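(* Let $J\neq F_n^\infty$ be a WOT-closed two-sided ideal of $F_n^\infty$ and let $T:=[T_1,\ldots,T_n]$, $T_i\in B(\mathcal H)$, and $T':=[T_1',\ldots,T_n']$, $T_i'\in B(\mathcal H')$, be two $J$-constrained completely non-coisometric row contractions. Then $T$ and $T'$ are unitarily equivalent if and only if their constrained characteristic functions $\Theta_{J,T}$ and $\Theta_{J,T'}$ coincide.
   Context: Fock space. $n\in\{1,2,\ldots\}$; $H_n$ is an $n$-dimensional complex Hilbert space with orthonormal basis $e_1,\ldots,e_n$; $F^2(H_n):=\bigoplus_{k\ge0}H_n^{\otimes k}$ is the full Fock space, with $H_n^{\otimes0}:=\mathbb C1$. The left creation operators are $S_i\varphi:=e_i\otimes\varphi$ and the right creation operators are $R_i\varphi:=\varphi\otimes e_i$. $\mathbb F_n^+$ is the unital free semigroup on generators $g_1,\ldots,g_n$ with identity $g_0$; for $\alpha=g_{i_1}\cdots g_{i_k}$, $|\alpha|:=k$, $T_\alpha:=T_{i_1}\cdots T_{i_k}$, $e_\alpha:=e_{i_1}\otimes\cdots\otimes e_{i_k}$, with $|g_0|=0$, $T_{g_0}=I$, $e_{g_0}=1$. $F_n^\infty$ (the noncommutative analytic Toeplitz algebra) is the WOT-closed algebra generated by $S_1,\ldots,S_n$ and the identity; each $f\in F_n^\infty$ has a formal Fourier series $\sum_\alpha a_\alpha S_\alpha$, where $f(1)=\sum_\alpha a_\alpha e_\alpha$. Row contractions. $T=[T_1,\ldots,T_n]$, $T_i\in B(\mathcal H)$ ($\mathcal H$ a Hilbert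 space), is a row contraction if $\sum_iT_iT_i^*\le I$. It is completely non-coisometric (c.n.c.) if there is no $h\in\mathcal H$, $h\ne0$, with $\sum_{|\alpha|=k}\|T_\alpha^*h\|^2=\|h\|^2$ for all $k=1,2,\ldots$. For $T$ c.n.c. and $f=\sum a_\alpha S_\alpha\in F_n^\infty$, the limit $f(T_1,\ldots,T_n):=\text{SOT-}\lim_{r\to1^-}\sum_{k=0}^\infty\sum_{|\alpha|=k}r^{|\alpha|}a_\alpha T_\alpha$ exists ($F_n^\infty$-functional calculus; $f\mapsto f(T_1,\ldots,T_n)$ is a WOT-continuous completely contractive homomorphism). A c.n.c. row contraction $T$ is $J$-constrained if $\varphi(T_1,\ldots,T_n)=0$ for all $\varphi\in J$. Row contractions $T$ on $\mathcal H$ and $T'$ on $\mathcal H'$ are (unitarily) equivalent if there is a unitary $U:\mathcal H\to\mathcal H'$ with $UT_i=T_i'U$ for all $i$. Constrained shifts. For a WOT-closed two-sided ideal $J\ne F_n^\infty$ of $F_n^\infty$: $\mathcal M_J:=\overline{JF^2(H_n)}$, $\mathcal N_J:=F^2(H_n)\ominus\mathcal M_J$, $B_i:=P_{\mathcal N_J}S_i|_{\mathcal N_J}$ (constrained left creation operators), $W_i:=P_{\mathcal N_J}R_i|_{\mathcal N_J}$ (constrained right creation operators). A bounded operator $M:\mathcal N_J\otimes\mathcal K\to\mathcal N_J\otimes\mathcal K'$ is multi-analytic with respect to $B_1,\ldots,B_n$ if $M(B_i\otimes I_{\mathcal K})=(B_i\otimes I_{\mathcal K'})M$ for all $i$. Two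 multi-analytic operators $\Phi:\mathcal N_J\otimes\mathcal K_1\to\mathcal N_J\otimes\mathcal K_2$ and $\Phi':\mathcal N_J\otimes\mathcal K_1'\to\mathcal N_J\otimes\mathcal K_2'$ coincide if there are unitary operators $\tau_j\in B(\mathcal K_j,\mathcal K_j')$, $j=1,2$, such that $\Phi'(I_{\mathcal N_J}\otimes\tau_1)=(I_{\mathcal N_J}\otimes\tau_2)\Phi$. Defects. $\Delta_T:=(I_{\mathcal H}-\sum_iT_iT_i^* )^{1/2}\in B(\mathcal H)$, $\Delta_{T^*}:=(I-T^*T)^{1/2}\in B(\mathcal H^{(n)})$, where $\mathcal H^{(n)}$ is the direct sum of $n$ copies of $\mathcal H$ and $T:\mathcal H^{(n)}\to\mathcal H$ is the row operator; $\mathcal D_T:=\overline{\Delta_T\mathcal H}$, $\mathcal D_{T^*}:=\overline{\Delta_{T^*}\mathcal H^{(n)}}$. Constrained characteristic function. $\Theta_{J,T}:\mathcal N_J\otimes\mathcal D_{T^*}\to\mathcal N_J\otimes\mathcal D_T$ is the multi-analytic operator (with respect to $B_1,\ldots,B_n$) with formal Fourier representation $$-I_{\mathcal N_J}\otimes T+(I_{\mathcal N_J}\otimes\Delta_T)\Big(I_{\mathcal N_J\otimes\mathcal H}-\sum_{i=1}^nW_i\otimes T_i^*\Big)^{-1}[W_1\otimes I_{\mathcal H},\ldots,W_n\otimes I_{\mathcal H}](I_{\mathcal N_J}\otimes\Delta_{T^*}).$$ Precisely, let $\Theta_T:F^2(H_n)\otimes\mathcal D_{T^*}\to F^2(H_n)\otimes\mathcal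 D_T$ be the characteristic function of $T$, i.e. the (contractive) operator satisfying $\Theta_T(S_i\otimes I)=(S_i\otimes I)\Theta_T$ for all $i$ whose formal Fourier representation is the same expression with $\mathcal N_J$ replaced by $F^2(H_n)$ and $W_i$ by $R_i$ (the inverse being expanded as a Neumann series); equivalently, $\Theta_T(1\otimes x)=-1\otimes Tx+\sum_{i=1}^n\sum_{\beta\in\mathbb F_n^+}e_i\otimes e_\beta\otimes\Delta_TT_\beta^*P_i\Delta_{T^*}x$ for $x\in\mathcal D_{T^*}$, where $P_i:\mathcal H^{(n)}\to\mathcal H$ is the $i$-th coordinate projection. Then $\Theta_{J,T}=P_{\mathcal N_J\otimes\mathcal D_T}\Theta_T|_{\mathcal N_J\otimes\mathcal D_{T^*}}$. *)

theory Defs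
  imports "HOL-Analysis.Analysis"
begin

section \<open>Complex Hilbert spaces\<close>

text \<open>The inner product \<open>cinner\<close> is linear in its first argument. The norm and the topology are
  those of the underlying real inner product space, whose inner product is the real part.\<close>

class complex_inner = real_inner +
  fixes scaleC :: "complex \<Rightarrow> 'a \<Rightarrow> 'a"  (infixr \<open>*\<^sub>C\<close> 75)
    and cinner :: "'a \<Rightarrow> 'a \<Rightarrow> complex"
  assumes scaleC_add_right: "c *\<^sub>C (x + y) = c *\<^sub>C x + c *\<^sub>C y"
    and scaleC_add_left: "(c + d) *\<^sub>C x = c *\<^sub>C x + d *\<^sub>C x"
    and scaleC_scaleC: "c *\<^sub>C (d *\<^sub>C x) = (c * d) *\<^sub>C x"
    and scaleR_scaleC: "r *\<^sub>R x = complex_of_real r *\<^sub>C x"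
    and cinner_commute: "cinner x y = cnj (cinner y x)"
    and cinner_add_left: "cinner (x + y) z = cinner x z + cinner y z"
    and cinner_scaleC_left: "cinner (c *\<^sub>C x) y = c * cinner x y"
    and inner_eq_Re_cinner: "inner x y = Re (cinner x y)"

class chilbert_space = complex_inner + complete_space

instantiation complex :: chilbert_space
begin

definition scaleC_complex :: "complex \<Rightarrow> complex \<Rightarrow> complex"
  where "scaleC_complex c x = c * x"

definition cinner_complex :: "complex \<Rightarrow> complex \<Rightarrow> complex"
  where "cinner_complex x y = x * cnj y"

instance
  by standard
    (simp_all add: scaleC_complex_def cinner_complex_def inner_complex_def algebra_simps scaleR_conv_of_real)

end

lemma scaleC_one: "1 *\<^sub>C x = (x::'a::complex_inner)"
  using scaleR_scaleC[of 1 x] by simp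

lemma cinner_self_eq_norm: "cinner x x = complex_of_real ((norm (x::'a::complex_inner))\<^sup>2)"
proof (rule complex_eqI)
  show "Re (cinner x x) = Re (complex_of_real ((norm x)\<^sup>2))"
    by (simp add: inner_eq_Re_cinner[symmetric] power2_norm_eq_inner)
  have "Im (cinner x x) = Im (cnj (cinner x x))"
    using cinner_commute[of x x] by simp
  then show "Im (cinner x x) = Im (complex_of_real ((norm x)\<^sup>2))"
    by simp
qed

lemma norm_scaleC: "norm (c *\<^sub>C x) = cmod c * norm (x::'a::complex_inner)"
proof -
  have "cinner (c *\<^sub>C x) (c *\<^sub>C x) = c * cnj c * cinner x x"
    by (metis cinner_commute cinner_scaleC_left complex_cnj_mult mult.assoc)
  then have "complex_of_real ((norm (c *\<^sub>C x))\<^sup>2) = complex_of_real ((cmod c * norm x)\<^sup>2)"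
    by (simp add: cinner_self_eq_norm power_mult_distrib complex_norm_square[symmetric]
        del: of_real_power of_real_mult)
      (simp add: complex_norm_square)
  then have "(norm (c *\<^sub>C x))\<^sup>2 = (cmod c * norm x)\<^sup>2"
    using of_real_eq_iff by blast
  then show ?thesis
    by (simp add: power2_eq_iff_nonneg)
qed

lemma norm_cinner_le: "cmod (cinner x y) \<le> norm x * norm (y::'a::complex_inner)"
proof (cases "cinner x y = 0")
  case False
  define u where "u = cnj (cinner x y) / cmod (cinner x y)"
  have u: "cmod u = 1" using False by (simp add: u_def norm_divide)
  have "complex_of_real (cmod (cinner x y)) = cinner (u *\<^sub>C x) y"
    using False complex_norm_square[of "cinner x y"]
    by (simp add: cinner_scaleC_left u_def power2_eq_square field_simps)
  then have "cmod (cinner x y) = inner (u *\<^sub>C x) y"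
    by (metis Re_complex_of_real inner_eq_Re_cinner)
  also have "\<dots> \<le> norm (u *\<^sub>C x) * norm y"
    by (rule norm_cauchy_schwarz)
  finally show ?thesis by (simp add: norm_scaleC u)
qed simp

section \<open>Hilbert space direct sums\<close>

text \<open>The Hilbert direct sum of copies of a Hilbert space \<open>'a\<close> indexed by \<open>'i\<close>.\<close>

typedef (overloaded) ('i, 'a::complex_inner) ell2 =
  "{f :: 'i \<Rightarrow> 'a. (\<lambda>i. (norm (f i))\<^sup>2) summable_on UNIV}"
  morphisms comp_of Abs_ell2
  by (rule exI[of _ "\<lambda>_. 0"]) simp

setup_lifting type_definition_ell2

lemma comp_of_summable: "(\<lambda>i. (norm (comp_of f i))\<^sup>2) summable_on UNIV"
  using comp_of[of f] by simp

lemma sq_summable_add: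
  fixes f g :: "'i \<Rightarrow> 'a::real_inner"
  assumes "(\<lambda>i. (norm (f i))\<^sup>2) summable_on UNIV" "(\<lambda>i. (norm (g i))\<^sup>2) summable_on UNIV"
  shows "(\<lambda>i. (norm (f i + g i))\<^sup>2) summable_on UNIV"
proof (rule summable_on_comparison_test)
  show "(\<lambda>i. 2 * (norm (f i))\<^sup>2 + 2 * (norm (g i))\<^sup>2) summable_on UNIV"
    using assms by (intro summable_on_add summable_on_cmult_right)
  show "(norm (f i + g i))\<^sup>2 \<le> 2 * (norm (f i))\<^sup>2 + 2 * (norm (g i))\<^sup>2" for i
  proof -
    have "(norm (f i + g i))\<^sup>2 \<le> (norm (f i) + norm (g i))\<^sup>2"
      by (intro power_mono norm_triangle_ineq) simp
    also have "\<dots> \<le> 2 * (norm (f i))\<^sup>2 + 2 * (norm (g i))\<^sup>2"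
      using sum_squares_bound[of "norm (f i)" "norm (g i)"] by (simp add: power2_sum)
    finally show ?thesis .
  qed
qed simp

lemma sq_summable_scaleC:
  fixes f :: "'i \<Rightarrow> 'a::complex_inner"
  assumes "(\<lambda>i. (norm (f i))\<^sup>2) summable_on UNIV"
  shows "(\<lambda>i. (norm (c *\<^sub>C f i))\<^sup>2) summable_on UNIV"
  using summable_on_cmult_right[OF assms, of "(cmod c)\<^sup>2"]
  by (simp add: norm_scaleC power_mult_distrib)

lemma cinner_summable:
  "(\<lambda>i. cinner (comp_of f i) (comp_of g i)) summable_on UNIV"
proof (rule abs_summable_summable, rule summable_on_comparison_test)
  show "(\<lambda>i. (norm (comp_of f i))\<^sup>2 + (norm (comp_of g i))\<^sup>2) summable_on UNIV"
    by (intro summable_on_add comp_of_summable)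
  show "norm (cinner (comp_of f i) (comp_of g i))
      \<le> (norm (comp_of f i))\<^sup>2 + (norm (comp_of g i))\<^sup>2" for i
  proof -
    have "norm (comp_of f i) * norm (comp_of g i)
        \<le> (norm (comp_of f i))\<^sup>2 + (norm (comp_of g i))\<^sup>2"
      using sum_squares_bound[of "norm (comp_of f i)" "norm (comp_of g i)"]
        mult_nonneg_nonneg[OF norm_ge_zero norm_ge_zero, of "comp_of f i" "comp_of g i"]
      by linarith
    then show ?thesis using norm_cinner_le order_trans by blast
  qed
qed simp

instantiation ell2 :: (type, complex_inner) complex_inner
begin

lift_definition zero_ell2 :: "('a, 'b) ell2" is "\<lambda>_. 0" by simp
lift_definition plus_ell2 :: "('a, 'b) ell2 \<Rightarrow> ('a, 'b) ell2 \<Rightarrow> ('a, 'b) ell2"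
  is "\<lambda>f g i. f i + g i" by (rule sq_summable_add)
lift_definition uminus_ell2 :: "('a, 'b) ell2 \<Rightarrow> ('a, 'b) ell2"
  is "\<lambda>f i. - f i" by simp
lift_definition minus_ell2 :: "('a, 'b) ell2 \<Rightarrow> ('a, 'b) ell2 \<Rightarrow> ('a, 'b) ell2"
  is "\<lambda>f g i. f i - g i"
  subgoal for f g using sq_summable_add[of f "\<lambda>i. - g i"] by simp
  done
lift_definition scaleC_ell2 :: "complex \<Rightarrow> ('a, 'b) ell2 \<Rightarrow> ('a, 'b) ell2"
  is "\<lambda>c f i. c *\<^sub>C f i" by (rule sq_summable_scaleC)

definition scaleR_ell2 :: "real \<Rightarrow> ('a, 'b) ell2 \<Rightarrow> ('a, 'b) ell2"
  where "scaleR_ell2 r f = complex_of_real r *\<^sub>C f"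
definition cinner_ell2 :: "('a, 'b) ell2 \<Rightarrow> ('a, 'b) ell2 \<Rightarrow> complex"
  where "cinner_ell2 f g = (\<Sum>\<^sub>\<infinity>i. cinner (comp_of f i) (comp_of g i))"
definition inner_ell2 :: "('a, 'b) ell2 \<Rightarrow> ('a, 'b) ell2 \<Rightarrow> real"
  where "inner_ell2 f g = Re (cinner f g)"
definition norm_ell2 :: "('a, 'b) ell2 \<Rightarrow> real"
  where "norm_ell2 f = sqrt (inner f f)"
definition dist_ell2 :: "('a, 'b) ell2 \<Rightarrow> ('a, 'b) ell2 \<Rightarrow> real"
  where "dist_ell2 f g = norm (f - g)"
definition sgn_ell2 :: "('a, 'b) ell2 \<Rightarrow> ('a, 'b) ell2"
  where "sgn_ell2 f = inverse (norm f) *\<^sub>R f"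
definition uniformity_ell2 :: "(('a, 'b) ell2 \<times> ('a, 'b) ell2) filter"
  where "uniformity_ell2 = (INF e\<in>{0<..}. principal {(f, g). dist f g < e})"
definition open_ell2 :: "('a, 'b) ell2 set \<Rightarrow> bool"
  where "open_ell2 U \<longleftrightarrow>
    (\<forall>x\<in>U. \<forall>\<^sub>F (x', y) in uniformity. x' = x \<longrightarrow> y \<in> U)"

instance
proof
  fix f g h :: "('a, 'b) ell2" and c d :: complex and r s :: real
  show "f + g + h = f + (g + h)" "f + g = g + f" "0 + f = f" "- f + f = 0" "f - g = f + - g"
    by (transfer; simp add: add_ac)+
  show "c *\<^sub>C (f + g) = c *\<^sub>C f + c *\<^sub>C g" "(c + d) *\<^sub>C f = c *\<^sub>C f + d *\<^sub>C f"
    "c *\<^sub>C d *\<^sub>C f = (c * d) *\<^sub>C f"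
    by (transfer; simp add: scaleC_add_right scaleC_add_left scaleC_scaleC)+
  show "r *\<^sub>R (f + g) = r *\<^sub>R f + r *\<^sub>R g" "(r + s) *\<^sub>R f = r *\<^sub>R f + s *\<^sub>R f"
    "r *\<^sub>R s *\<^sub>R f = (r * s) *\<^sub>R f" "1 *\<^sub>R f = f" "r *\<^sub>R f = complex_of_real r *\<^sub>C f"
    unfolding scaleR_ell2_def of_real_add of_real_mult of_real_1
    by (transfer; simp add: scaleC_add_right scaleC_add_left scaleC_scaleC scaleC_one)+
  show comm: "cinner f g = cnj (cinner g f)" for f g :: "('a, 'b) ell2"
    unfolding cinner_ell2_def infsum_cnj[symmetric] by (intro infsum_cong cinner_commute)
  show add: "cinner (f + g) h = cinner f h + cinner g h"
    unfolding cinner_ell2_def plus_ell2.rep_eq cinner_add_left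
    by (rule infsum_add[OF cinner_summable cinner_summable])
  show scal: "cinner (c *\<^sub>C f) g = c * cinner f g" for c
    unfolding cinner_ell2_def scaleC_ell2.rep_eq cinner_scaleC_left
    by (rule infsum_cmult_right')
  show "inner f g = Re (cinner f g)" by (simp add: inner_ell2_def)
  show "inner f g = inner g f"
    using comm[of f g] by (simp add: inner_ell2_def)
  show "inner (f + g) h = inner f h + inner g h"
    by (simp add: inner_ell2_def add)
  show "inner (r *\<^sub>R f) g = r * inner f g"
    by (simp add: inner_ell2_def scaleR_ell2_def scal)
  have self: "inner f f = (\<Sum>\<^sub>\<infinity>i. (norm (comp_of f i))\<^sup>2)"
    unfolding inner_ell2_def cinner_ell2_def cinner_self_eq_norm
    by (subst infsum_Re[symmetric]) (use cinner_summable[of f f] in \<open>simp_all add: cinner_self_eq_norm\<close>)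
  show "0 \<le> inner f f" unfolding self by (rule infsum_nonneg) simp
  show "inner f f = 0 \<longleftrightarrow> f = 0"
  proof
    assume "inner f f = 0"
    then have "(norm (comp_of f i))\<^sup>2 = 0" for i
      unfolding self
      by (intro nonneg_infsum_le_0D[of "\<lambda>i. (norm (comp_of f i))\<^sup>2" UNIV])
        (auto simp: comp_of_summable)
    then show "f = 0" by (auto simp: comp_of_inject[symmetric] zero_ell2.rep_eq)
  next
    assume "f = 0"
    then show "inner f f = 0" unfolding self by (simp add: zero_ell2.rep_eq)
  qed
  show "norm f = sqrt (inner f f)" by (simp add: norm_ell2_def)
  show "dist f g = norm (f - g)" by (simp add: dist_ell2_def)
  show "sgn f = inverse (norm f) *\<^sub>R f" by (simp add: sgn_ell2_def)
  show "uniformity = (INF e\<in>{0<..}. principal {(f :: ('a, 'b) ell2, g). dist f g < e})"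
    by (simp add: uniformity_ell2_def)
  show "open U \<longleftrightarrow> (\<forall>x\<in>U. \<forall>\<^sub>F (x', y) in uniformity. x' = x \<longrightarrow> y \<in> U)"
    for U :: "('a, 'b) ell2 set"
    by (simp add: open_ell2_def)
qed

end

lemma norm_ell2_sq: "(norm f)\<^sup>2 = (\<Sum>\<^sub>\<infinity>i. (norm (comp_of f i))\<^sup>2)"
proof -
  have "(norm f)\<^sup>2 = Re (cinner f f)"
    by (simp add: power2_norm_eq_inner inner_eq_Re_cinner)
  also have "\<dots> = (\<Sum>\<^sub>\<infinity>i. (norm (comp_of f i))\<^sup>2)"
    unfolding cinner_ell2_def cinner_self_eq_norm
    by (subst infsum_Re[symmetric]) (use cinner_summable[of f f] in \<open>simp_all add: cinner_self_eq_norm\<close>)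
  finally show ?thesis .
qed

lemma sum_norm_comp_le: "finite F \<Longrightarrow> (\<Sum>i\<in>F. (norm (comp_of f i))\<^sup>2) \<le> (norm f)\<^sup>2"
  unfolding norm_ell2_sq by (rule finite_sum_le_infsum[OF comp_of_summable]) auto

lemma norm_comp_le: "norm (comp_of f i) \<le> norm f"
  using sum_norm_comp_le[of "{i}" f] by (simp add: power2_le_iff_abs_le)

instance ell2 :: (type, chilbert_space) chilbert_space
proof
  fix X :: "nat \<Rightarrow> ('a, 'b) ell2"
  assume X: "Cauchy X"
  have "Cauchy (\<lambda>n. comp_of (X n) i)" for i
    unfolding Cauchy_def
  proof (intro allI impI)
    fix e :: real assume "e > 0"
    then obtain N where N: "\<forall>m\<ge>N. \<forall>n\<ge>N. dist (X m) (X n) < e"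
      using X unfolding Cauchy_def by blast
    have "dist (comp_of (X m) i) (comp_of (X n) i) \<le> dist (X m) (X n)" for m n
      using norm_comp_le[of "X m - X n" i] by (simp add: dist_norm minus_ell2.rep_eq)
    then show "\<exists>N. \<forall>m\<ge>N. \<forall>n\<ge>N. dist (comp_of (X m) i) (comp_of (X n) i) < e"
      using N by (meson le_less_trans)
  qed
  then have "\<forall>i. \<exists>l. (\<lambda>n. comp_of (X n) i) \<longlonglongrightarrow> l"
    using Cauchy_convergent convergent_def by blast
  then obtain l where l: "\<And>i. (\<lambda>n. comp_of (X n) i) \<longlonglongrightarrow> l i"
    by metis
  have tail: "\<exists>N. \<forall>n\<ge>N. \<forall>F. finite F \<longrightarrow> (\<Sum>i\<in>F. (norm (comp_of (X n) i - l i))\<^sup>2) \<le> e\<^sup>2"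
    if "e > 0" for e
  proof -
    obtain N where N: "\<forall>m\<ge>N. \<forall>n\<ge>N. dist (X m) (X n) < e"
      using X \<open>e > 0\<close> unfolding Cauchy_def by blast
    have "(\<Sum>i\<in>F. (norm (comp_of (X n) i - l i))\<^sup>2) \<le> e\<^sup>2" if "n \<ge> N" "finite F" for n F
    proof (rule tendsto_upperbound)
      show "((\<lambda>m. \<Sum>i\<in>F. (norm (comp_of (X n) i - comp_of (X m) i))\<^sup>2) \<longlongrightarrow>
          (\<Sum>i\<in>F. (norm (comp_of (X n) i - l i))\<^sup>2)) sequentially"
        by (intro tendsto_intros l)
      show "\<forall>\<^sub>F m in sequentially. (\<Sum>i\<in>F. (norm (comp_of (X n) i - comp_of (X m) i))\<^sup>2) \<le> e\<^sup>2"
        using eventually_ge_at_top[of N]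
      proof eventually_elim
        case (elim m)
        have "(\<Sum>i\<in>F. (norm (comp_of (X n) i - comp_of (X m) i))\<^sup>2) \<le> (norm (X n - X m))\<^sup>2"
          using sum_norm_comp_le[OF \<open>finite F\<close>, of "X n - X m"] by (simp add: minus_ell2.rep_eq)
        also have "\<dots> \<le> e\<^sup>2"
          using N elim \<open>n \<ge> N\<close> by (intro power_mono) (auto simp: dist_norm less_imp_le)
        finally show ?case .
      qed
    qed simp
    then show ?thesis by blast
  qed
  obtain N where N: "\<And>F. finite F \<Longrightarrow> (\<Sum>i\<in>F. (norm (comp_of (X N) i - l i))\<^sup>2) \<le> 1"
    using tail[of 1] by auto
  have "(\<lambda>i. (norm (comp_of (X N) i - l i))\<^sup>2) summable_on UNIV"
    by (rule nonneg_bounded_partial_sums_imp_summable_on[where C = 1])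
      (auto intro: eventually_finite_subsets_at_top_weakI N)
  from sq_summable_add[of "\<lambda>i. - (comp_of (X N) i - l i)" "comp_of (X N)"] this
  have ls: "(\<lambda>i. (norm (l i))\<^sup>2) summable_on UNIV"
    using comp_of_summable[of "X N"] by (simp add: norm_minus_commute)
  define L where "L = Abs_ell2 l"
  have L: "comp_of L = l"
    unfolding L_def by (rule Abs_ell2_inverse) (use ls in simp)
  have "X \<longlonglongrightarrow> L"
  proof (rule metric_LIMSEQ_I)
    fix e :: real assume "e > 0"
    then obtain N where N: "\<And>n F. n \<ge> N \<Longrightarrow> finite F \<Longrightarrow>
        (\<Sum>i\<in>F. (norm (comp_of (X n) i - l i))\<^sup>2) \<le> (e/2)\<^sup>2"
      using tail[of "e/2"] by auto
    have "dist (X n) L < e" if "n \<ge> N" for n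
    proof -
      have "(norm (X n - L))\<^sup>2 \<le> (e/2)\<^sup>2"
        unfolding norm_ell2_sq
        by (rule infsum_le_finite_sums[OF comp_of_summable])
          (use N[OF that] in \<open>simp add: minus_ell2.rep_eq L\<close>)
      then have "norm (X n - L) \<le> e/2"
        using \<open>e > 0\<close> by (simp add: power2_le_iff_abs_le)
      then show ?thesis using \<open>e > 0\<close> by (simp add: dist_norm)
    qed
    then show "\<exists>N. \<forall>n\<ge>N. dist (X n) L < e" by blast
  qed
  then show "convergent X" by (rule convergentI)
qed

section \<open>Operators and subspaces\<close>

definition bounded_clinear :: "('a::complex_inner \<Rightarrow> 'b::complex_inner) \<Rightarrow> bool"
  where "bounded_clinear A \<longleftrightarrow> bounded_linear A \<and> (\<forall>c x. A (c *\<^sub>C x) = c *\<^sub>C A x)"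

definition cadjoint :: "('a::complex_inner \<Rightarrow> 'b::complex_inner) \<Rightarrow> 'b \<Rightarrow> 'a"
  where "cadjoint A = (THE B. \<forall>x y. cinner (A x) y = cinner x (B y))"

definition positive_op :: "('a::complex_inner \<Rightarrow> 'a) \<Rightarrow> bool"
  where "positive_op A \<longleftrightarrow> bounded_clinear A \<and> (\<forall>x. cinner (A x) x \<in> \<real>\<^sub>\<ge>\<^sub>0)"

definition positive_sqrt :: "('a::complex_inner \<Rightarrow> 'a) \<Rightarrow> 'a \<Rightarrow> 'a"
  where "positive_sqrt A = (THE B. positive_op B \<and> B \<circ> B = A)"

definition closed_csubspace :: "'a::complex_inner set \<Rightarrow> bool"
  where "closed_csubspace M \<longleftrightarrow> subspace M \<and> (\<forall>c. \<forall>x\<in>M. c *\<^sub>C x \<in> M) \<and> closed M"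

definition ortho_compl :: "'a::complex_inner set \<Rightarrow> 'a set"
  where "ortho_compl M = {x. \<forall>y\<in>M. cinner x y = 0}"

definition ortho_proj :: "'a::complex_inner set \<Rightarrow> 'a \<Rightarrow> 'a"
  where "ortho_proj M x = (THE p. p \<in> M \<and> x - p \<in> ortho_compl M)"

text \<open>Operators between closed subspaces are represented by functions on the ambient types of
  which only the values on the domain subspace matter.\<close>

definition clinear_on :: "'a::complex_inner set \<Rightarrow> ('a \<Rightarrow> 'b::complex_inner) \<Rightarrow> bool"
  where "clinear_on M A \<longleftrightarrow>
    (\<forall>x\<in>M. \<forall>y\<in>M. A (x + y) = A x + A y) \<and> (\<forall>c. \<forall>x\<in>M. A (c *\<^sub>C x) = c *\<^sub>C A x)"

definition contraction_between ::
    "'a::complex_inner set \<Rightarrow> 'b::complex_inner set \<Rightarrow> ('a \<Rightarrow> 'b) \<Rightarrow> bool"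
  where "contraction_between M N A \<longleftrightarrow>
    clinear_on M A \<and> A ` M \<subseteq> N \<and> (\<forall>x\<in>M. norm (A x) \<le> norm x)"

definition unitary_between ::
    "'a::complex_inner set \<Rightarrow> 'b::complex_inner set \<Rightarrow> ('a \<Rightarrow> 'b) \<Rightarrow> bool"
  where "unitary_between M N U \<longleftrightarrow>
    clinear_on M U \<and> U ` M = N \<and> (\<forall>x\<in>M. \<forall>y\<in>M. cinner (U x) (U y) = cinner x y)"

definition wot :: "('a::complex_inner \<Rightarrow> 'b::complex_inner) topology"
  where "wot = pullback_topology {A. bounded_clinear A} (\<lambda>A (x, y). cinner (A x) y) euclidean"

section \<open>The full Fock space\<close>

text \<open>Words in the free semigroup on the generators indexed by \<open>'n\<close> are lists. Through the
  orthonormal basis of the \<open>e\<^sub>\<alpha>\<close>, the full Fock space \<open>F\<^sup>2(H\<^sub>n)\<close> with \<open>n = CARD('n)\<close> is the space of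
  square summable families of scalars indexed by words, and the Hilbert tensor product
  \<open>F\<^sup>2(H\<^sub>n) \<otimes> \<K>\<close> is the space of square summable families of vectors of \<open>\<K>\<close>.\<close>

type_synonym ('n, 'a) fock_tensor = "('n list, 'a) ell2"
type_synonym 'n fock = "('n, complex) fock_tensor"

text \<open>The operator \<open>S\<^sub>i \<otimes> I\<close>; for \<open>'a = complex\<close> it is \<open>S\<^sub>i\<close> itself.\<close>

lift_definition left_creation :: "'n \<Rightarrow> ('n, 'a::complex_inner) fock_tensor \<Rightarrow> ('n, 'a) fock_tensor"
  is "\<lambda>i f w. case w of [] \<Rightarrow> 0 | j # v \<Rightarrow> if j = i then f v else 0"
proof -
  fix i :: 'n and f :: "'n list \<Rightarrow> 'a"
  let ?g = "\<lambda>w. case w of [] \<Rightarrow> 0 | j # v \<Rightarrow> if j = i then f v else 0"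
  assume "(\<lambda>w. (norm (f w))\<^sup>2) summable_on UNIV"
  then have "(\<lambda>w. (norm (?g w))\<^sup>2) summable_on (range (Cons i))"
    by (subst summable_on_reindex) (auto simp: o_def)
  then show "(\<lambda>w. (norm (?g w))\<^sup>2) summable_on UNIV"
    by (rule summable_on_cong_neutral[THEN iffD1, rotated -1]) (auto split: list.splits)
qed

lift_definition simple_tensor :: "'n fock \<Rightarrow> 'a::complex_inner \<Rightarrow> ('n, 'a) fock_tensor"
  is "\<lambda>\<phi> x w. \<phi> w *\<^sub>C x"
proof -
  fix \<phi> :: "'n list \<Rightarrow> complex" and x :: 'a
  assume "(\<lambda>w. (norm (\<phi> w))\<^sup>2) summable_on UNIV"
  from summable_on_cmult_left[OF this, of "(norm x)\<^sup>2"]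
  show "(\<lambda>w. (norm (\<phi> w *\<^sub>C x))\<^sup>2) summable_on UNIV"
    by (simp add: norm_scaleC power_mult_distrib)
qed

lift_definition vacuum :: "'n fock" is "\<lambda>w. if w = [] then 1 else 0"
proof -
  have "(\<lambda>w::'n list. (norm (if w = [] then 1 else 0 :: complex))\<^sup>2) summable_on {[]}"
    by simp
  then show "(\<lambda>w::'n list. (norm (if w = [] then 1 else 0 :: complex))\<^sup>2) summable_on UNIV"
    by (rule summable_on_cong_neutral[THEN iffD1, rotated -1]) auto
qed

definition tensor_subspace ::
    "'n fock set \<Rightarrow> 'a::complex_inner set \<Rightarrow> ('n, 'a) fock_tensor set"
  where "tensor_subspace M K = closed_csubspace hull {simple_tensor \<phi> x |\<phi> x. \<phi> \<in> M \<and> x \<in> K}"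

text \<open>The operator \<open>I \<otimes> \<tau>\<close>. If \<open>\<tau>\<close> is bounded on the subspace \<open>\<K>\<close>, the family on the right hand
  side is square summable for all \<open>f\<close> with components in \<open>\<K>\<close>.\<close>

definition id_tensor ::
    "('a::complex_inner \<Rightarrow> 'b::complex_inner) \<Rightarrow> ('n, 'a) fock_tensor \<Rightarrow> ('n, 'b) fock_tensor"
  where "id_tensor \<tau> f = Abs_ell2 (\<lambda>w. \<tau> (comp_of f w))"

definition op_algebra :: "('a::complex_inner \<Rightarrow> 'a) set \<Rightarrow> bool"
  where "op_algebra X \<longleftrightarrow>
    (\<forall>A\<in>X. \<forall>B\<in>X. (\<lambda>x. A x + B x) \<in> X \<and> A \<circ> B \<in> X) \<and> (\<forall>c. \<forall>A\<in>X. (\<lambda>x. c *\<^sub>C A x) \<in> X)"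

definition nc_toeplitz :: "('n fock \<Rightarrow> 'n fock) set"
  where "nc_toeplitz = (\<lambda>X. op_algebra X \<and> closedin wot X) hull (insert id (range left_creation))"

definition wot_closed_ideal :: "('n fock \<Rightarrow> 'n fock) set \<Rightarrow> bool"
  where "wot_closed_ideal J \<longleftrightarrow>
    J \<subseteq> nc_toeplitz \<and> closedin wot J \<and> (\<lambda>_. 0) \<in> J \<and>
    (\<forall>\<phi>\<in>J. \<forall>\<psi>\<in>J. (\<lambda>x. \<phi> x + \<psi> x) \<in> J) \<and>
    (\<forall>\<phi>\<in>J. \<forall>\<psi>\<in>nc_toeplitz. \<phi> \<circ> \<psi> \<in> J \<and> \<psi> \<circ> \<phi> \<in> J)"

definition M_space :: "('n fock \<Rightarrow> 'n fock) set \<Rightarrow> 'n fock set"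
  where "M_space J = closed_csubspace hull {\<phi> f |\<phi> f. \<phi> \<in> J}"

definition N_space :: "('n fock \<Rightarrow> 'n fock) set \<Rightarrow> 'n fock set"
  where "N_space J = ortho_compl (M_space J)"

section \<open>Row contractions\<close>

text \<open>A tuple \<open>T\<^sub>1, \<dots>, T\<^sub>n\<close> is a function on the index type \<open>'n\<close>; the direct sum of \<open>n\<close> copies of the
  space is \<open>('n, 'h) ell2\<close>.\<close>

definition word_op :: "('n \<Rightarrow> 'h \<Rightarrow> 'h) \<Rightarrow> 'n list \<Rightarrow> 'h \<Rightarrow> 'h"
  where "word_op T \<alpha> = foldr (\<lambda>i A. T i \<circ> A) \<alpha> id"

definition row_op :: "('n::finite \<Rightarrow> 'h::complex_inner \<Rightarrow> 'h) \<Rightarrow> ('n, 'h) ell2 \<Rightarrow> 'h"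
  where "row_op T x = (\<Sum>i\<in>UNIV. T i (comp_of x i))"

definition row_contraction :: "('n::finite \<Rightarrow> 'h::complex_inner \<Rightarrow> 'h) \<Rightarrow> bool"
  where "row_contraction T \<longleftrightarrow>
    (\<forall>i. bounded_clinear (T i)) \<and> positive_op (\<lambda>h. h - (\<Sum>i\<in>UNIV. T i (cadjoint (T i) h)))"

definition completely_non_coisometric :: "('n::finite \<Rightarrow> 'h::complex_inner \<Rightarrow> 'h) \<Rightarrow> bool"
  where "completely_non_coisometric T \<longleftrightarrow>
    \<not> (\<exists>h. h \<noteq> 0 \<and>
      (\<forall>k\<ge>1. (\<Sum>\<alpha> | length \<alpha> = k. (norm (cadjoint (word_op T \<alpha>) h))\<^sup>2) = (norm h)\<^sup>2))"

text \<open>\<open>A\<close> is \<open>f(T\<^sub>1, \<dots>, T\<^sub>n)\<close>, that is, the limit defining it exists in the strong operator topology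
  and is \<open>A\<close>. The coefficients of \<open>f\<close> are those of the vector \<open>f(1)\<close>.\<close>

definition has_functional_calculus ::
    "('n::finite \<Rightarrow> 'h::complex_inner \<Rightarrow> 'h) \<Rightarrow> ('n fock \<Rightarrow> 'n fock) \<Rightarrow> ('h \<Rightarrow> 'h) \<Rightarrow> bool"
  where "has_functional_calculus T f A \<longleftrightarrow> bounded_clinear A \<and>
    (\<forall>h. ((\<lambda>r. \<Sum>k. \<Sum>\<alpha> | length \<alpha> = k.
        (complex_of_real r ^ length \<alpha> * comp_of (f vacuum) \<alpha>) *\<^sub>C word_op T \<alpha> h)
      \<longlongrightarrow> A h) (at_left 1))"

definition constrained ::
    "('n fock \<Rightarrow> 'n fock) set \<Rightarrow> ('n::finite \<Rightarrow> 'h::complex_inner \<Rightarrow> 'h) \<Rightarrow> bool"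
  where "constrained J T \<longleftrightarrow> (\<forall>\<phi>\<in>J. has_functional_calculus T \<phi> (\<lambda>_. 0))"

definition unitarily_equivalent ::
    "('n \<Rightarrow> 'h::complex_inner \<Rightarrow> 'h) \<Rightarrow> ('n \<Rightarrow> 'k::complex_inner \<Rightarrow> 'k) \<Rightarrow> bool"
  where "unitarily_equivalent T T' \<longleftrightarrow>
    (\<exists>U. unitary_between UNIV UNIV U \<and> (\<forall>i. U \<circ> T i = T' i \<circ> U))"

section \<open>Characteristic functions\<close>

definition defect_op :: "('n::finite \<Rightarrow> 'h::complex_inner \<Rightarrow> 'h) \<Rightarrow> 'h \<Rightarrow> 'h"
  where "defect_op T = positive_sqrt (\<lambda>h. h - (\<Sum>i\<in>UNIV. T i (cadjoint (T i) h)))"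

definition defect_op_star ::
    "('n::finite \<Rightarrow> 'h::complex_inner \<Rightarrow> 'h) \<Rightarrow> ('n, 'h) ell2 \<Rightarrow> ('n, 'h) ell2"
  where "defect_op_star T = positive_sqrt (\<lambda>x. x - cadjoint (row_op T) (row_op T x))"

definition defect_space :: "('n::finite \<Rightarrow> 'h::complex_inner \<Rightarrow> 'h) \<Rightarrow> 'h set"
  where "defect_space T = closure (range (defect_op T))"

definition defect_space_star :: "('n::finite \<Rightarrow> 'h::complex_inner \<Rightarrow> 'h) \<Rightarrow> ('n, 'h) ell2 set"
  where "defect_space_star T = closure (range (defect_op_star T))"

text \<open>The coefficients of \<open>\<Theta>\<^sub>T(1 \<otimes> x)\<close>: \<open>- T x\<close> at the empty word and
  \<open>\<Delta>\<^sub>T T\<^sub>\<beta>\<^sup>* P\<^sub>i \<Delta>\<^bsub>T\<^sup>*\<^esub> x\<close> at the word \<open>g\<^sub>i \<beta>\<close>.\<close>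

fun char_coeff :: "('n::finite \<Rightarrow> 'h::complex_inner \<Rightarrow> 'h) \<Rightarrow> 'n list \<Rightarrow> ('n, 'h) ell2 \<Rightarrow> 'h"
  where
    "char_coeff T [] x = - row_op T x"
  | "char_coeff T (i # \<beta>) x =
      defect_op T (cadjoint (word_op T \<beta>) (comp_of (defect_op_star T x) i))"

definition is_char_function ::
    "('n::finite \<Rightarrow> 'h::complex_inner \<Rightarrow> 'h) \<Rightarrow>
      (('n, ('n, 'h) ell2) fock_tensor \<Rightarrow> ('n, 'h) fock_tensor) \<Rightarrow> bool"
  where "is_char_function T \<Theta> \<longleftrightarrow>
    contraction_between (tensor_subspace UNIV (defect_space_star T))
      (tensor_subspace UNIV (defect_space T)) \<Theta> \<and>
    (\<forall>i. \<forall>f\<in>tensor_subspace UNIV (defect_space_star T).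
      \<Theta> (left_creation i f) = left_creation i (\<Theta> f)) \<and>
    (\<forall>x\<in>defect_space_star T. \<forall>\<alpha>. comp_of (\<Theta> (simple_tensor vacuum x)) \<alpha> = char_coeff T \<alpha> x)"

text \<open>The conditions determine \<open>\<Theta>\<^sub>T\<close> on \<open>F\<^sup>2(H\<^sub>n) \<otimes> \<D>\<^bsub>T\<^sup>*\<^esub>\<close>, which is its domain; the
  choice only concerns the irrelevant values elsewhere.\<close>

definition char_function ::
    "('n::finite \<Rightarrow> 'h::complex_inner \<Rightarrow> 'h) \<Rightarrow>
      ('n, ('n, 'h) ell2) fock_tensor \<Rightarrow> ('n, 'h) fock_tensor"
  where "char_function T = (SOME \<Theta>. is_char_function T \<Theta>)"

text \<open>The domain of \<open>\<Theta>\<^bsub>J,T\<^esub>\<close> is \<open>\<N>\<^sub>J \<otimes> \<D>\<^bsub>T\<^sup>*\<^esub>\<close>.\<close>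

definition constrained_char_function ::
    "('n fock \<Rightarrow> 'n fock) set \<Rightarrow> ('n::finite \<Rightarrow> 'h::complex_inner \<Rightarrow> 'h) \<Rightarrow>
      ('n, ('n, 'h) ell2) fock_tensor \<Rightarrow> ('n, 'h) fock_tensor"
  where "constrained_char_function J T f =
    ortho_proj (tensor_subspace (N_space J) (defect_space T)) (char_function T f)"

text \<open>\<open>\<Phi>\<close> is an operator from \<open>\<N>\<^sub>J \<otimes> K1\<close> to \<open>\<N>\<^sub>J \<otimes> K2\<close>, and \<open>\<Phi>'\<close> one from \<open>\<N>\<^sub>J \<otimes> K1'\<close> to
  \<open>\<N>\<^sub>J \<otimes> K2'\<close>.\<close>

definition coincide ::
    "('n fock \<Rightarrow> 'n fock) set \<Rightarrow>
      'a::complex_inner set \<Rightarrow> 'b::complex_inner set \<Rightarrow>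
      (('n, 'a) fock_tensor \<Rightarrow> ('n, 'b) fock_tensor) \<Rightarrow>
      'c::complex_inner set \<Rightarrow> 'd::complex_inner set \<Rightarrow>
      (('n, 'c) fock_tensor \<Rightarrow> ('n, 'd) fock_tensor) \<Rightarrow> bool"
  where "coincide J K1 K2 \<Phi> K1' K2' \<Phi>' \<longleftrightarrow>
    (\<exists>\<tau>1 \<tau>2. unitary_between K1 K1' \<tau>1 \<and> unitary_between K2 K2' \<tau>2 \<and>
      (\<forall>f\<in>tensor_subspace (N_space J) K1. \<Phi>' (id_tensor \<tau>1 f) = id_tensor \<tau>2 (\<Phi> f)))"

end

theory Submission
  imports Defs
begin

text \<open>Let \<open>K h = \<Sum>\<^sub>\<alpha> e\<^sub>\<alpha> \<otimes> \<Delta>\<^sub>T T\<^sub>\<alpha>\<^sup>* h\<close> be the Poisson kernel. It intertwines \<open>T\<^sub>i\<^sup>*\<close> with \<open>S\<^sub>i\<^sup>* \<otimes> I\<close>, is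
  injective since \<open>T\<close> is completely non-coisometric, and has its range in \<open>\<N>\<^sub>J \<otimes> \<D>\<^sub>T\<close> since \<open>T\<close> is
  \<open>J\<close>-constrained. As \<open>\<Theta>\<^sub>T\<close> is multi-analytic, \<open>\<Theta>\<^sub>T\<^sup>*\<close> maps \<open>\<N>\<^sub>J \<otimes> \<D>\<^sub>T\<close> into \<open>\<N>\<^sub>J \<otimes> \<D>\<^bsub>T\<^sup>*\<^esub>\<close>, so
  the identity \<open>\<Theta>\<^sub>T \<Theta>\<^sub>T\<^sup>* + K K\<^sup>* = I\<close> compresses to \<open>\<Theta>\<^bsub>J,T\<^esub> \<Theta>\<^bsub>J,T\<^esub>\<^sup>* + K K\<^sup>* = I\<close> on \<open>\<N>\<^sub>J \<otimes> \<D>\<^sub>T\<close>.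
  If \<open>\<Theta>\<^bsub>J,T\<^esub>\<close> and \<open>\<Theta>\<^bsub>J,T'\<^esub>\<close> coincide via \<open>\<tau>\<^sub>1, \<tau>\<^sub>2\<close>, then \<open>\<parallel>K\<^sup>* g\<parallel> = \<parallel>K'\<^sup>* (I \<otimes> \<tau>\<^sub>2) g\<parallel>\<close>, and
  \<open>K\<^sup>* g \<mapsto> K'\<^sup>* (I \<otimes> \<tau>\<^sub>2) g\<close> extends to a unitary operator that intertwines \<open>T\<close> and \<open>T'\<close>.\<close>

section \<open>Hilbert spaces\<close>

\<comment> \<open>\<open>char_function\<close> is only specified, by its values on 1 \<otimes> x and
  its commutation with the left creation operators, so a contraction with these properties must be
  produced. Its adjoint is the easier object: it commutes with the backward shifts, hence is
  determined by its component at the empty word, and this component is an explicit expression in the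
  Poisson kernel. \<Theta> is then obtained as an adjoint, and the energy count that makes it a
  contraction is the one that yields the identity with K; no Neumann series has to be summed. The
  compression to N_J is harmless because the slices of \<Theta> commute with all left creation
  operators and therefore with every element of J. A coincidence compares \<Theta> on N_J only, so K
  is not recovered from it directly: only the norms of adjoint Poisson transforms are compared, and
  polarization turns equality of norms into an isometry. In the converse direction every
  construction is natural in the unitary. The defect operators are natural because the square roots
  are limits of polynomials without constant term.\<close>
subclass (in chilbert_space) banach ..

lemma cinner_add_right: "cinner x (y + z) = cinner x y + cinner x (z::'a::complex_inner)"
  by (metis cinner_add_left cinner_commute complex_cnj_add)

lemma cinner_scaleC_right: "cinner x (c *\<^sub>C y) = cnj c * cinner x (y::'a::complex_inner)"
  by (metis cinner_scaleC_left cinner_commute complex_cnj_mult)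

lemma bounded_bilinear_cinner:
  "bounded_bilinear (cinner :: 'a::complex_inner \<Rightarrow> 'a \<Rightarrow> complex)"
proof
  show "\<exists>K. \<forall>a b::'a. norm (cinner a b) \<le> norm a * norm b * K"
    by (rule exI[of _ 1]) (simp add: norm_cinner_le)
qed (simp_all add: cinner_add_left cinner_add_right scaleR_scaleC cinner_scaleC_left
    cinner_scaleC_right scaleC_complex_def)

interpretation cinner: bounded_bilinear "cinner :: 'a::complex_inner \<Rightarrow> 'a \<Rightarrow> complex"
  by (rule bounded_bilinear_cinner)

lemmas cinner_simps = cinner_add_left cinner_add_right cinner_scaleC_left cinner_scaleC_right
  cinner.diff_left cinner.diff_right cinner.zero_left cinner.zero_right
  cinner.minus_left cinner.minus_right

lemma scaleC_zero_right [simp]: "c *\<^sub>C (0::'a::complex_inner) = 0"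
  using scaleC_add_right[of c 0 "0::'a"] by simp

lemma scaleC_zero_left [simp]: "0 *\<^sub>C (x::'a::complex_inner) = 0"
  using scaleC_add_left[of 0 0 x] by simp

declare scaleC_one [simp]

lemma scaleC_diff_right: "c *\<^sub>C (x - y) = c *\<^sub>C x - c *\<^sub>C (y::'a::complex_inner)"
  using scaleC_add_right[of c "x - y" y] by simp

lemma scaleC_sum_right: "c *\<^sub>C (\<Sum>i\<in>A. f i) = (\<Sum>i\<in>A. c *\<^sub>C (f i :: 'a::complex_inner))"
  by (induction A rule: infinite_finite_induct) (simp_all add: scaleC_add_right)

lemma bounded_linear_scaleC: "bounded_linear (\<lambda>x::'a::complex_inner. c *\<^sub>C x)"
  by (rule bounded_linear_intro[where K="cmod c"])
    (simp_all add: scaleC_add_right scaleR_scaleC scaleC_scaleC norm_scaleC mult.commute)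

lemmas tendsto_scaleC = bounded_linear.tendsto[OF bounded_linear_scaleC]

lemma cinner_self_zero_iff: "cinner x x = 0 \<longleftrightarrow> x = (0::'a::complex_inner)"
  by (simp add: cinner_self_eq_norm)

lemma cinner_left_ext: "(\<And>z. cinner x z = cinner y z) \<Longrightarrow> x = (y::'a::complex_inner)"
  using cinner_self_zero_iff[of "x - y"] by (metis cinner.diff_left right_minus_eq)

lemma cinner_right_ext: "(\<And>z. cinner z x = cinner z y) \<Longrightarrow> x = (y::'a::complex_inner)"
  by (rule cinner_left_ext) (metis cinner_commute)

lemma norm_eq_of_cinner:
  "cinner x x = cinner y y \<Longrightarrow> norm (x::'a::complex_inner) = norm (y::'b::complex_inner)"
  by (metis cinner_self_eq_norm norm_ge_zero of_real_eq_iff power2_eq_iff_nonneg)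

lemma norm_sq_add:
  "(norm (x + y))\<^sup>2 = (norm x)\<^sup>2 + (norm y)\<^sup>2 + 2 * Re (cinner x (y::'a::complex_inner))"
  by (simp add: power2_norm_eq_inner inner_eq_Re_cinner[symmetric] inner_add_left inner_add_right
      inner_commute)

subsection \<open>Bounded operators\<close>

lemma bounded_clinearI:
  assumes "\<And>x y. A (x + y) = A x + A y" and "\<And>c x. A (c *\<^sub>C x) = c *\<^sub>C A x"
    and "\<And>x. norm (A x) \<le> K * norm x"
  shows "bounded_clinear A"
  unfolding bounded_clinear_def
  using assms by (auto intro!: bounded_linear_intro[where K=K] simp: scaleR_scaleC mult.commute)

lemma bounded_clinear_bounded_linear: "bounded_clinear A \<Longrightarrow> bounded_linear A"
  by (simp add: bounded_clinear_def)

lemma bounded_clinear_scaleC: "bounded_clinear A \<Longrightarrow> A (c *\<^sub>C x) = c *\<^sub>C A x"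
  by (simp add: bounded_clinear_def)

lemma bounded_clinear_add: "bounded_clinear A \<Longrightarrow> A (x + y) = A x + A y"
  by (simp add: bounded_clinear_def linear_add bounded_linear.linear)

lemma bounded_clinear_diff: "bounded_clinear A \<Longrightarrow> A (x - y) = A x - A y"
  by (simp add: bounded_clinear_def linear_diff bounded_linear.linear)

lemma bounded_clinear_zero: "bounded_clinear A \<Longrightarrow> A 0 = 0"
  by (simp add: bounded_clinear_def linear_0 bounded_linear.linear)

lemma bounded_clinear_sum: "bounded_clinear A \<Longrightarrow> A (\<Sum>i\<in>I. f i) = (\<Sum>i\<in>I. A (f i))"
  by (simp add: bounded_clinear_def linear_sum bounded_linear.linear)

lemma bounded_clinear_id: "bounded_clinear id" "bounded_clinear (\<lambda>x. x)"
  by (rule bounded_clinearI[where K=1]; simp)+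

lemma bounded_clinear_compose:
  "bounded_clinear A \<Longrightarrow> bounded_clinear B \<Longrightarrow> bounded_clinear (\<lambda>x. A (B x))"
  unfolding bounded_clinear_def by (auto intro: bounded_linear_compose)

lemma bounded_clinear_plus:
  "bounded_clinear A \<Longrightarrow> bounded_clinear B \<Longrightarrow> bounded_clinear (\<lambda>x. A x + B x)"
  unfolding bounded_clinear_def by (auto intro: bounded_linear_add simp: scaleC_add_right)

lemma bounded_clinear_minus:
  "bounded_clinear A \<Longrightarrow> bounded_clinear B \<Longrightarrow> bounded_clinear (\<lambda>x. A x - B x)"
  unfolding bounded_clinear_def by (auto intro: bounded_linear_sub simp: scaleC_diff_right)

lemma bounded_clinear_smult:
  assumes "bounded_clinear A" shows "bounded_clinear (\<lambda>x. c *\<^sub>C A x)"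
  unfolding bounded_clinear_def
  using assms bounded_linear_compose[OF bounded_linear_scaleC, of A c]
  by (auto simp: bounded_clinear_def scaleC_scaleC mult.commute)

lemma bounded_clinear_bigsum:
  "(\<And>i. i \<in> I \<Longrightarrow> bounded_clinear (A i)) \<Longrightarrow> bounded_clinear (\<lambda>x. \<Sum>i\<in>I. A i x)"
  by (induction I rule: infinite_finite_induct)
    (auto intro: bounded_clinear_plus bounded_clinearI[where K=0])

subsection \<open>Closed subspaces\<close>

lemma closed_csubspaceI:
  assumes "0 \<in> M" "\<And>x y. x \<in> M \<Longrightarrow> y \<in> M \<Longrightarrow> x + y \<in> M" "\<And>c x. x \<in> M \<Longrightarrow> c *\<^sub>C x \<in> M"
    "closed M"
  shows "closed_csubspace M"
  using assms by (auto simp: closed_csubspace_def subspace_def scaleR_scaleC)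

lemma
  assumes "closed_csubspace M"
  shows closed_csubspace_0: "0 \<in> M"
    and closed_csubspace_add: "x \<in> M \<Longrightarrow> y \<in> M \<Longrightarrow> x + y \<in> M"
    and closed_csubspace_diff: "x \<in> M \<Longrightarrow> y \<in> M \<Longrightarrow> x - y \<in> M"
    and closed_csubspace_scaleC: "x \<in> M \<Longrightarrow> c *\<^sub>C x \<in> M"
    and closed_csubspace_closed: "closed M"
  using assms
  by (auto simp: closed_csubspace_def subspace_def intro: subspace_diff[unfolded subspace_def])

lemma closed_csubspace_UNIV: "closed_csubspace UNIV"
  by (rule closed_csubspaceI) auto

lemma closed_csubspace_Inter: "(\<And>M. M \<in> X \<Longrightarrow> closed_csubspace M) \<Longrightarrow> closed_csubspace (\<Inter>X)"
  by (auto intro!: closed_csubspaceI closed_Inter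
      simp: closed_csubspace_0 closed_csubspace_add closed_csubspace_scaleC closed_csubspace_closed)

lemma closed_csubspace_hull: "closed_csubspace (closed_csubspace hull S)"
  by (rule hull_in) (rule closed_csubspace_Inter, auto)

lemma closed_csubspace_vimage:
  assumes A: "bounded_clinear A" and M: "closed_csubspace M"
  shows "closed_csubspace {x. A x \<in> M}"
proof (rule closed_csubspaceI)
  have "closed (A -` M)"
    using closed_csubspace_closed[OF M] bounded_clinear_bounded_linear[OF A]
    by (intro continuous_closed_vimage) (auto simp: linear_continuous_at)
  then show "closed {x. A x \<in> M}" by (simp add: vimage_def)
qed (use M A in \<open>auto simp: bounded_clinear_zero bounded_clinear_add bounded_clinear_scaleC
      closed_csubspace_0 closed_csubspace_add closed_csubspace_scaleC\<close>)

lemma closed_csubspace_zero: "closed_csubspace {0}"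
  by (rule closed_csubspaceI) auto

lemma bounded_clinear_cinner_left: "bounded_clinear (\<lambda>x. cinner x y)"
  by (rule bounded_clinearI[where K="norm y"])
    (auto simp: cinner_simps scaleC_complex_def norm_cinner_le mult.commute[of "norm y"])

section \<open>Orthogonal complements and projections\<close>

lemma closed_csubspace_ortho_compl: "closed_csubspace (ortho_compl M)"
proof -
  have "ortho_compl M = \<Inter> ((\<lambda>y. {x. cinner x y \<in> {0}}) ` M)"
    by (auto simp: ortho_compl_def)
  then show ?thesis
    using closed_csubspace_vimage[OF bounded_clinear_cinner_left closed_csubspace_zero]
    by (auto intro!: closed_csubspace_Inter)
qed

lemma ortho_compl_sym: "x \<in> ortho_compl M \<Longrightarrow> y \<in> M \<Longrightarrow> cinner y x = 0"
  by (metis (mono_tags, lifting) cinner_commute complex_cnj_zero mem_Collect_eq ortho_compl_def)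

lemma ortho_complD: "x \<in> ortho_compl M \<Longrightarrow> y \<in> M \<Longrightarrow> cinner x y = 0"
  by (simp add: ortho_compl_def)

lemma ortho_complI: "(\<And>y. y \<in> M \<Longrightarrow> cinner x y = 0) \<Longrightarrow> x \<in> ortho_compl M"
  by (simp add: ortho_compl_def)

lemma ortho_compl_hull: "ortho_compl (closed_csubspace hull S) = ortho_compl S"
proof
  show "ortho_compl (closed_csubspace hull S) \<subseteq> ortho_compl S"
    using hull_subset[of S closed_csubspace] by (auto simp: ortho_compl_def)
  show "ortho_compl S \<subseteq> ortho_compl (closed_csubspace hull S)"
  proof
    fix x assume x: "x \<in> ortho_compl S"
    have "closed_csubspace hull S \<subseteq> ortho_compl {x}"
      using x by (intro hull_minimal closed_csubspace_ortho_compl)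
        (auto simp: ortho_compl_sym intro: ortho_complI)
    then show "x \<in> ortho_compl (closed_csubspace hull S)"
      by (auto intro!: ortho_complI dest!: subsetD ortho_compl_sym)
  qed
qed

text \<open>A minimizing sequence for the distance to \<open>M\<close> is Cauchy by the
  parallelogram law, and minimality of its limit under small displacements along \<open>M\<close> is
  orthogonality.\<close>

lemma ex_ortho_proj:
  fixes x :: "'a::chilbert_space"
  assumes M: "closed_csubspace M"
  shows "\<exists>p\<in>M. x - p \<in> ortho_compl M"
proof -
  define d where "d = infdist x M"
  have d0: "d \<ge> 0" by (simp add: d_def infdist_nonneg)
  have M0: "M \<noteq> {}" using closed_csubspace_0[OF M] by auto
  have dle: "d \<le> norm (x - a)" if "a \<in> M" for a
    using infdist_le[OF that] by (simp add: d_def dist_norm)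
  have "\<exists>a\<in>M. norm (x - a) < d + 1 / Suc n" for n
  proof -
    have "(INF a\<in>M. dist x a) < d + 1 / Suc n"
      using M0 by (simp add: d_def infdist_def)
    then show ?thesis
      using M0 by (subst (asm) cInf_less_iff) (auto intro: bdd_belowI[of _ 0] simp: dist_norm)
  qed
  then obtain a where aM: "\<And>n. a n \<in> M" and a: "\<And>n. norm (x - a n) < d + 1 / Suc n"
    by metis
  \<comment> \<open>The midpoint of \<open>a m\<close> and \<open>a n\<close> lies in
    \<open>M\<close>, so the sum of the two error vectors has norm at least \<open>2 * d\<close>;
    the parallelogram law then bounds their difference.\<close>
  have par: "(norm (a m - a n))\<^sup>2 \<le> 4 * ((d + e)\<^sup>2 - d\<^sup>2)"
    if "norm (x - a m) \<le> d + e" "norm (x - a n) \<le> d + e" for m n e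
  proof -
    define u where "u = x - a m"
    define v where "v = x - a n"
    have "(1/2) *\<^sub>R (a m + a n) \<in> M"
      using M aM by (auto simp: scaleR_scaleC intro!: closed_csubspace_scaleC closed_csubspace_add)
    from dle[OF this] have "d \<le> norm ((1/2) *\<^sub>R (u + v))"
      by (simp add: u_def v_def algebra_simps) (simp add: scaleR_left_distrib[symmetric])
    then have d4: "4 * d\<^sup>2 \<le> (norm (u + v))\<^sup>2"
      using power_mono[OF _ d0, of "norm ((1/2) *\<^sub>R (u + v))" 2]
      by (simp add: power_divide)
    have "(norm u)\<^sup>2 \<le> (d + e)\<^sup>2" "(norm v)\<^sup>2 \<le> (d + e)\<^sup>2"
      using that by (auto simp: u_def v_def intro!: power_mono)
    moreover have "(norm (u - v))\<^sup>2 + (norm (u + v))\<^sup>2 = 2 * (norm u)\<^sup>2 + 2 * (norm v)\<^sup>2"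
      by (simp add: power2_norm_eq_inner inner_simps inner_commute)
    moreover have "norm (a m - a n) = norm (u - v)"
      by (simp add: u_def v_def norm_minus_commute)
    ultimately show ?thesis using d4 by simp
  qed
  have "Cauchy a"
  proof (rule metric_CauchyI)
    fix e :: real assume "e > 0"
    have "(\<lambda>n. 4 * ((d + 1 / real (Suc n))\<^sup>2 - d\<^sup>2)) \<longlonglongrightarrow> 4 * ((d + 0)\<^sup>2 - d\<^sup>2)"
      by (intro tendsto_intros LIMSEQ_Suc[OF lim_1_over_n, unfolded o_def])
    then have "\<forall>\<^sub>F n in sequentially. 4 * ((d + 1 / real (Suc n))\<^sup>2 - d\<^sup>2) < e\<^sup>2"
      by (rule order_tendstoD) (use \<open>e > 0\<close> in simp)
    then obtain N where N: "4 * ((d + 1 / real (Suc N))\<^sup>2 - d\<^sup>2) < e\<^sup>2"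
      by (auto simp: eventually_sequentially)
    have le: "norm (x - a n) \<le> d + 1 / real (Suc N)" if "n \<ge> N" for n
    proof -
      have "1 / real (Suc n) \<le> 1 / real (Suc N)" using that by (simp add: frac_le)
      then show ?thesis using a[of n] by linarith
    qed
    have "dist (a m) (a n) < e" if "m \<ge> N" "n \<ge> N" for m n
    proof -
      have "(norm (a m - a n))\<^sup>2 < e\<^sup>2"
        using par[OF le[OF that(1)] le[OF that(2)]] N by linarith
      then show ?thesis
        using \<open>e > 0\<close> by (simp add: dist_norm power_less_imp_less_base)
    qed
    then show "\<exists>N. \<forall>m\<ge>N. \<forall>n\<ge>N. dist (a m) (a n) < e" by blast
  qed
  then obtain p where p: "a \<longlonglongrightarrow> p"
    using Cauchy_convergent convergent_def by blast
  have pM: "p \<in> M"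
    using closed_csubspace_closed[OF M] p aM closed_sequentially by blast
  have "norm (x - p) \<le> d + 0"
  proof (rule LIMSEQ_le)
    show "(\<lambda>n. norm (x - a n)) \<longlonglongrightarrow> norm (x - p)" by (intro tendsto_intros p)
    show "(\<lambda>n. d + 1 / real (Suc n)) \<longlonglongrightarrow> d + 0"
      by (intro tendsto_intros LIMSEQ_Suc[OF lim_1_over_n, unfolded o_def])
  qed (use a in \<open>auto intro: less_imp_le\<close>)
  then have npd: "norm (x - p) \<le> d" by simp
  have re0: "Re (cinner (x - p) m) = 0" if "m \<in> M" for m
  proof (cases "m = 0")
    case False
    \<comment> \<open>This \<open>t\<close> minimizes the norm of
      \<open>x - p - t *\<^sub>R m\<close>; the minimum lies below the squared norm of
      \<open>x - p\<close> by exactly the squared inner product over the squared norm of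
      \<open>m\<close>.\<close>
    define t where "t = inner (x - p) m / (norm m)\<^sup>2"
    have "p + t *\<^sub>R m \<in> M"
      using M pM that by (auto simp: scaleR_scaleC intro!: closed_csubspace_scaleC closed_csubspace_add)
    from dle[OF this] npd have "norm (x - p) \<le> norm (x - p - t *\<^sub>R m)"
      by (simp add: diff_diff_eq)
    then have "(norm (x - p))\<^sup>2 \<le> (norm (x - p - t *\<^sub>R m))\<^sup>2"
      by (intro power_mono) auto
    also have "\<dots> = (norm (x - p))\<^sup>2 - 2 * t * inner (x - p) m + t\<^sup>2 * (norm m)\<^sup>2"
      unfolding power2_norm_eq_inner
      by (simp add: inner_diff_left inner_diff_right inner_commute power2_eq_square algebra_simps)
    also have "\<dots> = (norm (x - p))\<^sup>2 - (inner (x - p) m)\<^sup>2 / (norm m)\<^sup>2"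
      using False by (simp add: t_def power2_eq_square field_simps)
    finally have "(inner (x - p) m)\<^sup>2 / (norm m)\<^sup>2 \<le> 0" by simp
    moreover have "0 \<le> (inner (x - p) m)\<^sup>2 / (norm m)\<^sup>2" by simp
    ultimately have "(inner (x - p) m)\<^sup>2 / (norm m)\<^sup>2 = 0" by (rule antisym)
    then have "inner (x - p) m = 0" using False by simp
    then show ?thesis by (simp add: inner_eq_Re_cinner)
  qed (simp add: cinner_simps)
  have "x - p \<in> ortho_compl M"
  proof (rule ortho_complI)
    fix m assume m: "m \<in> M"
    \<comment> \<open>The variation along real multiples controls only the real part; replacing
      \<open>m\<close> by \<i> times \<open>m\<close> gives the imaginary part.\<close>
    have "Re (cinner (x - p) (\<i> *\<^sub>C m)) = 0"
      using re0 closed_csubspace_scaleC[OF M m] by blast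
    then show "cinner (x - p) m = 0"
      using re0[OF m] by (simp add: complex_eq_iff cinner_scaleC_right)
  qed
  then show ?thesis using pM by blast
qed

lemma ortho_proj_unique:
  assumes M: "closed_csubspace M" and p: "p \<in> M" "x - p \<in> ortho_compl M"
    and q: "q \<in> M" "x - q \<in> ortho_compl M"
  shows "p = q"
proof -
  have "p - q \<in> M" "p - q \<in> ortho_compl M"
    using closed_csubspace_diff[OF M p(1) q(1)]
      closed_csubspace_diff[OF closed_csubspace_ortho_compl q(2) p(2)] by auto
  then have "cinner (p - q) (p - q) = 0" by (simp add: ortho_complD)
  then show ?thesis by (simp add: cinner_self_zero_iff)
qed

lemma ortho_proj_eqI:
  assumes "closed_csubspace M" "p \<in> M" "x - p \<in> ortho_compl M"
  shows "ortho_proj M x = p"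
  unfolding ortho_proj_def using assms ortho_proj_unique[OF assms(1)] by (intro the_equality) blast+

lemma
  fixes x :: "'a::chilbert_space"
  assumes M: "closed_csubspace M"
  shows ortho_proj_in: "ortho_proj M x \<in> M"
    and ortho_proj_compl: "x - ortho_proj M x \<in> ortho_compl M"
  using ex_ortho_proj[OF M, of x] ortho_proj_eqI[OF M, of _ x] by auto

lemma cinner_ortho_proj:
  fixes x :: "'a::chilbert_space"
  assumes M: "closed_csubspace M" and "y \<in> M"
  shows "cinner (ortho_proj M x) y = cinner x y"
  using ortho_complD[OF ortho_proj_compl[OF M] \<open>y \<in> M\<close>, of x] by (simp add: cinner_simps)

text \<open>For \<open>x\<close> in \<open>N\<close>, the vector \<open>x - ortho_proj M x\<close>
  lies in \<open>N\<close> and is orthogonal to \<open>M\<close>. This is the form in which density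
  statements are proved below.\<close>

lemma closed_csubspace_eqI:
  fixes M N :: "'a::chilbert_space set"
  assumes M: "closed_csubspace M" and N: "closed_csubspace N" and "M \<subseteq> N"
    and *: "\<And>x. x \<in> N \<Longrightarrow> x \<in> ortho_compl M \<Longrightarrow> x = 0"
  shows "M = N"
proof
  show "N \<subseteq> M"
  proof
    fix x assume "x \<in> N"
    then have "x - ortho_proj M x \<in> N"
      using ortho_proj_in[OF M] \<open>M \<subseteq> N\<close> by (auto intro!: closed_csubspace_diff[OF N])
    with * ortho_proj_compl[OF M, of x] have "x - ortho_proj M x = 0" by blast
    then show "x \<in> M" using ortho_proj_in[OF M, of x] by simp
  qed
qed (rule \<open>M \<subseteq> N\<close>)

lemma closed_csubspace_closure:
  assumes "0 \<in> S" "\<And>x y. x \<in> S \<Longrightarrow> y \<in> S \<Longrightarrow> x + y \<in> S" "\<And>c x. x \<in> S \<Longrightarrow> c *\<^sub>C x \<in> S"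
  shows "closed_csubspace (closure S)"
proof (rule closed_csubspaceI)
  show "0 \<in> closure S" using assms(1) closure_subset by blast
  show "x + y \<in> closure S" if "x \<in> closure S" "y \<in> closure S" for x y
  proof -
    obtain f g where "\<forall>n. f n \<in> S" "f \<longlonglongrightarrow> x" "\<forall>n. g n \<in> S" "g \<longlonglongrightarrow> y"
      using \<open>x \<in> closure S\<close> \<open>y \<in> closure S\<close> unfolding closure_sequential by blast
    then show ?thesis
      using assms(2) tendsto_add[of f x sequentially g y]
      unfolding closure_sequential by (intro exI[of _ "\<lambda>n. f n + g n"]) auto
  qed
  show "c *\<^sub>C x \<in> closure S" if "x \<in> closure S" for c x
  proof -
    obtain f where "\<forall>n. f n \<in> S" "f \<longlonglongrightarrow> x"
      using \<open>x \<in> closure S\<close> unfolding closure_sequential by blast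
    then show ?thesis
      using assms(3) tendsto_scaleC[of f x sequentially c]
      unfolding closure_sequential by (intro exI[of _ "\<lambda>n. c *\<^sub>C f n"]) auto
  qed
qed simp

lemma closure_eq_UNIV:
  fixes S :: "'a::chilbert_space set"
  assumes "0 \<in> S" "\<And>x y. x \<in> S \<Longrightarrow> y \<in> S \<Longrightarrow> x + y \<in> S" "\<And>c x. x \<in> S \<Longrightarrow> c *\<^sub>C x \<in> S"
    and *: "\<And>x. (\<And>y. y \<in> S \<Longrightarrow> cinner x y = 0) \<Longrightarrow> x = 0"
  shows "closure S = UNIV"
proof (rule closed_csubspace_eqI[OF closed_csubspace_closure closed_csubspace_UNIV])
  show "x = 0" if "x \<in> ortho_compl (closure S)" for x
    using that closure_subset[of S] by (intro *) (auto simp: ortho_compl_def)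
qed (use assms in auto)

lemma closed_csubspace_closure_range:
  assumes A: "bounded_clinear A"
  shows "closed_csubspace (closure (range A))"
proof (rule closed_csubspace_closure)
  show "0 \<in> range A" by (rule range_eqI[of _ _ 0]) (simp add: bounded_clinear_zero[OF A])
  show "x + y \<in> range A" if xy: "x \<in> range A" "y \<in> range A" for x y
  proof -
    obtain u v where "x = A u" "y = A v" using xy by blast
    then show ?thesis by (intro range_eqI[of _ _ "u + v"]) (simp add: bounded_clinear_add[OF A])
  qed
  show "c *\<^sub>C x \<in> range A" if "x \<in> range A" for c x
  proof -
    obtain u where "x = A u" using \<open>x \<in> range A\<close> by blast
    then show ?thesis by (intro range_eqI[of _ _ "c *\<^sub>C u"]) (simp add: bounded_clinear_scaleC[OF A])
  qed
qed

lemma in_closed_csubspaceI: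
  fixes M :: "'a::chilbert_space set"
  assumes M: "closed_csubspace M" and *: "\<And>k. k \<in> ortho_compl M \<Longrightarrow> cinner x k = 0"
  shows "x \<in> M"
proof -
  let ?q = "x - ortho_proj M x"
  have q: "?q \<in> ortho_compl M" by (rule ortho_proj_compl[OF M])
  have "cinner ?q ?q = cinner x ?q - cinner (ortho_proj M x) ?q" by (simp add: cinner_simps)
  also have "\<dots> = 0"
    using *[OF q] ortho_compl_sym[OF q ortho_proj_in[OF M]] by simp
  finally show "x \<in> M" using ortho_proj_in[OF M, of x] by (simp add: cinner_self_zero_iff)
qed

lemma clinear_on_sum:
  assumes A: "clinear_on M A" and M: "closed_csubspace M" and f: "\<And>i. f i \<in> M"
  shows "(\<Sum>i\<in>I. f i) \<in> M \<and> A (\<Sum>i\<in>I. f i) = (\<Sum>i\<in>I. A (f i))"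
proof (induction I rule: infinite_finite_induct)
  case (insert i I)
  then show ?case using A f M by (simp add: clinear_on_def closed_csubspace_add)
qed (use A closed_csubspace_0[OF M] in \<open>auto simp: clinear_on_def dest!: spec[of _ 0]\<close>)

subsection \<open>Adjoints\<close>

text \<open>The kernel of a nonzero functional has a vector \<open>w\<close> orthogonal to it with
  nonzero value. Subtracting the right multiple of \<open>w\<close> puts any \<open>x\<close> into
  the kernel, which determines the functional by the inner product with \<open>w\<close>.\<close>

lemma riesz_representation:
  fixes f :: "'a::chilbert_space \<Rightarrow> complex"
  assumes f: "bounded_clinear f"
  shows "\<exists>z. \<forall>x. f x = cinner x z"
proof (cases "\<forall>x. f x = 0")
  case True
  then show ?thesis by (auto intro!: exI[of _ 0] simp: cinner_simps)
next
  case False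
  then obtain x0 where x0: "f x0 \<noteq> 0" by blast
  define M where "M = {x. f x \<in> {0}}"
  have M: "closed_csubspace M"
    unfolding M_def by (rule closed_csubspace_vimage[OF f closed_csubspace_zero])
  define w where "w = x0 - ortho_proj M x0"
  have "f (ortho_proj M x0) = 0" using ortho_proj_in[OF M, of x0] by (simp add: M_def)
  then have fw: "f w \<noteq> 0" using x0 by (simp add: w_def bounded_clinear_diff[OF f])
  then have w0: "cinner w w \<noteq> 0"
    using bounded_clinear_zero[OF f] by (auto simp: cinner_self_zero_iff)
  have "f x = cinner x (cnj (f w / cinner w w) *\<^sub>C w)" for x
  proof -
    have "x - (f x / f w) *\<^sub>C w \<in> M"
      using fw by (simp add: M_def bounded_clinear_diff[OF f] bounded_clinear_scaleC[OF f]
          scaleC_complex_def)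
    then have "cinner (x - (f x / f w) *\<^sub>C w) w = 0"
      unfolding w_def by (rule ortho_compl_sym[OF ortho_proj_compl[OF M]])
    then have "cinner x w = f x / f w * cinner w w" by (simp add: cinner_simps)
    then show ?thesis using fw w0 by (simp add: cinner_simps)
  qed
  then show ?thesis by blast
qed

lemma cadjoint_eqI:
  assumes "\<And>x y. cinner (A x) y = cinner x (B y)"
  shows "cadjoint A = B"
  unfolding cadjoint_def
proof (rule the_equality)
  fix B' assume B': "\<forall>x y. cinner (A x) y = cinner x (B' y)"
  show "B' = B"
  proof
    fix y
    show "B' y = B y" by (rule cinner_right_ext) (metis B' assms)
  qed
qed (use assms in blast)

text \<open>Riesz representation of \<open>\<lambda>x. cinner (A x) y\<close>, for each
  \<open>y\<close>, supplies an adjoint, so the definite description \<open>cadjoint\<close> denotes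
  one.\<close>

lemma cinner_cadjoint:
  fixes A :: "'a::chilbert_space \<Rightarrow> 'b::complex_inner"
  assumes A: "bounded_clinear A"
  shows "cinner (A x) y = cinner x (cadjoint A y)"
proof -
  have "\<exists>z. \<forall>x. cinner (A x) y = cinner x z" for y
    by (rule riesz_representation)
      (rule bounded_clinear_compose[OF bounded_clinear_cinner_left A])
  then obtain B where "\<And>x y. cinner (A x) y = cinner x (B y)" by metis
  then show ?thesis using cadjoint_eqI[of A B] by simp
qed

lemma cinner_cadjoint':
  fixes A :: "'a::chilbert_space \<Rightarrow> 'b::complex_inner"
  assumes "bounded_clinear A"
  shows "cinner (cadjoint A y) x = cinner y (A x)"
  by (metis cinner_cadjoint[OF assms] cinner_commute)

text \<open>Since the square of the norm of \<open>B x\<close> is \<open>cinner (A (B x)) x\<close>,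
  a bound for \<open>A\<close> is also one for \<open>B\<close>. It transfers boundedness from an
  operator that is easy to estimate to its formal adjoint, for instance from
  \<open>simple_tensor\<close> to \<open>slice\<close> and from \<open>bshift\<close> to
  \<open>left_creation\<close>.\<close>

lemma bounded_clinear_of_adjoint:
  assumes A: "bounded_clinear A" and adj: "\<And>x y. cinner (A x) y = cinner x (B y)"
  shows "bounded_clinear B"
proof -
  obtain K where K0: "K \<ge> 0" and K: "\<And>x. norm (A x) \<le> norm x * K"
    using bounded_linear.nonneg_bounded[OF bounded_clinear_bounded_linear[OF A]] by blast
  show ?thesis
  proof (rule bounded_clinearI[where K="K"])
    show "B (x + y) = B x + B y" for x y
      by (rule cinner_right_ext) (simp add: adj[symmetric] cinner_simps)
    show "B (c *\<^sub>C x) = c *\<^sub>C B x" for c x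
      by (rule cinner_right_ext) (simp add: adj[symmetric] cinner_simps)
    show "norm (B x) \<le> K * norm x" for x
    proof (cases "B x = 0")
      case False
      have "(norm (B x))\<^sup>2 = cmod (cinner (A (B x)) x)"
        by (simp add: adj cinner_self_eq_norm del: of_real_power)
      also have "\<dots> \<le> norm (B x) * K * norm x"
        using order_trans[OF norm_cinner_le mult_right_mono[OF K]] by simp
      finally show ?thesis using False by (simp add: power2_eq_square)
    qed (simp add: K0)
  qed
qed

lemma bounded_clinear_cadjoint:
  fixes A :: "'a::chilbert_space \<Rightarrow> 'b::complex_inner"
  assumes A: "bounded_clinear A"
  shows "bounded_clinear (cadjoint A)"
  by (rule bounded_clinear_of_adjoint[OF A cinner_cadjoint[OF A]])

lemma cadjoint_comp:
  fixes A :: "'b::chilbert_space \<Rightarrow> 'c::complex_inner" and B :: "'a::chilbert_space \<Rightarrow> 'b"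
  shows "bounded_clinear A \<Longrightarrow> bounded_clinear B \<Longrightarrow>
    cadjoint (A \<circ> B) = cadjoint B \<circ> cadjoint A"
  by (rule cadjoint_eqI) (simp add: cinner_cadjoint)

lemma cadjoint_id: "cadjoint id = id"
  by (rule cadjoint_eqI) simp

lemma norm_adjoint_le:
  assumes adj: "\<And>x y. cinner (A x) y = cinner x (B y)" and A: "\<And>x. norm (A x) \<le> norm x"
  shows "norm (B y) \<le> norm y"
proof (cases "B y = 0")
  case False
  have "(norm (B y))\<^sup>2 = cmod (cinner (A (B y)) y)"
    by (simp add: adj cinner_self_eq_norm del: of_real_power)
  also have "\<dots> \<le> norm (B y) * norm y"
    by (rule order_trans[OF norm_cinner_le mult_right_mono[OF A]]) simp
  finally have "norm (B y) * norm (B y) \<le> norm (B y) * norm y"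
    by (simp add: power2_eq_square)
  then show ?thesis using False by (simp add: mult_le_cancel_left_pos)
qed simp

subsection \<open>Positive square roots\<close>

lemma positive_opD:
  assumes "positive_op A"
  shows "bounded_clinear A" "Im (cinner (A x) x) = 0" "Re (cinner (A x) x) \<ge> 0"
  using assms by (auto simp: positive_op_def complex_nonneg_Reals_iff)

text \<open>Polarization: reality of the quadratic form at \<open>x + y\<close> fixes the imaginary
  part of \<open>cinner (A x) y + cinner (A y) x\<close>, and at \<open>x + \<i> *\<^sub>C y\<close>
  the real part of the difference.\<close>

lemma positive_op_selfadjoint:
  assumes A: "positive_op A"
  shows "cinner (A x) y = cinner x (A y)"
proof -
  note lin = bounded_clinear_add[OF positive_opD(1)[OF A]] bounded_clinear_scaleC[OF positive_opD(1)[OF A]]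
  have "Im (cinner (A x) y + cinner (A y) x) = 0"
    using positive_opD(2)[OF A, of "x + y"] positive_opD(2)[OF A, of x] positive_opD(2)[OF A, of y]
    by (simp add: lin cinner_simps)
  moreover have "Re (cinner (A y) x - cinner (A x) y) = 0"
    using positive_opD(2)[OF A, of "x + \<i> *\<^sub>C y"] positive_opD(2)[OF A, of x]
      positive_opD(2)[OF A, of y]
    by (simp add: lin cinner_simps)
  ultimately have "cinner (A x) y = cnj (cinner (A y) x)"
    by (simp add: complex_eq_iff)
  then show ?thesis by (metis cinner_commute)
qed

text \<open>The quadratic form at x - s A x is a quadratic polynomial in s without constant term. If
  A x were nonzero, its negative linear term would dominate for small positive s.\<close>

lemma positive_op_null:
  assumes A: "positive_op A" and 0: "cinner (A x) x = 0"
  shows "A x = 0"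
proof -
  note lin = bounded_clinear_add[OF positive_opD(1)[OF A]] bounded_clinear_scaleC[OF positive_opD(1)[OF A]]
  define n where "n = (norm (A x))\<^sup>2"
  define c where "c = Re (cinner (A (A x)) (A x))"
  have c: "c \<ge> 0" unfolding c_def by (rule positive_opD(3)[OF A])
  have n: "n \<ge> 0" by (simp add: n_def)
  \<comment> \<open>The optimal step would be \<open>n / c\<close>; the summand 1 covers
    \<open>c = 0\<close>.\<close>
  define s where "s = n / (c + 1)"
  have s: "s \<ge> 0" "s * (c + 1) = n" using c n by (simp_all add: s_def)
  have xx: "cinner (A x) (A x) = of_real n" by (simp add: n_def cinner_self_eq_norm)
  have Axx: "cinner (A (A x)) x = of_real n"
    using positive_op_selfadjoint[OF A, of "A x" x] by (simp add: xx)
  have "0 \<le> Re (cinner (A (x + of_real (- s) *\<^sub>C A x)) (x + of_real (- s) *\<^sub>C A x))"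
    by (rule positive_opD(3)[OF A])
  also have "\<dots> = s * s * c - 2 * s * n"
    by (simp add: lin cinner_simps 0 xx Axx c_def algebra_simps)
  finally have "2 * s * n \<le> s * s * c" by simp
  also have "\<dots> \<le> s * n"
    using mult_left_mono[of "s * c" n s] s(1) c by (simp add: s(2)[symmetric] algebra_simps)
  finally have "s * n \<le> 0" by linarith
  then have "n * n \<le> 0" using c by (simp add: s_def divide_le_0_iff)
  then have "n = 0" by (metis antisym zero_le_square mult_eq_0_iff)
  then show ?thesis by (simp add: n_def)
qed

text \<open>If \<open>X = (Y + X\<^sup>2) / 2\<close> then \<open>(I - X)\<^sup>2 = I - Y\<close>. The iteration for this fixed point equation
  is dominated by its scalar counterpart with \<open>Y = 1\<close>, which increases to \<open>1\<close>.\<close>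

fun sqrt_iter :: "('a::complex_inner \<Rightarrow> 'a) \<Rightarrow> nat \<Rightarrow> 'a \<Rightarrow> 'a" where
  "sqrt_iter Y 0 x = 0"
| "sqrt_iter Y (Suc n) x = (1/2) *\<^sub>C (Y x + sqrt_iter Y n (sqrt_iter Y n x))"

fun sqrt_bound :: "nat \<Rightarrow> real" where
  "sqrt_bound 0 = 0"
| "sqrt_bound (Suc n) = (1 + (sqrt_bound n)\<^sup>2) / 2"

lemma sqrt_bound_range: "0 \<le> sqrt_bound n \<and> sqrt_bound n \<le> 1"
proof (induction n)
  case (Suc n)
  then have "(sqrt_bound n)\<^sup>2 \<le> 1" by (simp add: power_le_one)
  then show ?case by simp
qed simp

lemma sqrt_bound_incseq: "incseq sqrt_bound"
proof (rule incseq_SucI)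
  fix n
  have "0 \<le> (1 - sqrt_bound n)\<^sup>2" by simp
  then show "sqrt_bound n \<le> sqrt_bound (Suc n)" by (simp add: power2_eq_square algebra_simps)
qed

text \<open>The iterates are polynomials in \<open>Y\<close> without constant term, so whatever
  intertwines \<open>Y\<close> and \<open>Y'\<close> intertwines them as well. All commutation
  properties of the square root come from here.\<close>

lemma sqrt_iter_intertwine:
  assumes C: "bounded_clinear C" and YC: "\<And>x. C (Y x) = Y' (C x)"
  shows "C (sqrt_iter Y n x) = sqrt_iter Y' n (C x)"
  by (induction n arbitrary: x)
    (simp_all add: bounded_clinear_zero[OF C] bounded_clinear_add[OF C] bounded_clinear_scaleC[OF C] YC)

definition sqrt_lim :: "('a::complex_inner \<Rightarrow> 'a) \<Rightarrow> 'a \<Rightarrow> 'a"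
  where "sqrt_lim Y x = lim (\<lambda>n. sqrt_iter Y n x)"

text \<open>The intended instances are the two products of a row contraction with its adjoint; the
  square root of I - Y is then a defect operator.\<close>

locale selfadjoint_contraction =
  fixes Y :: "'a::chilbert_space \<Rightarrow> 'a"
  assumes Y: "bounded_clinear Y" and Y_le: "norm (Y x) \<le> norm x"
    and Y_adj: "cinner (Y x) y = cinner x (Y y)"
begin

lemma sqrt_iter_linear: "bounded_clinear (sqrt_iter Y n)"
proof (induction n)
  case 0
  have "sqrt_iter Y 0 = (\<lambda>x. 0)" by auto
  then show ?case by (auto intro: bounded_clinearI[where K=0])
next
  case (Suc n)
  have "sqrt_iter Y (Suc n) = (\<lambda>x. (1/2) *\<^sub>C (Y x + sqrt_iter Y n (sqrt_iter Y n x)))" by auto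
  then show ?case
    using bounded_clinear_smult[OF bounded_clinear_plus[OF Y bounded_clinear_compose[OF Suc Suc]]]
    by simp
qed

lemma sqrt_iter_comm_Y: "Y (sqrt_iter Y n x) = sqrt_iter Y n (Y x)"
  by (rule sqrt_iter_intertwine[where C=Y and Y=Y and Y'=Y]) (simp_all add: Y)

lemma sqrt_iter_comm: "sqrt_iter Y m (sqrt_iter Y n x) = sqrt_iter Y n (sqrt_iter Y m x)"
  by (rule sqrt_iter_intertwine[where C="sqrt_iter Y m" and Y=Y and Y'=Y])
    (simp_all add: sqrt_iter_comm_Y sqrt_iter_linear)

lemma sqrt_iter_adj: "cinner (sqrt_iter Y n x) y = cinner x (sqrt_iter Y n y)"
  by (induction n arbitrary: x y) (simp_all add: cinner_simps Y_adj)

lemma norm_sqrt_iter: "norm (sqrt_iter Y n x) \<le> sqrt_bound n * norm x"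
proof (induction n arbitrary: x)
  case (Suc n)
  have "norm (sqrt_iter Y n (sqrt_iter Y n x)) \<le> sqrt_bound n * norm (sqrt_iter Y n x)"
    by (rule Suc)
  also have "\<dots> \<le> sqrt_bound n * (sqrt_bound n * norm x)"
    using Suc sqrt_bound_range by (intro mult_left_mono) auto
  finally have "norm (Y x + sqrt_iter Y n (sqrt_iter Y n x)) \<le> norm x + (sqrt_bound n)\<^sup>2 * norm x"
    using norm_triangle_ineq[of "Y x" "sqrt_iter Y n (sqrt_iter Y n x)"] Y_le[of x]
    by (simp add: power2_eq_square mult.assoc)
  then show ?case by (simp add: norm_scaleC algebra_simps)
qed simp

text \<open>The iterates commute, so a difference of their squares factors as difference times sum.
  The factors are bounded by the same factors of the scalar iteration, where the factorization holds
  too.\<close>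

lemma norm_sqrt_iter_Suc_diff:
  "norm (sqrt_iter Y (Suc n) x - sqrt_iter Y n x) \<le> (sqrt_bound (Suc n) - sqrt_bound n) * norm x"
proof (induction n arbitrary: x)
  case 0
  then show ?case using Y_le[of x] by (simp add: norm_scaleC)
next
  case (Suc n)
  let ?D = "\<lambda>x. sqrt_iter Y (Suc n) x - sqrt_iter Y n x"
  let ?S = "\<lambda>x. sqrt_iter Y (Suc n) x + sqrt_iter Y n x"
  have "sqrt_iter Y (Suc (Suc n)) x - sqrt_iter Y (Suc n) x =
      (1/2) *\<^sub>C (sqrt_iter Y (Suc n) (sqrt_iter Y (Suc n) x) - sqrt_iter Y n (sqrt_iter Y n x))"
    unfolding sqrt_iter.simps(2)[of Y "Suc n"] sqrt_iter.simps(2)[of Y n x]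
    by (simp add: scaleC_diff_right[symmetric] del: sqrt_iter.simps)
  also have "\<dots> = (1/2) *\<^sub>C ?D (?S x)"
    using bounded_clinear_add[OF sqrt_iter_linear] sqrt_iter_comm[of n "Suc n" x]
    by (simp del: sqrt_iter.simps)
  finally have "norm (sqrt_iter Y (Suc (Suc n)) x - sqrt_iter Y (Suc n) x) = norm (?D (?S x)) / 2"
    by (simp add: norm_scaleC del: sqrt_iter.simps)
  also have "\<dots> \<le> (sqrt_bound (Suc n) - sqrt_bound n) * norm (?S x) / 2"
    by (intro divide_right_mono Suc) simp
  also have "\<dots> \<le> (sqrt_bound (Suc n) - sqrt_bound n) *
      ((sqrt_bound (Suc n) + sqrt_bound n) * norm x) / 2"
  proof (intro divide_right_mono mult_left_mono)
    show "norm (?S x) \<le> (sqrt_bound (Suc n) + sqrt_bound n) * norm x"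
      using norm_triangle_ineq[of "sqrt_iter Y (Suc n) x" "sqrt_iter Y n x"]
        norm_sqrt_iter[of "Suc n" x] norm_sqrt_iter[of n x]
      unfolding distrib_right by linarith
    show "0 \<le> sqrt_bound (Suc n) - sqrt_bound n"
      using incseq_SucD[OF sqrt_bound_incseq, of n] by simp
  qed simp
  also have "\<dots> = (sqrt_bound (Suc (Suc n)) - sqrt_bound (Suc n)) * norm x"
    unfolding sqrt_bound.simps(2)[of "Suc n"]
    unfolding sqrt_bound.simps(2)[of n]
    by (simp add: power2_eq_square field_simps)
  finally show ?case .
qed

text \<open>Summing the increment bounds dominates the iteration by a bounded increasing real
  sequence, whose Cauchy property it inherits.\<close>

lemma sqrt_iter_tendsto: "(\<lambda>n. sqrt_iter Y n x) \<longlonglongrightarrow> sqrt_lim Y x"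
proof -
  have diff: "norm (sqrt_iter Y (n + k) x - sqrt_iter Y n x) \<le>
      (sqrt_bound (n + k) - sqrt_bound n) * norm x" for n k
  proof (induction k)
    case (Suc k)
    have "norm (sqrt_iter Y (n + Suc k) x - sqrt_iter Y n x) \<le>
        norm (sqrt_iter Y (Suc (n + k)) x - sqrt_iter Y (n + k) x) +
        norm (sqrt_iter Y (n + k) x - sqrt_iter Y n x)"
      by (rule order_trans[OF _ norm_triangle_ineq]) (simp del: sqrt_iter.simps)
    then show ?case
      using Suc norm_sqrt_iter_Suc_diff[of "n + k" x]
      by (simp add: left_diff_distrib del: sqrt_iter.simps sqrt_bound.simps)
  qed simp
  obtain l where "sqrt_bound \<longlonglongrightarrow> l"
    using incseq_convergent[OF sqrt_bound_incseq, of 1] sqrt_bound_range by metis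
  then have "(\<lambda>n. sqrt_bound n * norm x) \<longlonglongrightarrow> l * norm x" by (intro tendsto_intros)
  then have C: "Cauchy (\<lambda>n. sqrt_bound n * norm x)" by (rule LIMSEQ_imp_Cauchy)
  have "Cauchy (\<lambda>n. sqrt_iter Y n x)"
  proof (rule metric_CauchyI)
    fix e :: real assume "e > 0"
    then obtain M where M: "\<And>m n. m \<ge> M \<Longrightarrow> n \<ge> M \<Longrightarrow>
        dist (sqrt_bound m * norm x) (sqrt_bound n * norm x) < e"
      using metric_CauchyD[OF C] by metis
    have *: "dist (sqrt_iter Y m x) (sqrt_iter Y n x) < e" if "M \<le> n" "n \<le> m" for m n
    proof -
      obtain k where k: "m = n + k" using \<open>n \<le> m\<close> le_Suc_ex by blast
      have "dist (sqrt_iter Y m x) (sqrt_iter Y n x) \<le> (sqrt_bound (n + k) - sqrt_bound n) * norm x"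
        using diff by (simp add: k dist_norm)
      also have "\<dots> \<le> dist (sqrt_bound m * norm x) (sqrt_bound n * norm x)"
        by (simp add: k dist_real_def left_diff_distrib)
      also have "\<dots> < e" using M that by auto
      finally show ?thesis .
    qed
    then show "\<exists>M. \<forall>m\<ge>M. \<forall>n\<ge>M. dist (sqrt_iter Y m x) (sqrt_iter Y n x) < e"
      by (metis dist_commute nle_le)
  qed
  then show ?thesis
    unfolding sqrt_lim_def using Cauchy_convergent convergent_LIMSEQ_iff by blast
qed

lemma norm_sqrt_lim: "norm (sqrt_lim Y x) \<le> norm x"
proof (rule tendsto_upperbound[OF tendsto_norm[OF sqrt_iter_tendsto]])
  show "\<forall>\<^sub>F n in sequentially. norm (sqrt_iter Y n x) \<le> norm x"
    using norm_sqrt_iter mult_right_mono[of "sqrt_bound _" 1 "norm x"] sqrt_bound_range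
    by (intro always_eventually allI) (metis mult_1 norm_ge_zero order_trans)
qed simp

lemma sqrt_lim_linear: "bounded_clinear (sqrt_lim Y)"
proof (rule bounded_clinearI[where K=1])
  show "sqrt_lim Y (x + y) = sqrt_lim Y x + sqrt_lim Y y" for x y
    by (rule LIMSEQ_unique[OF sqrt_iter_tendsto])
      (simp add: bounded_clinear_add[OF sqrt_iter_linear] tendsto_add sqrt_iter_tendsto)
  show "sqrt_lim Y (c *\<^sub>C x) = c *\<^sub>C sqrt_lim Y x" for c x
    by (rule LIMSEQ_unique[OF sqrt_iter_tendsto])
      (simp add: bounded_clinear_scaleC[OF sqrt_iter_linear] tendsto_scaleC sqrt_iter_tendsto)
qed (simp add: norm_sqrt_lim)

lemma sqrt_lim_adj: "cinner (sqrt_lim Y x) y = cinner x (sqrt_lim Y y)"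
proof (rule LIMSEQ_unique)
  show "(\<lambda>n. cinner (sqrt_iter Y n x) y) \<longlonglongrightarrow> cinner (sqrt_lim Y x) y"
    by (intro cinner.tendsto sqrt_iter_tendsto tendsto_const)
  show "(\<lambda>n. cinner (sqrt_iter Y n x) y) \<longlonglongrightarrow> cinner x (sqrt_lim Y y)"
    unfolding sqrt_iter_adj by (intro cinner.tendsto sqrt_iter_tendsto tendsto_const)
qed

lemma sqrt_lim_fixpoint: "sqrt_lim Y x = (1/2) *\<^sub>C (Y x + sqrt_lim Y (sqrt_lim Y x))"
proof (rule LIMSEQ_unique[OF LIMSEQ_Suc[OF sqrt_iter_tendsto]])
  \<comment> \<open>The operator and its argument both vary with \<open>n\<close>. The iterates are
    contractions, so the argument may be replaced by its limit.\<close>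
  have "(\<lambda>n. sqrt_iter Y n (sqrt_iter Y n x) - sqrt_iter Y n (sqrt_lim Y x)) \<longlonglongrightarrow> 0"
  proof (rule Lim_null_comparison)
    show "\<forall>\<^sub>F n in sequentially. norm (sqrt_iter Y n (sqrt_iter Y n x) - sqrt_iter Y n (sqrt_lim Y x))
        \<le> norm (sqrt_iter Y n x - sqrt_lim Y x)"
    proof (intro always_eventually allI)
      fix n
      let ?z = "sqrt_iter Y n x - sqrt_lim Y x"
      have "norm (sqrt_iter Y n ?z) \<le> sqrt_bound n * norm ?z" by (rule norm_sqrt_iter)
      also have "\<dots> \<le> norm ?z"
        using mult_right_mono[of "sqrt_bound n" 1 "norm ?z"] sqrt_bound_range by simp
      finally show "norm (sqrt_iter Y n (sqrt_iter Y n x) - sqrt_iter Y n (sqrt_lim Y x)) \<le> norm ?z"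
        by (simp add: bounded_clinear_diff[OF sqrt_iter_linear])
    qed
    show "(\<lambda>n. norm (sqrt_iter Y n x - sqrt_lim Y x)) \<longlonglongrightarrow> 0"
      using sqrt_iter_tendsto[of x] by (subst tendsto_norm_zero_iff) (simp add: LIM_zero)
  qed
  from tendsto_add[OF this sqrt_iter_tendsto[of "sqrt_lim Y x"]]
  have "(\<lambda>n. sqrt_iter Y n (sqrt_iter Y n x)) \<longlonglongrightarrow> sqrt_lim Y (sqrt_lim Y x)" by simp
  then show "(\<lambda>n. sqrt_iter Y (Suc n) x) \<longlonglongrightarrow> (1/2) *\<^sub>C (Y x + sqrt_lim Y (sqrt_lim Y x))"
    unfolding sqrt_iter.simps by (intro tendsto_scaleC tendsto_add tendsto_const)
qed

lemma sqrt_positive: "positive_op (\<lambda>x. x - sqrt_lim Y x)"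
  unfolding positive_op_def
proof (intro conjI allI)
  show "bounded_clinear (\<lambda>x. x - sqrt_lim Y x)"
    by (intro bounded_clinear_minus bounded_clinear_id sqrt_lim_linear)
  fix x
  have "cinner (sqrt_lim Y x) x = cnj (cinner (sqrt_lim Y x) x)"
    by (metis cinner_commute sqrt_lim_adj)
  then have "Im (cinner (sqrt_lim Y x) x) = Im (cnj (cinner (sqrt_lim Y x) x))"
    by (rule arg_cong)
  then have Im: "Im (cinner (sqrt_lim Y x) x) = 0" by simp
  have "Re (cinner (sqrt_lim Y x) x) \<le> norm (sqrt_lim Y x) * norm x"
    using complex_Re_le_cmod norm_cinner_le order_trans by blast
  also have "\<dots> \<le> (norm x)\<^sup>2"
    unfolding power2_eq_square by (intro mult_right_mono norm_sqrt_lim) simp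
  finally show "cinner (x - sqrt_lim Y x) x \<in> \<real>\<^sub>\<ge>\<^sub>0"
    using Im by (simp add: complex_nonneg_Reals_iff cinner_simps cinner_self_eq_norm)
qed

lemma sqrt_square: "(\<lambda>x. x - sqrt_lim Y x) \<circ> (\<lambda>x. x - sqrt_lim Y x) = (\<lambda>x. x - Y x)"
proof
  fix x
  have "2 *\<^sub>C sqrt_lim Y x = Y x + sqrt_lim Y (sqrt_lim Y x)"
    by (subst sqrt_lim_fixpoint) (simp add: scaleC_scaleC)
  moreover have "2 *\<^sub>C z = z + z" for z :: 'a
    using scaleC_add_left[of 1 1 z] by simp
  ultimately have "sqrt_lim Y x + sqrt_lim Y x = Y x + sqrt_lim Y (sqrt_lim Y x)" by metis
  then show "((\<lambda>x. x - sqrt_lim Y x) \<circ> (\<lambda>x. x - sqrt_lim Y x)) x = x - Y x"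
    by (simp add: bounded_clinear_diff[OF sqrt_lim_linear] algebra_simps)
qed

text \<open>\<open>B\<close> commutes with its square, hence with \<open>Y\<close>, with the
  iterates and with the constructed root \<open>C\<close>. Therefore (B + C)(B - C) = 0, and
  positivity forces \<open>B\<close> and \<open>C\<close> each to annihilate \<open>k\<close>, the
  value of B - C at \<open>x\<close>. Selfadjointness then makes \<open>k\<close> orthogonal to
  itself.\<close>

lemma sqrt_unique:
  assumes B: "positive_op B" and BB: "B \<circ> B = (\<lambda>x. x - Y x)"
  shows "B x = x - sqrt_lim Y x"
proof -
  note linB = bounded_clinear_diff[OF positive_opD(1)[OF B]]
  define C where "C x = x - sqrt_lim Y x" for x
  have C: "positive_op C" and CC: "C (C x) = B (B x)" for x
    using sqrt_positive fun_cong[OF sqrt_square, of x] fun_cong[OF BB, of x]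
    by (simp_all add: C_def[abs_def])
  note linC = bounded_clinear_diff[OF positive_opD(1)[OF C]]
  have BBx: "B (B x) = x - Y x" for x using fun_cong[OF BB, of x] by simp
  have BY: "B (Y x) = Y (B x)" for x
    using arg_cong[OF BBx[of x], of B] BBx[of "B x"] by (simp add: linB)
  have BC: "B (C x) = C (B x)" for x
  proof -
    have "B (sqrt_lim Y x) = sqrt_lim Y (B x)"
    proof (rule LIMSEQ_unique)
      show "(\<lambda>n. B (sqrt_iter Y n x)) \<longlonglongrightarrow> B (sqrt_lim Y x)"
        by (intro bounded_linear.tendsto[OF bounded_clinear_bounded_linear[OF positive_opD(1)[OF B]]]
            sqrt_iter_tendsto)
      show "(\<lambda>n. B (sqrt_iter Y n x)) \<longlonglongrightarrow> sqrt_lim Y (B x)"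
        unfolding sqrt_iter_intertwine[of B Y Y, OF positive_opD(1)[OF B] BY]
        by (rule sqrt_iter_tendsto)
    qed
    then show ?thesis by (simp add: C_def linB)
  qed
  define k where "k = B x - C x"
  have sum0: "B k + C k = 0"
    by (simp add: k_def linB linC CC BC)
  then have "cinner (B k) k + cinner (C k) k = 0"
    by (metis cinner_add_left cinner.zero_left)
  then have "cinner (B k) k = 0 \<and> cinner (C k) k = 0"
    using positive_opD(2,3)[OF B, of k] positive_opD(2,3)[OF C, of k] by (auto simp: complex_eq_iff)
  then have "B k = 0" "C k = 0"
    using positive_op_null[OF B, of k] positive_op_null[OF C, of k] by auto
  then have "cinner k k = 0"
    unfolding k_def
    by (metis (no_types, lifting) cinner.diff_right cinner.diff_left k_def cinner.zero_left
        positive_op_selfadjoint[OF B] positive_op_selfadjoint[OF C] right_minus_eq)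
  then show ?thesis by (simp add: cinner_self_zero_iff k_def C_def)
qed

lemma positive_sqrt_eq: "positive_sqrt (\<lambda>x. x - Y x) = (\<lambda>x. x - sqrt_lim Y x)"
  unfolding positive_sqrt_def
proof (rule the_equality)
  show "positive_op (\<lambda>x. x - sqrt_lim Y x) \<and>
      (\<lambda>x. x - sqrt_lim Y x) \<circ> (\<lambda>x. x - sqrt_lim Y x) = (\<lambda>x. x - Y x)"
    using sqrt_positive sqrt_square by (rule conjI)
  show "B = (\<lambda>x. x - sqrt_lim Y x)" if "positive_op B \<and> B \<circ> B = (\<lambda>x. x - Y x)" for B
    by (rule ext, rule sqrt_unique) (use that in blast)+
qed

lemma positive_sqrt_positive: "positive_op (positive_sqrt (\<lambda>x. x - Y x))"
  unfolding positive_sqrt_eq by (rule sqrt_positive)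

lemma positive_sqrt_square:
  "positive_sqrt (\<lambda>x. x - Y x) (positive_sqrt (\<lambda>x. x - Y x) x) = x - Y x"
  unfolding positive_sqrt_eq using fun_cong[OF sqrt_square, of x] by simp

end

text \<open>Naturality of the square root. It is applied to a row operator and its adjoint, which
  relate the two defect operators, and to unitaries intertwining two row contractions.\<close>

lemma positive_sqrt_intertwine:
  assumes Y: "selfadjoint_contraction Y" and Y': "selfadjoint_contraction Y'"
    and C: "bounded_clinear C" and YC: "\<And>x. C (Y x) = Y' (C x)"
  shows "C (positive_sqrt (\<lambda>x. x - Y x) x) = positive_sqrt (\<lambda>x. x - Y' x) (C x)"
proof -
  have "C (sqrt_lim Y x) = sqrt_lim Y' (C x)"
  proof (rule LIMSEQ_unique)
    show "(\<lambda>n. C (sqrt_iter Y n x)) \<longlonglongrightarrow> C (sqrt_lim Y x)"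
      by (intro bounded_linear.tendsto[OF bounded_clinear_bounded_linear[OF C]]
          selfadjoint_contraction.sqrt_iter_tendsto[OF Y])
    show "(\<lambda>n. C (sqrt_iter Y n x)) \<longlonglongrightarrow> sqrt_lim Y' (C x)"
      unfolding sqrt_iter_intertwine[of C Y Y', OF C YC]
      by (rule selfadjoint_contraction.sqrt_iter_tendsto[OF Y'])
  qed
  then show ?thesis
    by (simp add: selfadjoint_contraction.positive_sqrt_eq[OF Y]
        selfadjoint_contraction.positive_sqrt_eq[OF Y'] bounded_clinear_diff[OF C])
qed

section \<open>Direct sums and the Fock space\<close>

lemma ell2_eqI: "(\<And>i. comp_of f i = comp_of g i) \<Longrightarrow> f = g"
  by (simp add: comp_of_inject[symmetric] fun_eq_iff)

lemma comp_of_Abs_ell2: "(\<lambda>i. (norm (f i))\<^sup>2) summable_on UNIV \<Longrightarrow> comp_of (Abs_ell2 f) = f"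
  by (simp add: Abs_ell2_inverse)

lemma comp_of_Abs_ell2_finite: "comp_of (Abs_ell2 f :: ('i::finite, 'a::complex_inner) ell2) = f"
  by (rule comp_of_Abs_ell2) simp

lemma sq_summable_comparison:
  fixes g :: "'i \<Rightarrow> 'b::real_normed_vector"
  assumes "\<And>i. norm (g i) \<le> C * norm (comp_of f i)"
  shows "(\<lambda>i. (norm (g i))\<^sup>2) summable_on UNIV"
proof (rule summable_on_comparison_test)
  show "(\<lambda>i. C\<^sup>2 * (norm (comp_of f i))\<^sup>2) summable_on UNIV"
    by (intro summable_on_cmult_right comp_of_summable)
  show "(norm (g i))\<^sup>2 \<le> C\<^sup>2 * (norm (comp_of f i))\<^sup>2" for i
    using power_mono[OF assms[of i], of 2] by (simp add: power_mult_distrib)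
qed simp

text \<open>The typical use is a family given by a formula: one bound on finite partial sums both
  makes \<open>Abs_ell2\<close> meaningful and estimates the norm. The Poisson kernel and
  \<open>char_adj\<close> are obtained this way.\<close>

lemma sq_summable_Abs_le:
  assumes "\<And>F. finite F \<Longrightarrow> (\<Sum>i\<in>F. (norm (f i))\<^sup>2) \<le> B\<^sup>2" and "B \<ge> 0"
  shows "comp_of (Abs_ell2 f) = f" and "norm (Abs_ell2 f) \<le> B"
proof -
  have "(\<lambda>i. (norm (f i))\<^sup>2) summable_on UNIV"
    by (rule nonneg_bounded_partial_sums_imp_summable_on[where C="B\<^sup>2"])
      (auto intro: eventually_finite_subsets_at_top_weakI assms)
  then show *: "comp_of (Abs_ell2 f) = f" by (rule comp_of_Abs_ell2)
  have "(norm (Abs_ell2 f))\<^sup>2 \<le> B\<^sup>2"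
    unfolding norm_ell2_sq
    by (rule infsum_le_finite_sums[OF comp_of_summable]) (use * assms in simp)
  then show "norm (Abs_ell2 f) \<le> B" using assms(2) by (rule power2_le_imp_le)
qed

lemma has_sum_cinner_ell2:
  "((\<lambda>i. cinner (comp_of f i) (comp_of g i)) has_sum cinner f g) UNIV"
  unfolding cinner_ell2_def by (rule has_sum_infsum[OF cinner_summable])

lemma cinner_ell2_finite:
  "cinner f g = (\<Sum>i\<in>UNIV. cinner (comp_of f i) (comp_of (g :: ('i::finite, 'a::complex_inner) ell2) i))"
  by (simp add: cinner_ell2_def)

lemma norm_ell2_finite:
  "(norm (f :: ('i::finite, 'a::complex_inner) ell2))\<^sup>2 = (\<Sum>i\<in>UNIV. (norm (comp_of f i))\<^sup>2)"
  by (simp add: norm_ell2_sq)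

lemma norm_ell2_mono:
  assumes "\<And>i. norm (comp_of f i) \<le> norm (comp_of g i)"
  shows "norm f \<le> norm g"
proof (rule power2_le_imp_le)
  show "(norm f)\<^sup>2 \<le> (norm g)\<^sup>2"
    unfolding norm_ell2_sq
    by (rule infsum_mono[OF comp_of_summable comp_of_summable]) (simp add: power_mono assms)
qed simp

lemma comp_of_Abs_ell2_isometric:
  assumes "\<And>i. norm (\<tau> (comp_of f i)) = norm (comp_of f i)"
  shows "comp_of (Abs_ell2 (\<lambda>i. \<tau> (comp_of f i))) = (\<lambda>i. \<tau> (comp_of f i))"
  by (rule comp_of_Abs_ell2) (simp add: assms comp_of_summable)

lemma bounded_clinear_comp_of: "bounded_clinear (\<lambda>f. comp_of f i)"
  by (rule bounded_clinearI[where K=1])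
    (auto simp: plus_ell2.rep_eq scaleC_ell2.rep_eq norm_comp_le)

lift_definition ell2_single :: "'i \<Rightarrow> 'a::complex_inner \<Rightarrow> ('i, 'a) ell2"
  is "\<lambda>i x j. if j = i then x else 0"
proof -
  fix i :: 'i and x :: 'a
  have "(\<lambda>j. (norm (if j = i then x else 0))\<^sup>2) summable_on {i}" by simp
  then show "(\<lambda>j. (norm (if j = i then x else 0))\<^sup>2) summable_on UNIV"
    by (rule summable_on_cong_neutral[THEN iffD1, rotated -1]) auto
qed

lemma cinner_ell2_single: "cinner f (ell2_single i x) = cinner (comp_of f i) x"
proof (rule has_sum_unique[OF has_sum_cinner_ell2])
  show "((\<lambda>j. cinner (comp_of f j) (comp_of (ell2_single i x) j)) has_sum cinner (comp_of f i) x) UNIV"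
    by (rule has_sum_finite_neutralI[of "{i}"]) (auto simp: ell2_single.rep_eq cinner_simps)
qed

lemma cinner_ell2_single_left: "cinner (ell2_single i x) f = cinner x (comp_of f i)"
  by (metis cinner_commute cinner_ell2_single)

text \<open>The slice map \<open>f \<mapsto> (I \<otimes> \<langle>\<sqdot>, y\<rangle>) f\<close>.\<close>

lift_definition slice :: "'a::complex_inner \<Rightarrow> ('i, 'a) ell2 \<Rightarrow> ('i, complex) ell2"
  is "\<lambda>y f i. cinner (f i) y"
proof -
  fix y :: 'a and f :: "'i \<Rightarrow> 'a"
  assume "(\<lambda>i. (norm (f i))\<^sup>2) summable_on UNIV"
  then show "(\<lambda>i. (norm (cinner (f i) y))\<^sup>2) summable_on UNIV"
    using sq_summable_comparison[of "\<lambda>i. cinner (f i) y" "norm y" "Abs_ell2 f"]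
    by (simp add: comp_of_Abs_ell2 norm_cinner_le mult.commute[of "norm y"])
qed

lemma cinner_slice: "cinner (slice y f) \<phi> = cinner f (simple_tensor \<phi> y)"
  unfolding cinner_ell2_def
  by (rule infsum_cong)
    (simp add: slice.rep_eq simple_tensor.rep_eq cinner_scaleC_right cinner_complex_def mult.commute)

lemma bounded_clinear_simple_tensor:
  "bounded_clinear (\<lambda>\<phi> :: 'n fock. simple_tensor \<phi> (y::'a::complex_inner))"
proof (rule bounded_clinearI[where K="norm y"])
  show "simple_tensor (\<phi> + \<psi>) y = simple_tensor \<phi> y + simple_tensor \<psi> y" for \<phi> \<psi> :: "'n fock"
    by (rule ell2_eqI) (simp add: simple_tensor.rep_eq plus_ell2.rep_eq scaleC_add_left)
  show "simple_tensor (c *\<^sub>C \<phi>) y = c *\<^sub>C simple_tensor \<phi> y" for c and \<phi> :: "'n fock"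
    by (rule ell2_eqI)
      (simp add: simple_tensor.rep_eq scaleC_ell2.rep_eq scaleC_scaleC scaleC_complex_def)
  show "norm (simple_tensor \<phi> y) \<le> norm y * norm \<phi>" for \<phi> :: "'n fock"
  proof (rule power2_le_imp_le)
    have "(norm (simple_tensor \<phi> y))\<^sup>2 = (norm \<phi>)\<^sup>2 * (norm y)\<^sup>2"
      unfolding norm_ell2_sq
      by (simp add: simple_tensor.rep_eq norm_scaleC power_mult_distrib infsum_cmult_left')
    then show "(norm (simple_tensor \<phi> y))\<^sup>2 \<le> (norm y * norm \<phi>)\<^sup>2"
      by (simp add: power_mult_distrib)
  qed simp
qed

lemma bounded_clinear_slice: "bounded_clinear (slice y :: ('n, 'a::complex_inner) fock_tensor \<Rightarrow> 'n fock)"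
proof (rule bounded_clinear_of_adjoint[OF bounded_clinear_simple_tensor])
  show "cinner (simple_tensor \<phi> y) f = cinner \<phi> (slice y f)"
    for \<phi> and f :: "('n, 'a) fock_tensor"
    by (metis cinner_commute cinner_slice)
qed

subsection \<open>Backward shifts and sums over words\<close>

lemma finite_words_eq [simp]: "finite {w::'n::finite list. length w = k}"
  using finite_lists_length_eq[of "UNIV :: 'n set" k] by simp

lemma finite_words_less [simp]: "finite {w::'n::finite list. length w < N}"
proof -
  have "{w::'n list. length w < N} = (\<Union>k<N. {w. length w = k})" by auto
  then show ?thesis by simp
qed

lemma finite_words_bounded:
  fixes F :: "'n list set"
  assumes "finite F" obtains N where "F \<subseteq> {w. length w < N}"
proof -
  obtain N where "\<forall>k\<in>length ` F. k < N"
    using finite_nat_set_iff_bounded assms by blast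
  then show ?thesis by (intro that[of N]) auto
qed

text \<open>The sets of words of bounded length are finite and exhaust all words. Unordered sums
  thus become sequential limits of the partial sums for which telescoping identities are
  available.\<close>

lemma filterlim_words:
  "filterlim (\<lambda>N. {w::'n::finite list. length w < N}) (finite_subsets_at_top UNIV) sequentially"
  unfolding filterlim_iff
proof (intro allI impI)
  fix P :: "'n list set \<Rightarrow> bool"
  assume "eventually P (finite_subsets_at_top UNIV)"
  then obtain X where X: "finite X" "\<And>Z. finite Z \<Longrightarrow> X \<subseteq> Z \<Longrightarrow> P Z"
    unfolding eventually_finite_subsets_at_top by auto
  obtain N0 where N0: "\<forall>k\<in>length ` X. k < N0"
    using finite_nat_set_iff_bounded X(1) by blast
  have "P {w. length w < N}" if "N \<ge> N0" for N
    by (rule X(2)) (use N0 that in fastforce)+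
  then show "\<forall>\<^sub>F N in sequentially. P {w. length w < N}"
    unfolding eventually_sequentially by blast
qed

lemma has_sum_words:
  fixes g :: "'n::finite list \<Rightarrow> 'b::{comm_monoid_add, topological_space}"
  shows "(g has_sum s) UNIV \<Longrightarrow> (\<lambda>N. \<Sum>w | length w < N. g w) \<longlonglongrightarrow> s"
  unfolding has_sum_def by (rule filterlim_compose[OF _ filterlim_words])

lemma sum_words_less:
  fixes g :: "'n::finite list \<Rightarrow> 'b::comm_monoid_add"
  shows "(\<Sum>w | length w < N. g w) = (\<Sum>k<N. \<Sum>w | length w = k. g w)"
proof (induction N)
  case (Suc N)
  have "{w::'n list. length w < Suc N} = {w. length w < N} \<union> {w. length w = N}" by auto
  then show ?case using Suc by (simp add: sum.union_disjoint disjoint_iff)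
qed simp

lemma has_sum_word_levels:
  fixes g :: "'n::finite list \<Rightarrow> 'b::real_normed_vector"
  shows "(g has_sum s) UNIV \<Longrightarrow> (\<lambda>k. \<Sum>w | length w = k. g w) sums s"
  using has_sum_words[of g s] by (simp add: sums_def sum_words_less)

lemma sum_words_eq_Suc:
  fixes g :: "'n::finite list \<Rightarrow> 'b::comm_monoid_add"
  shows "(\<Sum>w | length w = Suc N. g w) = (\<Sum>i\<in>UNIV. \<Sum>w | length w = N. g (i # w))"
proof -
  have "{w::'n list. length w = Suc N} = (\<lambda>(i, w). i # w) ` (UNIV \<times> {w. length w = N})"
    by (auto simp: length_Suc_conv)
  then show ?thesis
    by (simp add: sum.cartesian_product sum.reindex inj_on_def case_prod_unfold o_def)
qed

lemma sum_words_less_Suc: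
  fixes g :: "'n::finite list \<Rightarrow> 'b::comm_monoid_add"
  shows "(\<Sum>w | length w < Suc N. g w) = g [] + (\<Sum>i\<in>UNIV. \<Sum>w | length w < N. g (i # w))"
proof -
  have "{w::'n list. length w < Suc N} =
      insert [] ((\<lambda>(i, w). i # w) ` (UNIV \<times> {w. length w < N}))"
  proof (rule set_eqI)
    fix w :: "'n list"
    show "w \<in> {w. length w < Suc N} \<longleftrightarrow>
        w \<in> insert [] ((\<lambda>(i, w). i # w) ` (UNIV \<times> {w. length w < N}))"
      by (cases w) auto
  qed
  then show ?thesis
    by (subst \<open>_ = _\<close>, subst sum.insert)
      (auto simp: sum.cartesian_product sum.reindex inj_on_def case_prod_unfold o_def)
qed

text \<open>An energy balance at one node, iterated along the tree of words. \<open>fold s w\<close>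
  lets the first letter of \<open>w\<close> act first, which fits the induction peeling off first
  letters. The invariant set \<open>V\<close> serves balances that hold only on the Fock space over
  a defect space.\<close>

lemma telescope_words:
  fixes s :: "'n::finite \<Rightarrow> 'x \<Rightarrow> 'x" and E p :: "'x \<Rightarrow> real"
  assumes inv: "\<And>i y. y \<in> V \<Longrightarrow> s i y \<in> V"
    and step: "\<And>y. y \<in> V \<Longrightarrow> E y = p y + (\<Sum>i\<in>UNIV. E (s i y))"
    and "y \<in> V"
  shows "E y = (\<Sum>w | length w < N. p (fold s w y)) + (\<Sum>w | length w = N. E (fold s w y))"
  using \<open>y \<in> V\<close>
proof (induction N arbitrary: y)
  case 0
  then show ?case by simp
next
  case (Suc N)
  show ?case
    unfolding sum_words_less_Suc sum_words_eq_Suc step[OF \<open>y \<in> V\<close>]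
    by (simp add: Suc.IH[OF inv[OF Suc.prems]] sum.distrib)
qed

text \<open>The adjoint of \<open>left_creation i\<close>, by \<open>cinner_left_creation\<close>.
  Having it in coordinates makes iterated shifts explicit: \<open>fold bshift w\<close> deletes the
  prefix \<open>w\<close>.\<close>

lift_definition bshift :: "'n \<Rightarrow> ('n, 'a::complex_inner) fock_tensor \<Rightarrow> ('n, 'a) fock_tensor"
  is "\<lambda>i f w. f (i # w)"
proof -
  fix i :: 'n and f :: "'n list \<Rightarrow> 'a"
  assume "(\<lambda>w. (norm (f w))\<^sup>2) summable_on UNIV"
  then have "(\<lambda>w. (norm (f w))\<^sup>2) summable_on range (Cons i)"
    by (rule summable_on_subset_banach) simp
  then show "(\<lambda>w. (norm (f (i # w)))\<^sup>2) summable_on UNIV"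
    by (subst (asm) summable_on_reindex) (auto simp: o_def)
qed

lemma comp_of_fold_bshift: "comp_of (fold bshift w f) v = comp_of f (w @ v)"
  by (induction w arbitrary: f) (simp_all add: bshift.rep_eq)

text \<open>The weak form of the relation that the projection onto 1 \<otimes> K and the range
  projections of the left creation operators sum to I. In the proof the word length is shifted by
  one: words shorter than N + 1 are the empty word and the words \<open>i # w\<close> with
  \<open>w\<close> shorter than N.\<close>

lemma cinner_fock_decomp:
  fixes f g :: "('n::finite, 'a::complex_inner) fock_tensor"
  shows "cinner f g = cinner (comp_of f []) (comp_of g []) + (\<Sum>i\<in>UNIV. cinner (bshift i f) (bshift i g))"
proof (rule LIMSEQ_unique[OF LIMSEQ_Suc[OF has_sum_words[OF has_sum_cinner_ell2]]])
  have "(\<lambda>N. \<Sum>w | length w < N. cinner (comp_of f (i # w)) (comp_of g (i # w)))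
      \<longlonglongrightarrow> cinner (bshift i f) (bshift i g)" for i
    using has_sum_words[OF has_sum_cinner_ell2[of "bshift i f" "bshift i g"]]
    by (simp add: bshift.rep_eq)
  then show "(\<lambda>N. \<Sum>w | length w < Suc N. cinner (comp_of f w) (comp_of g w)) \<longlonglongrightarrow>
      cinner (comp_of f []) (comp_of g []) + (\<Sum>i\<in>UNIV. cinner (bshift i f) (bshift i g))"
    unfolding sum_words_less_Suc by (intro tendsto_intros)
qed

lemma norm_fock_decomp:
  fixes f :: "('n::finite, 'a::complex_inner) fock_tensor"
  shows "(norm f)\<^sup>2 = (norm (comp_of f []))\<^sup>2 + (\<Sum>i\<in>UNIV. (norm (bshift i f))\<^sup>2)"
  using cinner_fock_decomp[of f f]
  by (simp add: cinner_self_eq_norm flip: of_real_sum of_real_add of_real_power del: of_real_power)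

lemma bounded_clinear_bshift:
  "bounded_clinear (bshift i :: ('n::finite, 'a::complex_inner) fock_tensor \<Rightarrow> _)"
proof (rule bounded_clinearI[where K=1])
  show "bshift i (f + g) = bshift i f + bshift i g" for f g :: "('n, 'a) fock_tensor"
    by (rule ell2_eqI) (simp add: bshift.rep_eq plus_ell2.rep_eq)
  show "bshift i (c *\<^sub>C f) = c *\<^sub>C bshift i f" for c and f :: "('n, 'a) fock_tensor"
    by (rule ell2_eqI) (simp add: bshift.rep_eq scaleC_ell2.rep_eq)
  show "norm (bshift i f) \<le> 1 * norm f" for f :: "('n, 'a) fock_tensor"
  proof -
    have "(norm (bshift i f))\<^sup>2 \<le> (\<Sum>i\<in>UNIV. (norm (bshift i f))\<^sup>2)"
      by (rule member_le_sum) auto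
    then have "(norm (bshift i f))\<^sup>2 \<le> (norm f)\<^sup>2"
      using norm_fock_decomp[of f] zero_le_power2[of "norm (comp_of f [])"] by linarith
    then have "norm (bshift i f) \<le> norm f" by (rule power2_le_imp_le) simp
    then show ?thesis by simp
  qed
qed

lemma fold_bshift_linear:
  "bounded_clinear (fold bshift w :: ('n::finite, 'a::complex_inner) fock_tensor \<Rightarrow> _)"
proof (induction w)
  case (Cons i w)
  then show ?case using bounded_clinear_compose[OF Cons bounded_clinear_bshift] by (simp add: o_def)
qed (simp add: bounded_clinear_id)

lemma norm_fock_levels:
  fixes f :: "('n::finite, 'a::complex_inner) fock_tensor"
  shows "(norm f)\<^sup>2 = (\<Sum>w | length w < N. (norm (comp_of f w))\<^sup>2) +
    (\<Sum>w | length w = N. (norm (fold bshift w f))\<^sup>2)"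
  using telescope_words[of UNIV bshift "\<lambda>f. (norm f)\<^sup>2" "\<lambda>f. (norm (comp_of f []))\<^sup>2" f N,
      OF UNIV_I norm_fock_decomp UNIV_I]
  by (simp add: comp_of_fold_bshift)

text \<open>The N-th term is the tail of a convergent sum. The backward shifts are thus pure, which
  removes the remainder terms both in the energy identity and in the uniqueness of the
  characteristic function.\<close>

lemma fock_tail_tendsto:
  fixes f :: "('n::finite, 'a::complex_inner) fock_tensor"
  shows "(\<lambda>N. \<Sum>w | length w = N. (norm (fold bshift w f))\<^sup>2) \<longlonglongrightarrow> 0"
proof -
  have "((\<lambda>w. (norm (comp_of f w))\<^sup>2) has_sum (norm f)\<^sup>2) UNIV"
    unfolding norm_ell2_sq by (rule has_sum_infsum[OF comp_of_summable])
  from tendsto_diff[OF tendsto_const[of "(norm f)\<^sup>2"] has_sum_words[OF this]]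
  have "(\<lambda>N. (norm f)\<^sup>2 - (\<Sum>w | length w < N. (norm (comp_of f w))\<^sup>2)) \<longlonglongrightarrow> 0" by simp
  moreover have "(norm f)\<^sup>2 - (\<Sum>w | length w < N. (norm (comp_of f w))\<^sup>2) =
      (\<Sum>w | length w = N. (norm (fold bshift w f))\<^sup>2)" for N
    using norm_fock_levels[of f N] by simp
  ultimately show ?thesis by simp
qed

lemma bshift_left_creation: "bshift j (left_creation i f) = (if j = i then f else 0)"
  by (rule ell2_eqI) (simp add: bshift.rep_eq left_creation.rep_eq zero_ell2.rep_eq)

lemma cinner_left_creation:
  fixes f g :: "('n::finite, 'a::complex_inner) fock_tensor"
  shows "cinner (left_creation i f) g = cinner f (bshift i g)"
proof -
  have "(\<Sum>j\<in>UNIV. cinner (bshift j (left_creation i f)) (bshift j g)) =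
      (\<Sum>j\<in>UNIV. if j = i then cinner f (bshift i g) else 0)"
    by (rule sum.cong) (auto simp: bshift_left_creation cinner_simps)
  then show ?thesis
    by (simp add: cinner_fock_decomp[of "left_creation i f"] left_creation.rep_eq cinner_simps)
qed

lemma bounded_clinear_left_creation:
  "bounded_clinear (left_creation i :: ('n::finite, 'a::complex_inner) fock_tensor \<Rightarrow> _)"
proof (rule bounded_clinear_of_adjoint[OF bounded_clinear_bshift])
  show "cinner (bshift i f) g = cinner f (left_creation i g)"
    for f g :: "('n, 'a) fock_tensor"
    using cinner_left_creation[of i g f]
    by (subst (1 2) cinner_commute) simp
qed

lemma slice_left_creation: "slice y (left_creation i f) = left_creation i (slice y f)"
  by (rule ell2_eqI)
    (auto simp: slice.rep_eq left_creation.rep_eq cinner_simps split: list.splits)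

lemma simple_tensor_left_creation:
  "simple_tensor (left_creation i \<phi>) y = left_creation i (simple_tensor \<phi> y)"
  by (rule ell2_eqI)
    (auto simp: simple_tensor.rep_eq left_creation.rep_eq split: list.splits)

lemma fock_decomp:
  fixes f :: "('n::finite, 'a::complex_inner) fock_tensor"
  shows "f = simple_tensor vacuum (comp_of f []) + (\<Sum>i\<in>UNIV. left_creation i (bshift i f))"
proof (rule ell2_eqI)
  fix w
  have "comp_of (\<Sum>i\<in>UNIV. left_creation i (bshift i f)) w =
      (\<Sum>i\<in>UNIV. comp_of (left_creation i (bshift i f)) w)"
    by (rule bounded_clinear_sum[OF bounded_clinear_comp_of])
  also have "\<dots> = (case w of [] \<Rightarrow> 0 | j # v \<Rightarrow> comp_of f w)"
    by (auto simp: left_creation.rep_eq bshift.rep_eq split: list.splits)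
  finally show "comp_of f w = comp_of (simple_tensor vacuum (comp_of f []) +
      (\<Sum>i\<in>UNIV. left_creation i (bshift i f))) w"
    by (auto simp: plus_ell2.rep_eq simple_tensor.rep_eq vacuum.rep_eq split: list.splits)
qed

lemma vacuum_eq_single: "vacuum = ell2_single [] 1"
  by (rule ell2_eqI) (simp add: vacuum.rep_eq ell2_single.rep_eq)

lemma left_creation_single: "left_creation i (ell2_single w x) = ell2_single (i # w) x"
  by (rule ell2_eqI) (auto simp: left_creation.rep_eq ell2_single.rep_eq split: list.splits)

lemma simple_tensor_single: "simple_tensor (ell2_single w c) x = ell2_single w (c *\<^sub>C x)"
  by (rule ell2_eqI) (simp add: simple_tensor.rep_eq ell2_single.rep_eq)

lemma simple_tensor_vacuum: "simple_tensor vacuum x = ell2_single [] x"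
  by (simp add: vacuum_eq_single simple_tensor_single)

lemma bshift_single_Nil: "bshift i (ell2_single [] x) = 0"
  by (rule ell2_eqI) (simp add: bshift.rep_eq ell2_single.rep_eq zero_ell2.rep_eq)

lemma bshift_single_Cons:
  "bshift j (ell2_single (i # w) x) = (if j = i then ell2_single w x else 0)"
  by (rule ell2_eqI) (simp add: bshift.rep_eq ell2_single.rep_eq zero_ell2.rep_eq)

subsection \<open>Tensor products with closed subspaces\<close>

text \<open>Replaces the closed linear hull by conditions on components and slices. The right hand
  side is a closed subspace containing the simple tensors, so it remains to see that none of its
  nonzero vectors is orthogonal to all of them.\<close>

lemma tensor_subspace_eq:
  fixes K :: "'a::chilbert_space set" and M :: "'n fock set"
  assumes M: "closed_csubspace M" and K: "closed_csubspace K"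
  shows "tensor_subspace M K = {f. (\<forall>w. comp_of f w \<in> K) \<and> (\<forall>y\<in>K. slice y f \<in> M)}"
    (is "_ = ?R")
  unfolding tensor_subspace_def
proof (rule closed_csubspace_eqI[OF closed_csubspace_hull])
  have "?R = (\<Inter>w. {f. comp_of f w \<in> K}) \<inter> (\<Inter>y\<in>K. {f. slice y f \<in> M})" by auto
  also have "\<dots> = \<Inter> (range (\<lambda>w. {f. comp_of f w \<in> K}) \<union> (\<lambda>y. {f. slice y f \<in> M}) ` K)"
    by auto
  finally show R: "closed_csubspace ?R"
    using closed_csubspace_vimage[OF bounded_clinear_comp_of K]
      closed_csubspace_vimage[OF bounded_clinear_slice M]
    by (auto intro!: closed_csubspace_Inter)
  have "slice y (simple_tensor \<phi> x) = cinner x y *\<^sub>C \<phi>" for \<phi> :: "'n fock" and x y :: 'a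
    by (rule ell2_eqI)
      (simp add: slice.rep_eq simple_tensor.rep_eq scaleC_ell2.rep_eq cinner_simps scaleC_complex_def)
  then show "closed_csubspace hull {simple_tensor \<phi> x |\<phi> x. \<phi> \<in> M \<and> x \<in> K} \<subseteq> ?R"
    using M K
    by (intro hull_minimal R) (auto simp: simple_tensor.rep_eq closed_csubspace_scaleC)
  fix f :: "('n, 'a) fock_tensor"
  assume f: "f \<in> ?R" and "f \<in> ortho_compl (closed_csubspace hull {simple_tensor \<phi> x |\<phi> x. \<phi> \<in> M \<and> x \<in> K})"
  then have ort: "cinner f (simple_tensor \<phi> x) = 0" if "\<phi> \<in> M" "x \<in> K" for \<phi> x
    using that unfolding ortho_compl_hull by (auto simp: ortho_compl_def)
  show "f = 0"
  proof (rule ell2_eqI)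
    fix w
    have fw: "comp_of f w \<in> K" using f by auto
    \<comment> \<open>The slice of \<open>f\<close> along its own component is an admissible left
      factor. Pairing \<open>f\<close> with the resulting simple tensor gives the squared norm of
      the slice, whose component at \<open>w\<close> is the squared norm of
      \<open>comp_of f w\<close>.\<close>
    then have "slice (comp_of f w) f \<in> M" using f by auto
    then have "cinner (slice (comp_of f w) f) (slice (comp_of f w) f) = 0"
      using ort[OF _ fw] by (simp add: cinner_slice)
    then have "comp_of (slice (comp_of f w) f) w = 0"
      by (simp add: cinner_self_zero_iff zero_ell2.rep_eq)
    then show "comp_of f w = comp_of 0 w"
      by (simp add: slice.rep_eq zero_ell2.rep_eq cinner_self_zero_iff)
  qed
qed

lemma tensor_subspace_UNIV:
  fixes K :: "'a::chilbert_space set"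
  assumes K: "closed_csubspace K"
  shows "(tensor_subspace UNIV K :: ('n, 'a) fock_tensor set) = {f. \<forall>w. comp_of f w \<in> K}"
  using tensor_subspace_eq[OF closed_csubspace_UNIV K] by simp

lemma closed_csubspace_tensor_subspace: "closed_csubspace (tensor_subspace M K)"
  unfolding tensor_subspace_def by (rule closed_csubspace_hull)

lemma tensor_subspace_mono: "M \<subseteq> M' \<Longrightarrow> tensor_subspace M K \<subseteq> tensor_subspace M' K"
  unfolding tensor_subspace_def by (rule hull_mono) blast

section \<open>Row contractions and their characteristic functions\<close>

locale row_contr =
  fixes T :: "'n::finite \<Rightarrow> 'h::chilbert_space \<Rightarrow> 'h"
  assumes row_contr: "row_contraction T"
begin

lemma T_linear: "bounded_clinear (T i)"
  using row_contr by (simp add: row_contraction_def)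

definition row_adj :: "'h \<Rightarrow> ('n, 'h) ell2"
  where "row_adj h = Abs_ell2 (\<lambda>i. cadjoint (T i) h)"

lemma comp_of_row_adj: "comp_of (row_adj h) i = cadjoint (T i) h"
  by (simp add: row_adj_def comp_of_Abs_ell2_finite)

lemma row_op_linear: "bounded_clinear (row_op T)"
proof -
  have "bounded_clinear (\<lambda>x. T i (comp_of x i))" for i
    by (rule bounded_clinear_compose[OF T_linear bounded_clinear_comp_of])
  then have "bounded_clinear (\<lambda>x. \<Sum>i\<in>UNIV. T i (comp_of x i))"
    by (rule bounded_clinear_bigsum)
  then show ?thesis by (simp add: row_op_def[abs_def])
qed

lemma row_op_adj: "cinner (row_op T x) h = cinner x (row_adj h)"
  by (simp add: row_op_def cinner_ell2_finite comp_of_row_adj cinner.sum_left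
      cinner_cadjoint[OF T_linear])

lemma row_adj_adj: "cinner (row_adj h) x = cinner h (row_op T x)"
  by (metis cinner_commute row_op_adj)

lemma cadjoint_row_op: "cadjoint (row_op T) = row_adj"
  by (rule cadjoint_eqI) (rule row_op_adj)

lemma row_adj_linear: "bounded_clinear row_adj"
  by (rule bounded_clinear_of_adjoint[OF row_op_linear]) (rule row_op_adj)

lemma row_op_row_adj: "row_op T (row_adj h) = (\<Sum>i\<in>UNIV. T i (cadjoint (T i) h))"
  by (simp add: row_op_def comp_of_row_adj)

lemma row_adj_le: "norm (row_adj h) \<le> norm h"
proof (rule power2_le_imp_le)
  have "positive_op (\<lambda>h. h - row_op T (row_adj h))"
    using row_contr by (simp add: row_contraction_def row_op_row_adj)
  from positive_opD(3)[OF this, of h] show "(norm (row_adj h))\<^sup>2 \<le> (norm h)\<^sup>2"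
    by (simp add: cinner_simps row_op_adj cinner_self_eq_norm)
qed simp

lemma row_op_le: "norm (row_op T x) \<le> norm x"
proof (rule norm_adjoint_le[of row_adj])
  show "cinner (row_adj h) x = cinner h (row_op T x)" for h x
    by (rule row_adj_adj)
qed (rule row_adj_le)

lemma selfadj1: "selfadjoint_contraction (\<lambda>h. row_op T (row_adj h))"
proof
  show "cinner (row_op T (row_adj x)) y = cinner x (row_op T (row_adj y))" for x y
    by (simp add: row_op_adj row_adj_adj)
  show "norm (row_op T (row_adj x)) \<le> norm x" for x
    using row_op_le row_adj_le order_trans by blast
qed (rule bounded_clinear_compose[OF row_op_linear row_adj_linear])

lemma selfadj2: "selfadjoint_contraction (\<lambda>x. row_adj (row_op T x))"
proof
  show "cinner (row_adj (row_op T x)) y = cinner x (row_adj (row_op T y))" for x y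
    by (simp add: row_op_adj[symmetric] row_adj_adj)
  show "norm (row_adj (row_op T x)) \<le> norm x" for x
    using row_op_le row_adj_le order_trans by blast
qed (rule bounded_clinear_compose[OF row_adj_linear row_op_linear])

lemma defect_op_eq: "defect_op T = positive_sqrt (\<lambda>h. h - row_op T (row_adj h))"
  by (simp add: defect_op_def row_op_row_adj)

lemma defect_op_star_eq: "defect_op_star T = positive_sqrt (\<lambda>x. x - row_adj (row_op T x))"
  by (simp add: defect_op_star_def cadjoint_row_op)

lemma defect_pos: "positive_op (defect_op T)"
  unfolding defect_op_eq by (rule selfadjoint_contraction.positive_sqrt_positive[OF selfadj1])

lemma defect_star_pos: "positive_op (defect_op_star T)"
  unfolding defect_op_star_eq by (rule selfadjoint_contraction.positive_sqrt_positive[OF selfadj2])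

lemmas defect_linear = positive_opD(1)[OF defect_pos]
lemmas defect_star_linear = positive_opD(1)[OF defect_star_pos]
lemmas defect_adj = positive_op_selfadjoint[OF defect_pos]
lemmas defect_star_adj = positive_op_selfadjoint[OF defect_star_pos]

lemma norm_defect: "(norm (defect_op T h))\<^sup>2 + (norm (row_adj h))\<^sup>2 = (norm h)\<^sup>2"
proof -
  have "cinner (defect_op T h) (defect_op T h) = cinner (h - row_op T (row_adj h)) h"
    unfolding defect_adj[symmetric] unfolding defect_op_eq
    by (simp add: selfadjoint_contraction.positive_sqrt_square[OF selfadj1])
  then have "Re (cinner (defect_op T h) (defect_op T h)) + Re (cinner (row_adj h) (row_adj h)) = Re (cinner h h)"
    by (simp add: cinner_simps row_op_adj)
  then show ?thesis by (simp add: cinner_self_eq_norm)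
qed

lemma norm_defect_star: "(norm (defect_op_star T x))\<^sup>2 + (norm (row_op T x))\<^sup>2 = (norm x)\<^sup>2"
proof -
  have "cinner (defect_op_star T x) (defect_op_star T x) = cinner x (x - row_adj (row_op T x))"
    unfolding defect_star_adj unfolding defect_op_star_eq
    by (simp add: selfadjoint_contraction.positive_sqrt_square[OF selfadj2])
  then have "Re (cinner (defect_op_star T x) (defect_op_star T x)) +
      Re (cinner (row_op T x) (row_op T x)) = Re (cinner x x)"
    by (simp add: cinner_simps row_op_adj)
  then show ?thesis by (simp add: cinner_self_eq_norm)
qed

text \<open>The row operator intertwines the two products formed with its adjoint, hence also the
  square roots. This relation makes the cross terms in \<open>norm_julia\<close> cancel.\<close>

lemma row_op_defect_star: "row_op T (defect_op_star T x) = defect_op T (row_op T x)"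
  unfolding defect_op_eq defect_op_star_eq
  by (rule positive_sqrt_intertwine[OF selfadj2 selfadj1 row_op_linear]) simp

lemma row_adj_defect: "row_adj (defect_op T h) = defect_op_star T (row_adj h)"
  unfolding defect_op_eq defect_op_star_eq
  by (rule positive_sqrt_intertwine[OF selfadj1 selfadj2 row_adj_linear]) simp

lemma defect_space_closed: "closed_csubspace (defect_space T)"
  unfolding defect_space_def by (rule closed_csubspace_closure_range[OF defect_linear])

lemma defect_space_star_closed: "closed_csubspace (defect_space_star T)"
  unfolding defect_space_star_def by (rule closed_csubspace_closure_range[OF defect_star_linear])

lemma defect_in: "defect_op T h \<in> defect_space T"
  unfolding defect_space_def by (rule subsetD[OF closure_subset rangeI])

lemma defect_star_in: "defect_op_star T x \<in> defect_space_star T"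
  unfolding defect_space_star_def by (rule subsetD[OF closure_subset rangeI])

text \<open>By the intertwining relation this holds on the range of the defect operator, and the
  condition is closed. It places the constant coefficient of \<Theta> in the defect space.\<close>

lemma row_op_in: "x \<in> defect_space_star T \<Longrightarrow> row_op T x \<in> defect_space T"
proof -
  have "closure (range (defect_op_star T)) \<subseteq> {x. row_op T x \<in> defect_space T}"
    using closed_csubspace_closed[OF closed_csubspace_vimage[OF row_op_linear defect_space_closed]]
    by (intro closure_minimal) (auto simp: row_op_defect_star defect_in)
  then show "x \<in> defect_space_star T \<Longrightarrow> row_op T x \<in> defect_space T"
    by (auto simp: defect_space_star_def)
qed

lemma row_adj_in: "h \<in> defect_space T \<Longrightarrow> row_adj h \<in> defect_space_star T"
proof -
  have "closure (range (defect_op T)) \<subseteq> {h. row_adj h \<in> defect_space_star T}"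
    using closed_csubspace_closed[OF closed_csubspace_vimage[OF row_adj_linear defect_space_star_closed]]
    by (intro closure_minimal) (auto simp: row_adj_defect defect_star_in)
  then show "h \<in> defect_space T \<Longrightarrow> row_adj h \<in> defect_space_star T"
    by (auto simp: defect_space_def)
qed

subsection \<open>The Poisson kernel\<close>

lemma word_op_Cons: "word_op T (i # w) = T i \<circ> word_op T w"
  by (simp add: word_op_def)

lemma word_op_Nil: "word_op T [] = id"
  by (simp add: word_op_def)

lemma word_op_linear: "bounded_clinear (word_op T w)"
proof (induction w)
  case (Cons i w)
  then show ?case
    using bounded_clinear_compose[OF T_linear Cons] by (simp add: word_op_Cons o_def)
qed (simp add: word_op_Nil bounded_clinear_id)

text \<open>Taking adjoints reverses products, so the first letter acts first, as in
  \<open>fold bshift\<close>. The two orders agree, and the intertwining property of the Poisson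
  kernel is a comparison of components.\<close>

abbreviation word_adj :: "'n list \<Rightarrow> 'h \<Rightarrow> 'h"
  where "word_adj \<equiv> fold (\<lambda>i. cadjoint (T i))"

lemma cadjoint_word_op: "cadjoint (word_op T w) h = word_adj w h"
proof (induction w arbitrary: h)
  case (Cons i w)
  then show ?case unfolding word_op_Cons cadjoint_comp[OF T_linear word_op_linear] by simp
qed (simp add: word_op_Nil cadjoint_id)

lemma word_adj_linear: "bounded_clinear (word_adj w)"
  using bounded_clinear_cadjoint[OF word_op_linear, of w] by (simp add: cadjoint_word_op[abs_def])

text \<open>The defect identity iterated along words. The first sum bounds the Poisson kernel; the
  second is the quantity in the definition of a completely non-coisometric row contraction.\<close>

lemma norm_word_levels:
  "(norm h)\<^sup>2 = (\<Sum>w | length w < N. (norm (defect_op T (word_adj w h)))\<^sup>2) +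
    (\<Sum>w | length w = N. (norm (word_adj w h))\<^sup>2)"
proof (rule telescope_words[of UNIV "\<lambda>i. cadjoint (T i)" "\<lambda>h. (norm h)\<^sup>2" "\<lambda>h. (norm (defect_op T h))\<^sup>2"])
  show "(norm y)\<^sup>2 = (norm (defect_op T y))\<^sup>2 + (\<Sum>i\<in>UNIV. (norm (cadjoint (T i) y))\<^sup>2)" for y
    using norm_defect[of y] by (simp add: norm_ell2_finite comp_of_row_adj)
qed auto

definition poisson :: "'h \<Rightarrow> ('n, 'h) fock_tensor"
  where "poisson h = Abs_ell2 (\<lambda>w. defect_op T (word_adj w h))"

lemma
  shows comp_of_poisson: "comp_of (poisson h) w = defect_op T (word_adj w h)"
    and norm_poisson_le: "norm (poisson h) \<le> norm h"
proof -
  have *: "(\<Sum>w\<in>F. (norm (defect_op T (word_adj w h)))\<^sup>2) \<le> (norm h)\<^sup>2" if "finite F" for F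
  proof -
    obtain N where N: "F \<subseteq> {w. length w < N}" by (rule finite_words_bounded[OF \<open>finite F\<close>])
    have "(\<Sum>w\<in>F. (norm (defect_op T (word_adj w h)))\<^sup>2) \<le>
        (\<Sum>w | length w < N. (norm (defect_op T (word_adj w h)))\<^sup>2)"
      by (rule sum_mono2) (use N in auto)
    also have "\<dots> \<le> (norm h)\<^sup>2"
      unfolding norm_word_levels[of h N] by (simp add: sum_nonneg)
    finally show ?thesis .
  qed
  show "comp_of (poisson h) w = defect_op T (word_adj w h)"
    unfolding poisson_def using sq_summable_Abs_le(1)[OF *] by simp
  show "norm (poisson h) \<le> norm h"
    unfolding poisson_def using sq_summable_Abs_le(2)[OF *] by simp
qed

lemma poisson_linear: "bounded_clinear poisson"
proof (rule bounded_clinearI[where K=1])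
  show "poisson (x + y) = poisson x + poisson y" for x y
    by (rule ell2_eqI) (simp add: comp_of_poisson plus_ell2.rep_eq
        bounded_clinear_add[OF word_adj_linear] bounded_clinear_add[OF defect_linear])
  show "poisson (c *\<^sub>C x) = c *\<^sub>C poisson x" for c x
    by (rule ell2_eqI) (simp add: comp_of_poisson scaleC_ell2.rep_eq
        bounded_clinear_scaleC[OF word_adj_linear] bounded_clinear_scaleC[OF defect_linear])
qed (simp add: norm_poisson_le)

lemma bshift_poisson: "bshift i (poisson h) = poisson (cadjoint (T i) h)"
  by (rule ell2_eqI) (simp add: bshift.rep_eq comp_of_poisson)

text \<open>If all components vanish, the level identity reduces to its second sum, for every
  length; complete non-coisometry excludes this for nonzero \<open>h\<close>.\<close>

lemma poisson_injective:
  assumes "completely_non_coisometric T" and "poisson h = 0"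
  shows "h = 0"
proof (rule ccontr)
  assume "h \<noteq> 0"
  have "defect_op T (word_adj w h) = 0" for w
    using comp_of_poisson[of h w] assms(2) by (simp add: zero_ell2.rep_eq)
  then have "(\<Sum>w | length w = k. (norm (cadjoint (word_op T w) h))\<^sup>2) = (norm h)\<^sup>2" for k
    using norm_word_levels[of h k] by (simp add: cadjoint_word_op)
  then show False
    using assms(1) \<open>h \<noteq> 0\<close> unfolding completely_non_coisometric_def by blast
qed

definition poisson_adj :: "('n, 'h) fock_tensor \<Rightarrow> 'h"
  where "poisson_adj = cadjoint poisson"

lemma cinner_poisson: "cinner (poisson h) y = cinner h (poisson_adj y)"
  unfolding poisson_adj_def by (rule cinner_cadjoint[OF poisson_linear])

lemma cinner_poisson_adj: "cinner (poisson_adj y) h = cinner y (poisson h)"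
  unfolding poisson_adj_def by (rule cinner_cadjoint'[OF poisson_linear])

lemma poisson_adj_linear: "bounded_clinear poisson_adj"
  unfolding poisson_adj_def by (rule bounded_clinear_cadjoint[OF poisson_linear])

lemma norm_poisson_adj_le: "norm (poisson_adj y) \<le> norm y"
  by (rule norm_adjoint_le[OF cinner_poisson norm_poisson_le])

definition poisson_row :: "('n, 'h) fock_tensor \<Rightarrow> ('n, 'h) ell2"
  where "poisson_row y = Abs_ell2 (\<lambda>i. poisson_adj (bshift i y))"

lemma comp_of_poisson_row: "comp_of (poisson_row y) i = poisson_adj (bshift i y)"
  by (simp add: poisson_row_def comp_of_Abs_ell2_finite)

text \<open>Dual to \<open>bshift_poisson\<close>: splitting off the empty word expresses the
  adjoint Poisson transform of \<open>y\<close> through those of its backward shifts. The pair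
  \<open>comp_of y []\<close>, \<open>poisson_row y\<close> is the input of the isometric matrix
  used below, and this is its first output.\<close>

lemma poisson_adj_decomp:
  "poisson_adj y = defect_op T (comp_of y []) + row_op T (poisson_row y)"
proof (rule cinner_left_ext)
  fix h
  have "cinner (poisson_adj y) h = cinner (comp_of y []) (defect_op T h) +
      (\<Sum>i\<in>UNIV. cinner (poisson_adj (bshift i y)) (cadjoint (T i) h))"
    by (simp add: cinner_poisson_adj cinner_fock_decomp[of y] comp_of_poisson bshift_poisson)
  also have "\<dots> = cinner (defect_op T (comp_of y [])) h + cinner (poisson_row y) (row_adj h)"
    by (simp add: defect_adj cinner_ell2_finite comp_of_poisson_row comp_of_row_adj)
  finally show "cinner (poisson_adj y) h =
      cinner (defect_op T (comp_of y []) + row_op T (poisson_row y)) h"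
    by (simp add: cinner_simps row_op_adj)
qed

subsection \<open>The adjoint of the characteristic function\<close>

text \<open>The component of the adjoint of \<Theta> at the empty word, which is the second output
  of the isometric matrix.\<close>

definition char_adj0 :: "('n, 'h) fock_tensor \<Rightarrow> ('n, 'h) ell2"
  where "char_adj0 y = defect_op_star T (poisson_row y) - row_adj (comp_of y [])"

text \<open>An operator commuting with the backward shifts is determined by its components at the
  empty word; the component at \<open>w\<close> is the one of the shifted vector.\<close>

definition char_adj :: "('n, 'h) fock_tensor \<Rightarrow> ('n, ('n, 'h) ell2) fock_tensor"
  where "char_adj y = Abs_ell2 (\<lambda>w. char_adj0 (fold bshift w y))"

text \<open>The matrix with rows \<open>(\<Delta>, T)\<close> and \<open>(-T\<^sup>*, \<Delta>\<^sub>*)\<close> is isometric; summed over the tree of words, this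
  energy balance telescopes to \<open>\<parallel>\<Theta>\<^sub>T\<^sup>* y\<parallel>\<^sup>2 + \<parallel>K\<^sup>* y\<parallel>\<^sup>2 = \<parallel>y\<parallel>\<^sup>2\<close>.\<close>

lemma norm_julia:
  "(norm (defect_op_star T g - row_adj y))\<^sup>2 + (norm (defect_op T y + row_op T g))\<^sup>2 =
    (norm y)\<^sup>2 + (norm g)\<^sup>2"
proof -
  have "cinner (defect_op T y) (row_op T g) = cinner y (row_op T (defect_op_star T g))"
    by (simp add: defect_adj row_op_defect_star)
  also have "\<dots> = cnj (cinner (row_op T (defect_op_star T g)) y)"
    by (rule cinner_commute)
  finally have "Re (cinner (defect_op T y) (row_op T g)) = Re (cinner (defect_op_star T g) (row_adj y))"
    by (simp add: row_op_adj)
  then show ?thesis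
    using norm_sq_add[of "defect_op_star T g" "- row_adj y"]
      norm_sq_add[of "defect_op T y" "row_op T g"] norm_defect[of y] norm_defect_star[of g]
    by (simp add: cinner_simps)
qed

text \<open>The matrix balance rearranged as a recursion for the energy of
  \<open>poisson_adj\<close>. The contribution of a node is a difference and may have either sign,
  so it is the telescoped identity that yields bounds.\<close>

lemma char_adj0_energy:
  "(norm (poisson_adj y))\<^sup>2 = ((norm (comp_of y []))\<^sup>2 - (norm (char_adj0 y))\<^sup>2) +
    (\<Sum>i\<in>UNIV. (norm (poisson_adj (bshift i y)))\<^sup>2)"
  using norm_julia[of "poisson_row y" "comp_of y []"]
  by (simp add: char_adj0_def poisson_adj_decomp[symmetric] norm_ell2_finite comp_of_poisson_row)

lemma char_adj_levels:
  "(\<Sum>w | length w < N. (norm (char_adj0 (fold bshift w y)))\<^sup>2) + (norm (poisson_adj y))\<^sup>2 =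
    (\<Sum>w | length w < N. (norm (comp_of y w))\<^sup>2) +
    (\<Sum>w | length w = N. (norm (poisson_adj (fold bshift w y)))\<^sup>2)"
  using telescope_words[of UNIV bshift "\<lambda>y. (norm (poisson_adj y))\<^sup>2"
      "\<lambda>y. (norm (comp_of y []))\<^sup>2 - (norm (char_adj0 y))\<^sup>2" y N, OF UNIV_I char_adj0_energy UNIV_I]
  by (simp add: comp_of_fold_bshift sum_subtractf)

lemma poisson_adj_tail_le:
  "(\<Sum>w | length w = N. (norm (poisson_adj (fold bshift w y)))\<^sup>2) \<le>
    (\<Sum>w | length w = N. (norm (fold bshift w y))\<^sup>2)"
  by (intro sum_mono power_mono norm_poisson_adj_le) simp

text \<open>The remainder at length N in \<open>char_adj_levels\<close> is at most the corresponding
  remainder of \<open>y\<close>, because \<open>poisson_adj\<close> is a contraction. Together with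
  the partial sum for \<open>y\<close> this gives at most the squared norm of \<open>y\<close>,
  independently of N.\<close>

lemma
  shows comp_of_char_adj: "comp_of (char_adj y) w = char_adj0 (fold bshift w y)"
    and norm_char_adj_le: "norm (char_adj y) \<le> norm y"
proof -
  have *: "(\<Sum>w\<in>F. (norm (char_adj0 (fold bshift w y)))\<^sup>2) \<le> (norm y)\<^sup>2" if "finite F" for F
  proof -
    obtain N where N: "F \<subseteq> {w. length w < N}" by (rule finite_words_bounded[OF \<open>finite F\<close>])
    have "(\<Sum>w\<in>F. (norm (char_adj0 (fold bshift w y)))\<^sup>2) \<le>
        (\<Sum>w | length w < N. (norm (char_adj0 (fold bshift w y)))\<^sup>2)"
      by (rule sum_mono2) (use N in auto)
    also have "\<dots> \<le> (norm y)\<^sup>2"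
      using char_adj_levels[where N=N and y=y] norm_fock_levels[of y N] poisson_adj_tail_le[where N=N and y=y]
        zero_le_power2[of "norm (poisson_adj y)"]
      by linarith
    finally show ?thesis .
  qed
  show "comp_of (char_adj y) w = char_adj0 (fold bshift w y)"
    unfolding char_adj_def using sq_summable_Abs_le(1)[OF *] by simp
  show "norm (char_adj y) \<le> norm y"
    unfolding char_adj_def using sq_summable_Abs_le(2)[OF *] by simp
qed

text \<open>The limit of \<open>char_adj_levels\<close>: its remainder is dominated by the Fock
  space tail of \<open>y\<close>, which tends to 0.\<close>

lemma norm_char_adj_poisson_adj:
  "(norm (char_adj y))\<^sup>2 + (norm (poisson_adj y))\<^sup>2 = (norm y)\<^sup>2"
proof (rule LIMSEQ_unique)
  have "((\<lambda>w. (norm (char_adj0 (fold bshift w y)))\<^sup>2) has_sum (norm (char_adj y))\<^sup>2) UNIV"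
    unfolding norm_ell2_sq[of "char_adj y"] comp_of_char_adj[symmetric]
    by (rule has_sum_infsum[OF comp_of_summable])
  from tendsto_add[OF has_sum_words[OF this] tendsto_const[of "(norm (poisson_adj y))\<^sup>2"]]
  show "(\<lambda>N. (\<Sum>w | length w < N. (norm (char_adj0 (fold bshift w y)))\<^sup>2) + (norm (poisson_adj y))\<^sup>2)
      \<longlonglongrightarrow> (norm (char_adj y))\<^sup>2 + (norm (poisson_adj y))\<^sup>2" .
  have "((\<lambda>w. (norm (comp_of y w))\<^sup>2) has_sum (norm y)\<^sup>2) UNIV"
    unfolding norm_ell2_sq by (rule has_sum_infsum[OF comp_of_summable])
  note y = has_sum_words[OF this]
  have "(\<lambda>N. \<Sum>w | length w = N. (norm (poisson_adj (fold bshift w y)))\<^sup>2) \<longlonglongrightarrow> 0"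
    by (rule tendsto_sandwich[OF _ _ tendsto_const fock_tail_tendsto[of y]])
      (auto intro!: always_eventually sum_nonneg poisson_adj_tail_le)
  from tendsto_add[OF y this]
  show "(\<lambda>N. (\<Sum>w | length w < N. (norm (char_adj0 (fold bshift w y)))\<^sup>2) + (norm (poisson_adj y))\<^sup>2)
      \<longlonglongrightarrow> (norm y)\<^sup>2"
    unfolding char_adj_levels by simp
qed

lemma poisson_row_linear:
  "poisson_row (x + y) = poisson_row x + poisson_row y" "poisson_row (c *\<^sub>C x) = c *\<^sub>C poisson_row x"
  by (rule ell2_eqI, simp add: comp_of_poisson_row plus_ell2.rep_eq scaleC_ell2.rep_eq
      bounded_clinear_add[OF bounded_clinear_bshift] bounded_clinear_add[OF poisson_adj_linear]
      bounded_clinear_scaleC[OF bounded_clinear_bshift] bounded_clinear_scaleC[OF poisson_adj_linear])+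

lemma char_adj_linear: "bounded_clinear char_adj"
proof (rule bounded_clinearI[where K=1])
  show "char_adj (x + y) = char_adj x + char_adj y" for x y
    by (rule ell2_eqI) (simp add: comp_of_char_adj char_adj0_def poisson_row_linear plus_ell2.rep_eq
        bounded_clinear_add[OF fold_bshift_linear] bounded_clinear_add[OF defect_star_linear]
        bounded_clinear_add[OF row_adj_linear])
  show "char_adj (c *\<^sub>C x) = c *\<^sub>C char_adj x" for c x
    by (rule ell2_eqI) (simp add: comp_of_char_adj char_adj0_def poisson_row_linear scaleC_ell2.rep_eq
        bounded_clinear_scaleC[OF fold_bshift_linear] bounded_clinear_scaleC[OF defect_star_linear]
        bounded_clinear_scaleC[OF row_adj_linear] scaleC_diff_right)
qed (simp add: norm_char_adj_le)

lemma bshift_char_adj: "bshift i (char_adj y) = char_adj (bshift i y)"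
  by (rule ell2_eqI) (simp add: bshift.rep_eq comp_of_char_adj)

lemma char_adj_in:
  assumes "\<And>w. comp_of y w \<in> defect_space T"
  shows "comp_of (char_adj y) w \<in> defect_space_star T"
  using assms
  by (auto simp: comp_of_char_adj char_adj0_def comp_of_fold_bshift
      intro!: closed_csubspace_diff[OF defect_space_star_closed] defect_star_in row_adj_in)

subsection \<open>The characteristic function\<close>

text \<open>Boundedness, the norm bound and the commutation with left creation operators pass over
  from \<open>char_adj\<close> by duality.\<close>

definition char_op :: "('n, ('n, 'h) ell2) fock_tensor \<Rightarrow> ('n, 'h) fock_tensor"
  where "char_op = cadjoint char_adj"

lemma cinner_char_adj: "cinner (char_adj y) f = cinner y (char_op f)"
  unfolding char_op_def by (rule cinner_cadjoint[OF char_adj_linear])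

lemma cinner_char_op: "cinner (char_op f) y = cinner f (char_adj y)"
  unfolding char_op_def by (rule cinner_cadjoint'[OF char_adj_linear])

lemma char_op_linear: "bounded_clinear char_op"
  unfolding char_op_def by (rule bounded_clinear_cadjoint[OF char_adj_linear])

lemma norm_char_op_le: "norm (char_op f) \<le> norm f"
  by (rule norm_adjoint_le[OF cinner_char_adj norm_char_adj_le])

lemma char_op_left_creation: "char_op (left_creation i f) = left_creation i (char_op f)"
  by (rule cinner_left_ext) (simp add: cinner_char_op cinner_left_creation bshift_char_adj)

text \<open>The component at \<open>w\<close> is tested against \<open>k\<close> by pairing with the
  vector \<open>k\<close> placed at \<open>w\<close>. For the empty word only the term with
  \<open>row_adj\<close> survives; for \<open>i # v\<close> only the i-th entry of
  \<open>poisson_row\<close>, whose dual is the Poisson kernel at \<open>v\<close>.\<close>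

lemma char_op_coeff: "comp_of (char_op (simple_tensor vacuum x)) w = char_coeff T w x"
proof (rule cinner_left_ext)
  fix k
  have "cinner (comp_of (char_op (simple_tensor vacuum x)) w) k =
      cinner x (char_adj0 (ell2_single w k))"
    unfolding cinner_ell2_single[symmetric]
    by (simp add: cinner_char_op simple_tensor_vacuum cinner_ell2_single_left comp_of_char_adj)
  also have "\<dots> = cinner (char_coeff T w x) k"
  proof (cases w)
    case Nil
    have "poisson_row (ell2_single [] k) = 0"
      by (rule ell2_eqI) (simp add: comp_of_poisson_row bshift_single_Nil zero_ell2.rep_eq
          bounded_clinear_zero[OF poisson_adj_linear])
    then show ?thesis
      by (simp add: Nil char_adj0_def bounded_clinear_zero[OF defect_star_linear] ell2_single.rep_eq
          cinner_simps row_op_adj)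
  next
    case (Cons i v)
    have "poisson_row (ell2_single (i # v) k) = ell2_single i (poisson_adj (ell2_single v k))"
      by (rule ell2_eqI) (simp add: comp_of_poisson_row bshift_single_Cons ell2_single.rep_eq
          bounded_clinear_zero[OF poisson_adj_linear])
    then have "cinner x (char_adj0 (ell2_single w k)) =
        cinner (comp_of (defect_op_star T x) i) (poisson_adj (ell2_single v k))"
      by (simp add: Cons char_adj0_def ell2_single.rep_eq bounded_clinear_zero[OF row_adj_linear]
          defect_star_adj[symmetric] cinner_ell2_single)
    then show ?thesis
      by (simp add: Cons cinner_poisson[symmetric] cinner_ell2_single comp_of_poisson cadjoint_word_op)
  qed
  finally show "cinner (comp_of (char_op (simple_tensor vacuum x)) w) k = cinner (char_coeff T w x) k" .
qed

text \<open>For \<open>k\<close> orthogonal to the defect space, the vector \<open>y\<close> with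
  \<open>k\<close> at \<open>w\<close> is invisible to the Poisson kernel, whose components lie in
  that space. Only the constant coefficient of \<Theta> is then seen by \<open>y\<close>, and
  \<open>row_op_in\<close> disposes of it.\<close>

lemma char_op_in:
  assumes f: "\<And>w. comp_of f w \<in> defect_space_star T"
  shows "comp_of (char_op f) w \<in> defect_space T"
proof (rule in_closed_csubspaceI[OF defect_space_closed])
  fix k assume k: "k \<in> ortho_compl (defect_space T)"
  define y where "y = (ell2_single w k :: ('n, 'h) fock_tensor)"
  have adj0: "poisson_adj (fold bshift v y) = 0" for v
  proof (rule cinner_left_ext)
    fix h
    have "cinner (poisson_adj (fold bshift v y)) h =
        (\<Sum>\<^sub>\<infinity>u. cinner (comp_of y (v @ u)) (defect_op T (word_adj u h)))"
      by (simp add: cinner_poisson_adj cinner_ell2_def comp_of_fold_bshift comp_of_poisson)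
    also have "\<dots> = 0"
      by (rule infsum_0)
        (auto simp: y_def ell2_single.rep_eq cinner_simps intro!: ortho_complD[OF k] defect_in)
    finally show "cinner (poisson_adj (fold bshift v y)) h = cinner 0 h" by (simp add: cinner_simps)
  qed
  have "poisson_row (fold bshift v y) = 0" for v
    using adj0[of "v @ [_]"]
    by (intro ell2_eqI) (simp add: comp_of_poisson_row zero_ell2.rep_eq)
  then have "comp_of (char_adj y) v = - row_adj (comp_of y v)" for v
    by (simp add: comp_of_char_adj char_adj0_def bounded_clinear_zero[OF defect_star_linear]
        comp_of_fold_bshift)
  then have "cinner (comp_of f v) (comp_of (char_adj y) v) =
      - cinner (row_op T (comp_of f v)) (comp_of y v)" for v
    by (simp add: cinner_simps row_op_adj)
  then have "cinner (comp_of f v) (comp_of (char_adj y) v) = 0" for v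
    using ortho_compl_sym[OF k row_op_in[OF f[of v]]]
    by (cases "v = w") (simp_all add: cinner_simps y_def ell2_single.rep_eq)
  then have "cinner f (char_adj y) = 0" by (simp add: cinner_ell2_def)
  then show "cinner (comp_of (char_op f) w) k = 0"
    unfolding cinner_ell2_single[symmetric] y_def[symmetric] by (simp add: cinner_char_op)
qed

section \<open>Existence and uniqueness of the characteristic function\<close>

lemma fock_defect_space:
  "(tensor_subspace UNIV (defect_space T) :: ('n, 'h) fock_tensor set) = {f. \<forall>w. comp_of f w \<in> defect_space T}"
  by (rule tensor_subspace_UNIV[OF defect_space_closed])

lemma fock_defect_space_star:
  "(tensor_subspace UNIV (defect_space_star T) :: ('n, ('n, 'h) ell2) fock_tensor set) =
    {f. \<forall>w. comp_of f w \<in> defect_space_star T}"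
  by (rule tensor_subspace_UNIV[OF defect_space_star_closed])

lemma is_char_function_char_op: "is_char_function T char_op"
  unfolding is_char_function_def contraction_between_def clinear_on_def
  by (auto simp: bounded_clinear_add[OF char_op_linear] bounded_clinear_scaleC[OF char_op_linear]
      norm_char_op_le char_op_left_creation char_op_coeff fock_defect_space fock_defect_space_star
      char_op_in)

text \<open>The difference \<open>D\<close> of two candidates vanishes on 1 \<otimes> x and commutes
  with the left creation operators. Hence its energy at \<open>f\<close> equals the total energy
  over all backward shifts of \<open>f\<close> along words of length N. As a difference of two
  contractions \<open>D\<close> has norm at most 2, whence the factor 4, and the tail of
  \<open>f\<close> tends to 0.\<close>

lemma is_char_function_unique:
  assumes \<Theta>: "is_char_function T \<Theta>" and f: "f \<in> tensor_subspace UNIV (defect_space_star T)"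
  shows "\<Theta> f = char_op f"
proof -
  let ?V = "tensor_subspace UNIV (defect_space_star T) :: ('n, ('n, 'h) ell2) fock_tensor set"
  have V: "closed_csubspace ?V" by (rule closed_csubspace_tensor_subspace)
  have lin: "clinear_on ?V \<Theta>" and le: "\<And>f. f \<in> ?V \<Longrightarrow> norm (\<Theta> f) \<le> norm f"
    and left: "\<And>i f. f \<in> ?V \<Longrightarrow> \<Theta> (left_creation i f) = left_creation i (\<Theta> f)"
    and coeff: "\<And>x \<alpha>. x \<in> defect_space_star T \<Longrightarrow>
      comp_of (\<Theta> (simple_tensor vacuum x)) \<alpha> = char_coeff T \<alpha> x"
    using \<Theta> by (auto simp: is_char_function_def contraction_between_def)
  have Vs: "bshift i f \<in> ?V" if "f \<in> ?V" for i f
    using that by (auto simp: fock_defect_space_star bshift.rep_eq)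
  have VL: "left_creation i f \<in> ?V" if "f \<in> ?V" for i f
    using that closed_csubspace_0[OF defect_space_star_closed]
    by (auto simp: fock_defect_space_star left_creation.rep_eq split: list.splits)
  define D where "D f = \<Theta> f - char_op f" for f
  have D: "D f = (\<Sum>i\<in>UNIV. left_creation i (D (bshift i f)))" if f: "f \<in> ?V" for f
  proof -
    have f0: "comp_of f [] \<in> defect_space_star T" using f by (auto simp: fock_defect_space_star)
    then have v: "simple_tensor vacuum (comp_of f []) \<in> ?V"
      using closed_csubspace_0[OF defect_space_star_closed]
      by (auto simp: fock_defect_space_star simple_tensor_vacuum ell2_single.rep_eq)
    have "\<Theta> (simple_tensor vacuum (comp_of f [])) = char_op (simple_tensor vacuum (comp_of f []))"
      by (rule ell2_eqI) (simp add: coeff[OF f0] char_op_coeff)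
    moreover have "(\<Sum>i\<in>UNIV. left_creation i (bshift i f)) \<in> ?V \<and>
        \<Theta> (\<Sum>i\<in>UNIV. left_creation i (bshift i f)) = (\<Sum>i\<in>UNIV. \<Theta> (left_creation i (bshift i f)))"
      by (rule clinear_on_sum[OF lin V VL[OF Vs[OF f]]])
    then have "\<Theta> f = \<Theta> (simple_tensor vacuum (comp_of f [])) +
        (\<Sum>i\<in>UNIV. left_creation i (\<Theta> (bshift i f)))"
      using lin v by (subst fock_decomp[of f]) (simp add: clinear_on_def left Vs f)
    moreover have "char_op f = char_op (simple_tensor vacuum (comp_of f [])) +
        (\<Sum>i\<in>UNIV. left_creation i (char_op (bshift i f)))"
      by (subst fock_decomp[of f]) (simp add: bounded_clinear_add[OF char_op_linear]
          bounded_clinear_sum[OF char_op_linear] char_op_left_creation)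
    ultimately show ?thesis
      by (simp add: D_def bounded_clinear_diff[OF bounded_clinear_left_creation] sum_subtractf)
  qed
  have norm_sum: "(norm (\<Sum>i\<in>UNIV. left_creation i (d i)))\<^sup>2 = (\<Sum>i\<in>UNIV. (norm (d i))\<^sup>2)"
    for d :: "'n \<Rightarrow> ('n, 'h) fock_tensor"
  proof -
    have "bshift j (\<Sum>i\<in>UNIV. left_creation i (d i)) = d j" for j
      by (simp add: bounded_clinear_sum[OF bounded_clinear_bshift] bshift_left_creation)
    moreover have "comp_of (\<Sum>i\<in>UNIV. left_creation i (d i)) [] = 0"
      by (simp add: bounded_clinear_sum[OF bounded_clinear_comp_of] left_creation.rep_eq)
    ultimately show ?thesis by (simp add: norm_fock_decomp[of "\<Sum>i\<in>UNIV. left_creation i (d i)"])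
  qed
  have step: "(norm (D f))\<^sup>2 = 0 + (\<Sum>i\<in>UNIV. (norm (D (bshift i f)))\<^sup>2)" if "f \<in> ?V" for f
    by (subst D[OF that]) (simp add: norm_sum)
  have Dle: "(norm (D g))\<^sup>2 \<le> 4 * (norm g)\<^sup>2" if "g \<in> ?V" for g
  proof -
    have "norm (D g) \<le> 2 * norm g"
      unfolding D_def
      using norm_triangle_ineq4[of "\<Theta> g" "char_op g"] le[OF that] norm_char_op_le[of g] by linarith
    then show ?thesis using power_mono[of "norm (D g)" "2 * norm g" 2] by (simp add: power_mult_distrib)
  qed
  have Vf: "fold bshift w f \<in> ?V" for w
    using f by (auto simp: fock_defect_space_star comp_of_fold_bshift)
  have "(norm (D f))\<^sup>2 \<le> 4 * (\<Sum>w | length w = N. (norm (fold bshift w f))\<^sup>2)" for N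
  proof -
    have "(norm (D f))\<^sup>2 = (\<Sum>w | length w = N. (norm (D (fold bshift w f)))\<^sup>2)"
      using telescope_words[of ?V bshift "\<lambda>f. (norm (D f))\<^sup>2" "\<lambda>_. 0" f N, OF Vs step f] by simp
    also have "\<dots> \<le> (\<Sum>w | length w = N. 4 * (norm (fold bshift w f))\<^sup>2)"
      by (intro sum_mono Dle Vf)
    finally show ?thesis by (simp add: sum_distrib_left)
  qed
  then have "(norm (D f))\<^sup>2 \<le> 4 * 0"
    by (intro LIMSEQ_le_const[OF tendsto_mult_left[OF fock_tail_tendsto[of f]]]) blast
  then show ?thesis by (simp add: D_def)
qed

lemma char_function_eq:
  "f \<in> tensor_subspace UNIV (defect_space_star T) \<Longrightarrow> char_function T f = char_op f"
  by (rule is_char_function_unique)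
    (auto simp: char_function_def intro: someI[of "is_char_function T", OF is_char_function_char_op])

end

section \<open>Constrained row contractions\<close>

text \<open>The commutant of a bounded operator is a WOT-closed algebra.\<close>

lemma nc_toeplitz_commute:
  fixes C :: "'n::finite fock \<Rightarrow> 'n fock"
  assumes C: "bounded_clinear C" and comm: "\<And>i f. left_creation i (C f) = C (left_creation i f)"
    and \<phi>: "\<phi> \<in> nc_toeplitz"
  shows "bounded_clinear \<phi>" and "\<phi> (C f) = C (\<phi> f)"
proof -
  define X where "X = {A. bounded_clinear A \<and> (\<forall>f. A (C f) = C (A f))}"
  \<comment> \<open>Commutation with \<open>C\<close> is tested on matrix coefficients, with
    \<open>C\<close> moved to the second argument as its adjoint. It becomes a family of equations
    between coordinates, closed in the product topology from which \<open>wot\<close> is pulled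
    back.\<close>
  define Z where "Z = {F :: 'n fock \<times> 'n fock \<Rightarrow> complex. \<forall>x y. F (C x, y) = F (x, cadjoint C y)}"
  have "closed Z"
    unfolding Z_def
    by (intro closed_Collect_all closed_Collect_eq continuous_on_product_coordinates)
  have "op_algebra X"
    unfolding op_algebra_def X_def
    by (auto simp: o_def bounded_clinear_add[OF C] bounded_clinear_scaleC[OF C]
        intro: bounded_clinear_plus bounded_clinear_smult bounded_clinear_compose)
  moreover have "closedin wot X"
  proof -
    let ?e = "\<lambda>A (x, y). cinner (A x) y"
    have top: "topspace wot = {A :: 'n fock \<Rightarrow> 'n fock. bounded_clinear A}"
      by (simp add: wot_def topspace_pullback_topology)
    have XZ: "A \<in> X \<longleftrightarrow> bounded_clinear A \<and> ?e A \<in> Z" for A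
    proof -
      have "cinner (C (A x)) y = cinner (A x) (cadjoint C y)" for x y
        by (rule cinner_cadjoint[OF C])
      then show ?thesis
        unfolding X_def Z_def by (auto intro: cinner_left_ext)
    qed
    have "topspace wot - X = ?e -` (- Z) \<inter> {A. bounded_clinear A}"
      unfolding top by (auto simp: XZ)
    moreover have "openin euclidean (- Z)" using \<open>closed Z\<close> by (simp add: open_Compl)
    ultimately have "openin wot (topspace wot - X)"
      unfolding wot_def openin_pullback_topology by blast
    moreover have "X \<subseteq> topspace wot" unfolding top by (auto simp: X_def)
    ultimately show ?thesis by (simp add: closedin_def)
  qed
  moreover have "insert id (range left_creation) \<subseteq> X"
    by (auto simp: X_def bounded_clinear_id bounded_clinear_left_creation comm)
  ultimately have "nc_toeplitz \<subseteq> X"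
    unfolding nc_toeplitz_def by (intro hull_minimal) auto
  then show "bounded_clinear \<phi>" and "\<phi> (C f) = C (\<phi> f)"
    using \<phi> by (auto simp: X_def)
qed

lemma nc_toeplitz_linear:
  fixes \<phi> :: "'n::finite fock \<Rightarrow> 'n fock"
  shows "\<phi> \<in> nc_toeplitz \<Longrightarrow> bounded_clinear \<phi>"
  by (rule nc_toeplitz_commute(1)[of id]) (simp_all add: bounded_clinear_id)

section \<open>Membership in N_J\<close>

lemma left_creation_nc_toeplitz: "(left_creation i :: 'n fock \<Rightarrow> 'n fock) \<in> nc_toeplitz"
  unfolding nc_toeplitz_def by (rule hull_inc) simp

lemma N_space_closed: "closed_csubspace (N_space J)"
  unfolding N_space_def by (rule closed_csubspace_ortho_compl)

lemma N_space_iff: "g \<in> N_space J \<longleftrightarrow> (\<forall>\<phi>\<in>J. \<forall>f. cinner g (\<phi> f) = 0)"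
  unfolding N_space_def M_space_def ortho_compl_hull by (auto simp: ortho_compl_def)

text \<open>An ideal absorbs left creation operators on the right, so the value of \<phi> at a basis
  vector is the value at the vacuum of another element of \<open>J\<close>. Hence the hypothesis
  annihilates all coordinates of \<open>cadjoint \<phi> g\<close>.\<close>

lemma N_spaceI_vacuum:
  fixes J :: "('n::finite fock \<Rightarrow> 'n fock) set"
  assumes J: "wot_closed_ideal J" and g: "\<And>\<phi>. \<phi> \<in> J \<Longrightarrow> cinner g (\<phi> vacuum) = 0"
  shows "g \<in> N_space J"
  unfolding N_space_iff
proof (intro ballI allI)
  fix \<phi> f assume \<phi>: "\<phi> \<in> J"
  then have lin: "bounded_clinear \<phi>"
    using J nc_toeplitz_linear by (auto simp: wot_closed_ideal_def)
  have single: "cinner g (\<phi> (ell2_single w 1)) = 0" for w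
    using \<phi>
  proof (induction w arbitrary: \<phi>)
    case Nil
    then show ?case using g by (simp add: vacuum_eq_single)
  next
    case (Cons i w)
    then have "\<phi> \<circ> left_creation i \<in> J"
      using J left_creation_nc_toeplitz[of i] unfolding wot_closed_ideal_def by blast
    from Cons.IH[OF this] show ?case by (simp add: left_creation_single)
  qed
  have "cadjoint \<phi> g = 0"
  proof (rule ell2_eqI)
    fix w
    have "cinner (comp_of (cadjoint \<phi> g) w) 1 = 0"
      using single[of w] by (simp add: cinner_ell2_single[symmetric] cinner_cadjoint'[OF lin])
    then show "comp_of (cadjoint \<phi> g) w = comp_of 0 w"
      by (simp add: cinner_complex_def zero_ell2.rep_eq)
  qed
  then show "cinner g (\<phi> f) = 0"
    by (simp add: cinner_cadjoint'[OF lin, symmetric] cinner_simps)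
qed

context row_contr
begin

lemma poisson_adj_single: "poisson_adj (ell2_single w y) = word_op T w (defect_op T y)"
proof (rule cinner_left_ext)
  fix h
  show "cinner (poisson_adj (ell2_single w y)) h = cinner (word_op T w (defect_op T y)) h"
    by (simp add: cinner_poisson_adj cinner_ell2_single_left comp_of_poisson
        cinner_cadjoint[OF word_op_linear] cadjoint_word_op defect_adj)
qed

text \<open>The homogeneous part is the adjoint Poisson transform of the part of a \<otimes> y in
  degree \<open>k\<close>. The bound is uniform in \<open>k\<close>, so the radial series at a
  vector in the range of the defect operator converges for r < 1.\<close>

lemma norm_sum_word_op_defect_le:
  fixes a :: "'n fock"
  shows "norm (\<Sum>w | length w = k. comp_of a w *\<^sub>C word_op T w (defect_op T y)) \<le> norm (simple_tensor a y)"
proof -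
  define u where "u = (\<Sum>w | length w = k. ell2_single w (comp_of a w *\<^sub>C y))"
  have "poisson_adj u = (\<Sum>w | length w = k. comp_of a w *\<^sub>C word_op T w (defect_op T y))"
    by (simp add: u_def bounded_clinear_sum[OF poisson_adj_linear] poisson_adj_single
        bounded_clinear_scaleC[OF defect_linear] bounded_clinear_scaleC[OF word_op_linear])
  moreover have "norm u \<le> norm (simple_tensor a y)"
  proof (rule norm_ell2_mono)
    fix v
    have "comp_of u v = (\<Sum>w | length w = k. if v = w then comp_of a w *\<^sub>C y else 0)"
      by (simp add: u_def bounded_clinear_sum[OF bounded_clinear_comp_of] ell2_single.rep_eq)
    then show "norm (comp_of u v) \<le> norm (comp_of (simple_tensor a y) v)"
      by (simp add: simple_tensor.rep_eq)
  qed
  ultimately show ?thesis using norm_poisson_adj_le[of u] by simp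
qed

text \<open>The pairing \<open>\<langle>f(1) \<otimes> y, K h\<rangle>\<close> is the absolutely convergent sum whose Abel means are
  \<open>\<langle>f(rT) \<Delta> y, h\<rangle>\<close>.\<close>

lemma cinner_slice_poisson_eq_0:
  fixes f :: "'n fock \<Rightarrow> 'n fock"
  assumes f: "has_functional_calculus T f (\<lambda>_. 0)"
  shows "cinner (slice y (poisson h)) (f vacuum) = 0"
proof -
  define a where "a = f vacuum"
  define x where "x = defect_op T y"
  define g where "g w = comp_of a w * cinner (word_op T w x) h" for w
  define c where "c k = (\<Sum>w | length w = k. g w)" for k
  define z where "z k = (\<Sum>w | length w = k. comp_of a w *\<^sub>C word_op T w x)" for k
  have cz: "c k = cinner (z k) h" for k
    by (simp add: c_def z_def g_def cinner.sum_left cinner_simps)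
  have "cinner (comp_of a w) (comp_of (slice y (poisson h)) w) = g w" for w
    by (simp add: g_def x_def cinner_complex_def slice.rep_eq comp_of_poisson
        cinner_cadjoint[OF word_op_linear] cadjoint_word_op defect_adj flip: cinner_commute)
  then have gsum: "(g has_sum cinner a (slice y (poisson h))) UNIV"
    using has_sum_cinner_ell2[of a "slice y (poisson h)"] by simp
  then have csum: "c sums cinner a (slice y (poisson h))"
    unfolding c_def by (rule has_sum_word_levels)
  \<comment> \<open>Unconditional summability of complex numbers is absolute. This provides the
    majorant, independent of r, that the exchange of limit and sum requires.\<close>
  have "(\<lambda>w. norm (g w)) summable_on UNIV"
    using gsum summable_on_iff_abs_summable_on_complex has_sum_imp_summable by blast
  then have "summable (\<lambda>k. \<Sum>w | length w = k. norm (g w))"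
    using has_sum_word_levels[OF has_sum_infsum] sums_summable by blast
  then have abs: "summable (\<lambda>k. norm (c k))"
    by (rule summable_comparison_test') (simp add: c_def norm_sum)
  have lim1: "((\<lambda>r. \<Sum>k. complex_of_real r ^ k * c k) \<longlongrightarrow> (\<Sum>k. 1 ^ k * c k)) (at_left 1)"
  proof (rule tannerys_theorem[THEN conjunct2, THEN conjunct2])
    show "((\<lambda>r. complex_of_real r ^ k * c k) \<longlongrightarrow> 1 ^ k * c k) (at_left 1)" for k
      using tendsto_of_real[OF tendsto_ident_at, of 1 "{..<1::real}", where 'a=complex]
      by (intro tendsto_intros) simp
    have "\<forall>\<^sub>F r in at_left (1::real). r \<in> {0<..<1}"
      by (rule eventually_at_left_real) simp
    then have "\<forall>\<^sub>F (k, r) in at_top \<times>\<^sub>F at_left 1. r \<in> {0<..<1::real}"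
      unfolding eventually_prod_filter
      by (intro exI[of _ "\<lambda>_. True"] exI[of _ "\<lambda>r. r \<in> {0<..<1::real}"]) auto
    then show "\<forall>\<^sub>F (k, r) in at_top \<times>\<^sub>F at_left 1. norm (complex_of_real r ^ k * c k) \<le> norm (c k)"
    proof (rule eventually_mono, clarify)
      fix k and r :: real assume r: "r \<in> {0<..<1}"
      have "r ^ k \<le> 1" using r by (simp add: power_le_one)
      then show "norm (complex_of_real r ^ k * c k) \<le> norm (c k)"
        using r by (simp add: norm_mult norm_power mult_left_le_one_le)
    qed
  qed (use abs in auto)
  have lim2: "((\<lambda>r. \<Sum>k. complex_of_real r ^ k * c k) \<longlongrightarrow> 0) (at_left 1)"
  proof (rule Lim_transform_eventually)
    let ?F = "\<lambda>r. \<Sum>k. \<Sum>w | length w = k. (complex_of_real r ^ length w * comp_of (f vacuum) w) *\<^sub>C word_op T w x"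
    have "((\<lambda>r. cinner (?F r) h) \<longlongrightarrow> cinner 0 h) (at_left 1)"
      using f unfolding has_functional_calculus_def by (intro cinner.tendsto tendsto_const) auto
    then show "((\<lambda>r. cinner (?F r) h) \<longlongrightarrow> 0) (at_left 1)" by (simp add: cinner_simps)
    have "\<forall>\<^sub>F r in at_left (1::real). r \<in> {0<..<1}"
      by (rule eventually_at_left_real) simp
    then show "\<forall>\<^sub>F r in at_left 1. cinner (?F r) h = (\<Sum>k. complex_of_real r ^ k * c k)"
    proof eventually_elim
      case (elim r)
      have zk: "(\<Sum>w | length w = k. (complex_of_real r ^ length w * comp_of (f vacuum) w) *\<^sub>C word_op T w x) =
          complex_of_real r ^ k *\<^sub>C z k" for k
        unfolding z_def a_def by (simp add: scaleC_sum_right scaleC_scaleC)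
      \<comment> \<open>The inner product may be moved into the series only if the vector series
        converges; a geometric majorant is available since r < 1.\<close>
      have "summable (\<lambda>k. complex_of_real r ^ k *\<^sub>C z k)"
      proof (rule summable_comparison_test')
        show "summable (\<lambda>k. norm (simple_tensor a y) * r ^ k)"
          using elim by (intro summable_mult summable_geometric) simp
        show "norm (complex_of_real r ^ k *\<^sub>C z k) \<le> norm (simple_tensor a y) * r ^ k" for k
          using norm_sum_word_op_defect_le[of a y k] elim
          by (simp add: norm_scaleC norm_power z_def x_def mult.commute mult_left_mono)
      qed
      then have "cinner (\<Sum>k. complex_of_real r ^ k *\<^sub>C z k) h =
          (\<Sum>k. cinner (complex_of_real r ^ k *\<^sub>C z k) h)"
        by (rule bounded_linear.suminf[OF cinner.bounded_linear_left])
      then show ?case unfolding zk by (simp add: cinner_simps cz)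
    qed
  qed
  have "(\<Sum>k. 1 ^ k * c k) = 0"
    by (rule tendsto_unique[OF _ lim1 lim2]) simp
  then have "cinner a (slice y (poisson h)) = 0"
    using sums_unique[OF csum] by simp
  then show ?thesis
    unfolding a_def by (subst cinner_commute) simp
qed

lemma poisson_in:
  assumes "wot_closed_ideal J" and "constrained J T"
  shows "poisson h \<in> tensor_subspace (N_space J) (defect_space T)"
  unfolding tensor_subspace_eq[OF N_space_closed defect_space_closed]
  using assms N_spaceI_vacuum[OF assms(1)] cinner_slice_poisson_eq_0
  by (auto simp: constrained_def comp_of_poisson defect_in)

text \<open>Components are handled by \<open>char_adj_in\<close>; for the slices, the adjoint is
  moved back, and \<open>y\<close> has to be orthogonal to the image under \<Theta> of every \<phi>
  f \<otimes> z with \<phi> in \<open>J\<close>. It suffices to check this on simple tensors g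
  \<otimes> x with \<open>g\<close> in N_J.\<close>

lemma char_adj_in_tensor:
  assumes J: "wot_closed_ideal J" and y: "y \<in> tensor_subspace (N_space J) (defect_space T)"
  shows "char_adj y \<in> tensor_subspace (N_space J) (defect_space_star T)"
  unfolding tensor_subspace_eq[OF N_space_closed defect_space_star_closed]
proof (intro CollectI conjI allI ballI)
  show "comp_of (char_adj y) w \<in> defect_space_star T" for w
    using y unfolding tensor_subspace_eq[OF N_space_closed defect_space_closed]
    by (intro char_adj_in) auto
  fix z
  show "slice z (char_adj y) \<in> N_space J"
    unfolding N_space_iff
  proof (intro ballI allI)
    fix \<phi> and f :: "'n fock" assume \<phi>: "\<phi> \<in> J"
    define v where "v = char_op (simple_tensor (\<phi> f) z)"
    have "tensor_subspace (N_space J) (defect_space T) \<subseteq> ortho_compl {v}"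
      unfolding tensor_subspace_def
    proof (rule hull_minimal[where S=closed_csubspace, OF _ closed_csubspace_ortho_compl], clarify)
      fix g :: "'n fock" and x assume g: "g \<in> N_space J"
      \<comment> \<open>A matrix coefficient of \<Theta>, that is, an operator on the scalar Fock
        space commuting with the left creation operators. As \<phi> commutes with it, the slice of
        \<open>v\<close> along \<open>x\<close> lies in the range of \<phi>, which is orthogonal to
        \<open>g\<close>.\<close>
      let ?C = "\<lambda>f. slice x (char_op (simple_tensor f z))"
      have C: "bounded_clinear ?C"
        by (rule bounded_clinear_compose[OF bounded_clinear_slice
              bounded_clinear_compose[OF char_op_linear bounded_clinear_simple_tensor]])
      have "\<phi> (?C f) = ?C (\<phi> f)"
        by (rule nc_toeplitz_commute(2)[of ?C, OF C])
          (use J \<phi> in \<open>auto simp: wot_closed_ideal_def simple_tensor_left_creation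
              char_op_left_creation slice_left_creation\<close>)
      then have "cinner g (slice x v) = 0"
        using g \<phi> unfolding N_space_iff v_def by metis
      then have "cinner (slice x v) g = 0" by (subst cinner_commute) simp
      then have "cinner (simple_tensor g x) v = 0"
        by (subst cinner_commute) (simp add: cinner_slice)
      then show "simple_tensor g x \<in> ortho_compl {v}" by (simp add: ortho_compl_def)
    qed
    then have "cinner y v = 0" using y by (auto simp: ortho_compl_def)
    then show "cinner (slice z (char_adj y)) (\<phi> f) = 0"
      by (simp add: cinner_slice cinner_char_adj v_def)
  qed
qed

text \<open>Testing within N_J \<otimes> D makes the projection disappear. Together with
  \<open>char_adj_in_tensor\<close> it identifies the restriction of \<open>char_adj\<close> as the
  adjoint of the constrained characteristic function.\<close>

lemma cinner_constrained_char_function: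
  assumes f: "f \<in> tensor_subspace (N_space J) (defect_space_star T)"
    and g: "g \<in> tensor_subspace (N_space J) (defect_space T)"
  shows "cinner (constrained_char_function J T f) g = cinner f (char_adj g)"
proof -
  have "f \<in> tensor_subspace UNIV (defect_space_star T)"
    using f tensor_subspace_mono[of "N_space J" UNIV] by blast
  then show ?thesis
    unfolding constrained_char_function_def
    by (simp add: cinner_ortho_proj[OF closed_csubspace_tensor_subspace g] char_function_eq cinner_char_op)
qed

end

section \<open>Unitary operators\<close>

lemma
  assumes "unitary_between K K' \<tau>"
  shows unitary_add: "x \<in> K \<Longrightarrow> y \<in> K \<Longrightarrow> \<tau> (x + y) = \<tau> x + \<tau> y"
    and unitary_scaleC: "x \<in> K \<Longrightarrow> \<tau> (c *\<^sub>C x) = c *\<^sub>C \<tau> x"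
    and unitary_in: "x \<in> K \<Longrightarrow> \<tau> x \<in> K'"
    and unitary_surj: "z \<in> K' \<Longrightarrow> \<exists>x\<in>K. z = \<tau> x"
    and unitary_cinner: "x \<in> K \<Longrightarrow> y \<in> K \<Longrightarrow> cinner (\<tau> x) (\<tau> y) = cinner x y"
    and unitary_norm: "x \<in> K \<Longrightarrow> norm (\<tau> x) = norm x"
  using assms norm_eq_of_cinner unfolding unitary_between_def clinear_on_def by blast+

lemma unitary_bounded_clinear: "unitary_between UNIV UNIV U \<Longrightarrow> bounded_clinear U"
  by (rule bounded_clinearI[where K=1]) (auto simp: unitary_add unitary_scaleC unitary_norm)

lemma unitary_inverse:
  assumes U: "unitary_between UNIV UNIV U"
  obtains V where "unitary_between UNIV UNIV V" "\<And>x. V (U x) = x" "\<And>y. U (V y) = y"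
proof
  have surj: "surj U" using U by (simp add: unitary_between_def)
  have "inj U"
  proof (rule injI)
    fix x y assume "U x = U y"
    then have "norm (U (x - y)) = 0"
      by (simp add: bounded_clinear_diff[OF unitary_bounded_clinear[OF U]])
    then show "x = y" by (simp add: unitary_norm[OF U])
  qed
  then show VU: "inv U (U x) = x" for x by simp
  show UV: "U (inv U y) = y" for y by (rule surj_f_inv_f[OF surj])
  have "inv U (x + y) = inv U x + inv U y" for x y
    using VU[of "inv U x + inv U y"] by (simp add: unitary_add[OF U] UV)
  moreover have "inv U (c *\<^sub>C x) = c *\<^sub>C inv U x" for c x
    using VU[of "c *\<^sub>C inv U x"] by (simp add: unitary_scaleC[OF U] UV)
  moreover have "cinner (inv U x) (inv U y) = cinner x y" for x y
    using unitary_cinner[OF U, of "inv U x" "inv U y"] by (simp add: UV)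
  moreover have "range (inv U) = UNIV" using VU by (metis surjI)
  ultimately show "unitary_between UNIV UNIV (inv U)"
    by (simp add: unitary_between_def clinear_on_def)
qed

section \<open>Isometries defined on a dense range\<close>

lemma cinner_eq_of_norm_eq:
  fixes A :: "'x::complex_inner \<Rightarrow> 'a::complex_inner" and A' :: "'x \<Rightarrow> 'b::complex_inner"
  assumes G: "closed_csubspace G" and A: "clinear_on G A" and A': "clinear_on G A'"
    and eq: "\<And>g. g \<in> G \<Longrightarrow> norm (A g) = norm (A' g)" and x: "x \<in> G" and y: "y \<in> G"
  shows "cinner (A x) (A y) = cinner (A' x) (A' y)"
proof -
  have re: "Re (cinner (A x) (A y)) = Re (cinner (A' x) (A' y))" if y: "y \<in> G" for y
  proof -
    have "norm (A x + A y) = norm (A' x + A' y)"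
      using eq[OF closed_csubspace_add[OF G x y]] A A' x y by (simp add: clinear_on_def)
    then show ?thesis
      using norm_sq_add[of "A x" "A y"] norm_sq_add[of "A' x" "A' y"] eq x y by simp
  qed
  have "Re (cinner (A x) (A (\<i> *\<^sub>C y))) = Re (cinner (A' x) (A' (\<i> *\<^sub>C y)))"
    by (rule re[OF closed_csubspace_scaleC[OF G y]])
  then have "Im (cinner (A x) (A y)) = Im (cinner (A' x) (A' y))"
    using A A' y by (simp add: clinear_on_def cinner_simps)
  then show ?thesis using re[OF y] by (simp add: complex_eq_iff)
qed

text \<open>Equality of norms on the subspace \<open>G\<close> makes
  \<open>A g \<mapsto> A' g\<close> well defined and distance preserving on a dense set. It extends
  by uniform continuity, and its algebraic properties pass to limits along sequences from
  \<open>G\<close>.\<close>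

lemma isometry_extension:
  fixes A :: "'x::complex_inner \<Rightarrow> 'a::chilbert_space" and A' :: "'x \<Rightarrow> 'b::chilbert_space"
  assumes G: "closed_csubspace G" and A: "clinear_on G A" and A': "clinear_on G A'"
    and eq: "\<And>g. g \<in> G \<Longrightarrow> norm (A g) = norm (A' g)" and dense: "closure (A ` G) = UNIV"
  obtains U where "bounded_clinear U" "\<And>x y. cinner (U x) (U y) = cinner x y"
    "\<And>g. g \<in> G \<Longrightarrow> U (A g) = A' g"
proof -
  have diff: "A (g - k) = A g - A k \<and> A' (g - k) = A' g - A' k" if "g \<in> G" "k \<in> G" for g k
  proof -
    have "g - k \<in> G" using closed_csubspace_diff[OF G that] .
    then have "A (g - k + k) = A (g - k) + A k" "A' (g - k + k) = A' (g - k) + A' k"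
      using A A' \<open>k \<in> G\<close> unfolding clinear_on_def by blast+
    then show ?thesis by simp
  qed
  have dist: "dist (A g) (A k) = dist (A' g) (A' k)" if "g \<in> G" "k \<in> G" for g k
    using eq[OF closed_csubspace_diff[OF G that]] diff[OF that] by (simp add: dist_norm)
  \<comment> \<open>The choice of a preimage is immaterial: two preimages in \<open>G\<close> under
    \<open>A\<close> have the same image under \<open>A'\<close>.\<close>
  define f where "f x = A' (inv_into G A x)" for x
  have f: "f (A g) = A' g" if "g \<in> G" for g
  proof -
    have k: "inv_into G A (A g) \<in> G" "A (inv_into G A (A g)) = A g"
      using that by (auto intro: inv_into_into f_inv_into_f)
    show ?thesis using dist[OF k(1) that] by (simp add: f_def k(2))
  qed
  have "uniformly_continuous_on (A ` G) f"
    unfolding uniformly_continuous_on_def by (auto simp: f dist)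
  then obtain U where Uc: "uniformly_continuous_on (closure (A ` G)) U"
    and Uf: "\<And>x. x \<in> A ` G \<Longrightarrow> f x = U x"
    by (rule uniformly_continuous_on_extension_on_closure) (use that in blast)
  have cont: "isCont U x" for x
    using uniformly_continuous_imp_continuous[OF Uc] by (simp add: dense continuous_on_eq_continuous_at)
  have UA: "U (A g) = A' g" if "g \<in> G" for g
    using Uf[of "A g"] f[OF that] that by simp
  have approx: "\<exists>k. (\<forall>n. k n \<in> G) \<and> (\<lambda>n. A (k n)) \<longlonglongrightarrow> x \<and> (\<lambda>n. A' (k n)) \<longlonglongrightarrow> U x" for x
  proof -
    have "x \<in> closure (A ` G)" by (simp add: dense)
    then obtain s where s: "\<forall>n. s n \<in> A ` G" "s \<longlonglongrightarrow> x" unfolding closure_sequential by blast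
    define k where "k n = inv_into G A (s n)" for n
    have k: "\<forall>n. k n \<in> G \<and> s n = A (k n)"
      using s(1) by (auto simp: k_def inv_into_into f_inv_into_f)
    have "s = (\<lambda>n. A (k n))" using k by auto
    with s(2) have Ak: "(\<lambda>n. A (k n)) \<longlonglongrightarrow> x" by simp
    have "(\<lambda>n. U (A (k n))) \<longlonglongrightarrow> U x" by (rule isCont_tendsto_compose[OF cont Ak])
    then show ?thesis using k Ak by (intro exI[of _ k]) (simp add: UA)
  qed
  have Uinner: "cinner (U x) (U y) = cinner x y" for x y
  proof -
    obtain k l where k: "\<forall>n. k n \<in> G" "(\<lambda>n. A (k n)) \<longlonglongrightarrow> x" "(\<lambda>n. A' (k n)) \<longlonglongrightarrow> U x"
      and l: "\<forall>n. l n \<in> G" "(\<lambda>n. A (l n)) \<longlonglongrightarrow> y" "(\<lambda>n. A' (l n)) \<longlonglongrightarrow> U y"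
      using approx[of x] approx[of y] by blast
    have "(\<lambda>n. cinner (A (k n)) (A (l n))) \<longlonglongrightarrow> cinner (U x) (U y)"
      using cinner.tendsto[OF k(3) l(3)] k(1) l(1)
      by (simp add: cinner_eq_of_norm_eq[OF G A A' eq])
    then show ?thesis
      by (rule LIMSEQ_unique) (rule cinner.tendsto[OF k(2) l(2)])
  qed
  have "U (x + y) = U x + U y" for x y
  proof -
    obtain k l where k: "\<forall>n. k n \<in> G" "(\<lambda>n. A (k n)) \<longlonglongrightarrow> x" "(\<lambda>n. A' (k n)) \<longlonglongrightarrow> U x"
      and l: "\<forall>n. l n \<in> G" "(\<lambda>n. A (l n)) \<longlonglongrightarrow> y" "(\<lambda>n. A' (l n)) \<longlonglongrightarrow> U y"
      using approx[of x] approx[of y] by blast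
    have "(\<lambda>n. A (k n + l n)) \<longlonglongrightarrow> x + y"
      using tendsto_add[OF k(2) l(2)] A k(1) l(1) by (simp add: clinear_on_def)
    then have "(\<lambda>n. U (A (k n + l n))) \<longlonglongrightarrow> U (x + y)"
      by (rule isCont_tendsto_compose[OF cont])
    moreover have "U (A (k n + l n)) = A' (k n) + A' (l n)" for n
      using UA[OF closed_csubspace_add[OF G]] k(1) l(1) A' by (simp add: clinear_on_def)
    ultimately have "(\<lambda>n. A' (k n) + A' (l n)) \<longlonglongrightarrow> U (x + y)" by simp
    then show ?thesis by (rule LIMSEQ_unique) (rule tendsto_add[OF k(3) l(3)])
  qed
  moreover have "U (c *\<^sub>C x) = c *\<^sub>C U x" for c x
  proof -
    obtain k where k: "\<forall>n. k n \<in> G" "(\<lambda>n. A (k n)) \<longlonglongrightarrow> x" "(\<lambda>n. A' (k n)) \<longlonglongrightarrow> U x"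
      using approx[of x] by blast
    have "(\<lambda>n. A (c *\<^sub>C k n)) \<longlonglongrightarrow> c *\<^sub>C x"
      using tendsto_scaleC[OF k(2)] A k(1) by (simp add: clinear_on_def)
    then have "(\<lambda>n. U (A (c *\<^sub>C k n))) \<longlonglongrightarrow> U (c *\<^sub>C x)"
      by (rule isCont_tendsto_compose[OF cont])
    moreover have "U (A (c *\<^sub>C k n)) = c *\<^sub>C A' (k n)" for n
      using UA[OF closed_csubspace_scaleC[OF G]] k(1) A' by (simp add: clinear_on_def)
    ultimately have "(\<lambda>n. c *\<^sub>C A' (k n)) \<longlonglongrightarrow> U (c *\<^sub>C x)" by simp
    then show ?thesis by (rule LIMSEQ_unique) (rule tendsto_scaleC[OF k(3)])
  qed
  moreover have "norm (U x) = norm x" for x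
    by (rule norm_eq_of_cinner[OF Uinner])
  ultimately have "bounded_clinear U" by (intro bounded_clinearI[where K=1]) auto
  then show ?thesis using Uinner UA by (rule that)
qed

lemma isometry_extension_unitary:
  fixes A :: "'x::complex_inner \<Rightarrow> 'a::chilbert_space" and A' :: "'x \<Rightarrow> 'b::chilbert_space"
  assumes G: "closed_csubspace G" and A: "clinear_on G A" and A': "clinear_on G A'"
    and eq: "\<And>g. g \<in> G \<Longrightarrow> norm (A g) = norm (A' g)"
    and dense: "closure (A ` G) = UNIV" and dense': "closure (A' ` G) = UNIV"
  obtains U where "unitary_between UNIV UNIV U" "\<And>g. g \<in> G \<Longrightarrow> U (A g) = A' g"
proof -
  obtain U where U: "bounded_clinear U" "\<And>x y. cinner (U x) (U y) = cinner x y"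
    "\<And>g. g \<in> G \<Longrightarrow> U (A g) = A' g"
    using isometry_extension[OF G A A' eq dense] by metis
  obtain V where V: "bounded_clinear V" "\<And>g. g \<in> G \<Longrightarrow> V (A' g) = A g"
    using isometry_extension[OF G A' A eq[symmetric] dense'] by metis
  \<comment> \<open>An isometry need not be surjective. The extension \<open>V\<close> in the
    opposite direction is a right inverse of \<open>U\<close> on the dense range of
    \<open>A'\<close>, hence everywhere.\<close>
  have "closed_csubspace {y. U (V y) - y \<in> {0}}"
    by (rule closed_csubspace_vimage[OF _ closed_csubspace_zero])
      (rule bounded_clinear_minus[OF bounded_clinear_compose[OF U(1) V(1)] bounded_clinear_id(2)])
  then have "closure (A' ` G) \<subseteq> {y. U (V y) - y \<in> {0}}"
    by (intro closure_minimal closed_csubspace_closed) (auto simp: U(3) V(2))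
  then have UV: "U (V y) = y" for y using dense' by auto
  have "range U = UNIV" by (metis UV surjI)
  then have "unitary_between UNIV UNIV U"
    using U by (simp add: unitary_between_def clinear_on_def bounded_clinear_add bounded_clinear_scaleC)
  then show ?thesis using U(3) by (rule that)
qed

text \<open>Nothing is known about \<tau> off \<open>K\<close>, and \<open>id_tensor\<close> passes
  through \<open>Abs_ell2\<close>, so every computation is confined to families with all components
  in \<open>K\<close>.\<close>

locale unitary_subspaces =
  fixes K :: "'a::chilbert_space set" and K' :: "'b::chilbert_space set" and \<tau> :: "'a \<Rightarrow> 'b"
  assumes K: "closed_csubspace K" and K': "closed_csubspace K'" and \<tau>: "unitary_between K K' \<tau>"
begin

abbreviation fock_K :: "('n, 'a) fock_tensor set"
  where "fock_K \<equiv> {f. \<forall>w. comp_of f w \<in> K}"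

lemma comp_of_id_tensor: "f \<in> fock_K \<Longrightarrow> comp_of (id_tensor \<tau> f) w = \<tau> (comp_of f w)"
  unfolding id_tensor_def by (subst comp_of_Abs_ell2_isometric) (auto simp: unitary_norm[OF \<tau>])

lemma id_tensor_cinner:
  "f \<in> fock_K \<Longrightarrow> g \<in> fock_K \<Longrightarrow> cinner (id_tensor \<tau> f) (id_tensor \<tau> g) = cinner f g"
  unfolding cinner_ell2_def by (simp add: comp_of_id_tensor unitary_cinner[OF \<tau>])

lemma id_tensor_norm: "f \<in> fock_K \<Longrightarrow> norm (id_tensor \<tau> f) = norm f"
  by (rule norm_eq_of_cinner) (rule id_tensor_cinner)

lemma id_tensor_add:
  assumes "f \<in> fock_K" "g \<in> fock_K"
  shows "id_tensor \<tau> (f + g) = id_tensor \<tau> f + id_tensor \<tau> g"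
proof (rule ell2_eqI)
  have "f + g \<in> fock_K" using assms by (auto simp: plus_ell2.rep_eq intro: closed_csubspace_add[OF K])
  then show "comp_of (id_tensor \<tau> (f + g)) w = comp_of (id_tensor \<tau> f + id_tensor \<tau> g) w" for w
    using assms by (simp add: comp_of_id_tensor plus_ell2.rep_eq unitary_add[OF \<tau>])
qed

lemma id_tensor_scaleC:
  assumes "f \<in> fock_K"
  shows "id_tensor \<tau> (c *\<^sub>C f) = c *\<^sub>C id_tensor \<tau> f"
proof (rule ell2_eqI)
  have "c *\<^sub>C f \<in> fock_K" using assms by (auto simp: scaleC_ell2.rep_eq intro: closed_csubspace_scaleC[OF K])
  then show "comp_of (id_tensor \<tau> (c *\<^sub>C f)) w = comp_of (c *\<^sub>C id_tensor \<tau> f) w" for w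
    using assms by (simp add: comp_of_id_tensor scaleC_ell2.rep_eq unitary_scaleC[OF \<tau>])
qed

lemma id_tensor_bshift:
  assumes "f \<in> fock_K"
  shows "bshift i (id_tensor \<tau> f) = id_tensor \<tau> (bshift i f)"
proof (rule ell2_eqI)
  have "bshift i f \<in> fock_K" using assms by (auto simp: bshift.rep_eq)
  then show "comp_of (bshift i (id_tensor \<tau> f)) w = comp_of (id_tensor \<tau> (bshift i f)) w" for w
    using assms by (simp add: comp_of_id_tensor bshift.rep_eq)
qed

lemma tensor_subspace_fock_K:
  "closed_csubspace M \<Longrightarrow> f \<in> tensor_subspace M K \<Longrightarrow> f \<in> fock_K"
  by (simp add: tensor_subspace_eq K)

lemma slice_id_tensor:
  "f \<in> fock_K \<Longrightarrow> y \<in> K \<Longrightarrow> slice (\<tau> y) (id_tensor \<tau> f) = slice y f"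
  by (rule ell2_eqI) (simp add: slice.rep_eq comp_of_id_tensor unitary_cinner[OF \<tau>])

text \<open>The slice of the image along \<tau> y is the slice of \<open>f\<close> along
  \<open>y\<close>, and \<tau> maps \<open>K\<close> onto \<open>K'\<close>; the conditions in
  \<open>tensor_subspace_eq\<close> therefore correspond.\<close>

lemma id_tensor_in_iff:
  assumes M: "closed_csubspace M" and f: "f \<in> fock_K"
  shows "id_tensor \<tau> f \<in> tensor_subspace M K' \<longleftrightarrow> f \<in> tensor_subspace M K"
proof -
  have "K' = \<tau> ` K" using \<tau> by (simp add: unitary_between_def)
  then have "(\<forall>y\<in>K'. slice y (id_tensor \<tau> f) \<in> M) \<longleftrightarrow> (\<forall>y\<in>K. slice y f \<in> M)"
    by (simp add: slice_id_tensor[OF f])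
  then show ?thesis
    using f by (simp add: tensor_subspace_eq M K K' comp_of_id_tensor unitary_in[OF \<tau>])
qed

lemma id_tensor_surj:
  fixes g :: "('n, 'b) fock_tensor"
  assumes g: "\<And>w. comp_of g w \<in> K'"
  shows "\<exists>f\<in>fock_K. g = id_tensor \<tau> f"
proof -
  have "\<forall>w. \<exists>x\<in>K. comp_of g w = \<tau> x" using unitary_surj[OF \<tau> g] by blast
  then obtain x where x: "\<And>w. x w \<in> K" "\<And>w. comp_of g w = \<tau> (x w)" by metis
  have "norm (x w) = norm (comp_of g w)" for w by (simp add: x unitary_norm[OF \<tau>])
  then have comp: "comp_of (Abs_ell2 x) = x"
    using comp_of_summable[of g] by (intro comp_of_Abs_ell2) simp
  then have "Abs_ell2 x \<in> fock_K" using x by simp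
  moreover from this have "g = id_tensor \<tau> (Abs_ell2 x)"
    by (intro ell2_eqI) (simp add: comp_of_id_tensor comp x)
  ultimately show ?thesis by blast
qed

lemma id_tensor_surj_tensor:
  assumes M: "closed_csubspace M" and g: "g \<in> tensor_subspace M K'"
  shows "\<exists>f\<in>tensor_subspace M K. g = id_tensor \<tau> f"
proof -
  obtain f where f: "f \<in> fock_K" "g = id_tensor \<tau> f"
    using id_tensor_surj[of g] g by (auto simp: tensor_subspace_eq M K')
  then show ?thesis using id_tensor_in_iff[OF M f(1)] g by blast
qed

end

section \<open>Coincidence implies unitary equivalence\<close>

text \<open>If \<open>h\<close> is orthogonal to the image, then it is orthogonal to the adjoint
  transform of \<open>poisson h\<close>, an admissible argument by \<open>poisson_in\<close>. So
  \<open>poisson h\<close> has norm 0, and the kernel is injective.\<close>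

lemma (in row_contr) poisson_adj_dense:
  assumes J: "wot_closed_ideal J" and cnc: "completely_non_coisometric T" and "constrained J T"
  shows "closure (poisson_adj ` tensor_subspace (N_space J) (defect_space T)) = UNIV"
proof (rule closure_eq_UNIV)
  let ?G = "tensor_subspace (N_space J) (defect_space T)"
  note G = closed_csubspace_tensor_subspace[of "N_space J" "defect_space T"]
  show "0 \<in> poisson_adj ` ?G"
    by (rule image_eqI[of _ _ 0]) (simp_all add: bounded_clinear_zero[OF poisson_adj_linear] closed_csubspace_0[OF G])
  show "x + y \<in> poisson_adj ` ?G" if xy: "x \<in> poisson_adj ` ?G" "y \<in> poisson_adj ` ?G" for x y
  proof -
    obtain u v where "u \<in> ?G" "v \<in> ?G" "x = poisson_adj u" "y = poisson_adj v" using xy by blast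
    then show ?thesis
      by (intro image_eqI[of _ _ "u + v"])
        (simp_all add: bounded_clinear_add[OF poisson_adj_linear] closed_csubspace_add[OF G])
  qed
  show "c *\<^sub>C x \<in> poisson_adj ` ?G" if x: "x \<in> poisson_adj ` ?G" for c x
  proof -
    obtain u where "u \<in> ?G" "x = poisson_adj u" using x by blast
    then show ?thesis
      by (intro image_eqI[of _ _ "c *\<^sub>C u"])
        (simp_all add: bounded_clinear_scaleC[OF poisson_adj_linear] closed_csubspace_scaleC[OF G])
  qed
  fix h assume *: "\<And>y. y \<in> poisson_adj ` ?G \<Longrightarrow> cinner h y = 0"
  have "poisson h \<in> ?G" by (rule poisson_in[OF J \<open>constrained J T\<close>])
  then have "cinner h (poisson_adj (poisson h)) = 0" by (intro * imageI)
  then have "poisson h = 0" by (simp add: cinner_poisson[symmetric] cinner_self_zero_iff)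
  then show "h = 0" by (rule poisson_injective[OF cnc])
qed

lemma coincide_imp_unitarily_equivalent:
  fixes J :: "('n::finite fock \<Rightarrow> 'n fock) set"
    and T :: "'n \<Rightarrow> 'h::chilbert_space \<Rightarrow> 'h" and T' :: "'n \<Rightarrow> 'k::chilbert_space \<Rightarrow> 'k"
  assumes J: "wot_closed_ideal J"
    and T: "row_contraction T" "completely_non_coisometric T" "constrained J T"
    and T': "row_contraction T'" "completely_non_coisometric T'" "constrained J T'"
    and coin: "coincide J (defect_space_star T) (defect_space T) (constrained_char_function J T)
      (defect_space_star T') (defect_space T') (constrained_char_function J T')"
  shows "unitarily_equivalent T T'"
proof -
  interpret A: row_contr T by standard (rule T(1))
  interpret B: row_contr T' by standard (rule T'(1))
  obtain \<tau>1 \<tau>2 where \<tau>1: "unitary_between (defect_space_star T) (defect_space_star T') \<tau>1"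
    and \<tau>2: "unitary_between (defect_space T) (defect_space T') \<tau>2"
    and eq: "\<And>f. f \<in> tensor_subspace (N_space J) (defect_space_star T) \<Longrightarrow>
      constrained_char_function J T' (id_tensor \<tau>1 f) = id_tensor \<tau>2 (constrained_char_function J T f)"
    using coin unfolding coincide_def by blast
  interpret t1: unitary_subspaces "defect_space_star T" "defect_space_star T'" \<tau>1
    by standard (rule A.defect_space_star_closed B.defect_space_star_closed \<tau>1)+
  interpret t2: unitary_subspaces "defect_space T" "defect_space T'" \<tau>2
    by standard (rule A.defect_space_closed B.defect_space_closed \<tau>2)+
  let ?G = "tensor_subspace (N_space J) (defect_space T)"
  let ?S = "tensor_subspace (N_space J) (defect_space_star T)"
  let ?G' = "tensor_subspace (N_space J) (defect_space T')"
  let ?S' = "tensor_subspace (N_space J) (defect_space_star T')"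
  note N = N_space_closed[of J]
  note G = closed_csubspace_tensor_subspace[of "N_space J" "defect_space T"]
  note fG = t2.tensor_subspace_fock_K[OF N] and fS = t1.tensor_subspace_fock_K[OF N]
  have inG: "id_tensor \<tau>2 g \<in> ?G'" if "g \<in> ?G" for g
    using that t2.id_tensor_in_iff[OF N fG[OF that]] by blast
  have inS: "id_tensor \<tau>1 f \<in> ?S'" if "f \<in> ?S" for f
    using that t1.id_tensor_in_iff[OF N fS[OF that]] by blast
  have adj: "id_tensor \<tau>1 (A.char_adj g) = B.char_adj (id_tensor \<tau>2 g)" if g: "g \<in> ?G" for g
  proof -
    let ?d = "id_tensor \<tau>1 (A.char_adj g) - B.char_adj (id_tensor \<tau>2 g)"
    have Ag: "A.char_adj g \<in> ?S" by (rule A.char_adj_in_tensor[OF J g])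
    have "?d \<in> ?S'"
      by (rule closed_csubspace_diff[OF closed_csubspace_tensor_subspace inS[OF Ag]
            B.char_adj_in_tensor[OF J inG[OF g]]])
    \<comment> \<open>The coincidence speaks only about vectors of the form I \<otimes> \<tau>1
      applied to some \<open>f\<close>. Writing the difference in this form allows it to be paired
      with itself.\<close>
    then obtain f where f: "f \<in> ?S" "?d = id_tensor \<tau>1 f"
      using t1.id_tensor_surj_tensor[OF N] by blast
    have "constrained_char_function J T f \<in> ?G"
      unfolding constrained_char_function_def by (rule ortho_proj_in[OF G])
    then have "cinner (id_tensor \<tau>1 f) (B.char_adj (id_tensor \<tau>2 g)) = cinner (id_tensor \<tau>1 f) (id_tensor \<tau>1 (A.char_adj g))"
      using f(1) g
      by (simp add: B.cinner_constrained_char_function[OF inS inG, symmetric] eq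
          t2.id_tensor_cinner[OF fG fG] A.cinner_constrained_char_function
          t1.id_tensor_cinner[OF fS fS[OF Ag]])
    then have "cinner ?d ?d = 0" unfolding f(2)[symmetric] by (simp add: cinner.diff_right)
    then show ?thesis by (simp add: cinner_self_zero_iff)
  qed
  have norm_eq: "norm (A.poisson_adj g) = norm (B.poisson_adj (id_tensor \<tau>2 g))" if g: "g \<in> ?G" for g
  proof -
    have "norm (A.char_adj g) = norm (B.char_adj (id_tensor \<tau>2 g))"
      using t1.id_tensor_norm[OF fS[OF A.char_adj_in_tensor[OF J g]]] adj[OF g] by simp
    moreover have "norm (id_tensor \<tau>2 g) = norm g" by (rule t2.id_tensor_norm[OF fG[OF g]])
    ultimately have "(norm (A.poisson_adj g))\<^sup>2 = (norm (B.poisson_adj (id_tensor \<tau>2 g)))\<^sup>2"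
      using A.norm_char_adj_poisson_adj[of g] B.norm_char_adj_poisson_adj[of "id_tensor \<tau>2 g"]
      by (metis add_left_imp_eq)
    then show ?thesis by (simp add: power2_eq_iff_nonneg)
  qed
  have linA: "clinear_on ?G A.poisson_adj"
    by (simp add: clinear_on_def bounded_clinear_add[OF A.poisson_adj_linear]
        bounded_clinear_scaleC[OF A.poisson_adj_linear])
  have linB: "clinear_on ?G (\<lambda>g. B.poisson_adj (id_tensor \<tau>2 g))"
    by (simp add: clinear_on_def t2.id_tensor_add[OF fG fG] t2.id_tensor_scaleC[OF fG]
        bounded_clinear_add[OF B.poisson_adj_linear] bounded_clinear_scaleC[OF B.poisson_adj_linear])
  have "id_tensor \<tau>2 ` ?G = ?G'"
    using inG t2.id_tensor_surj_tensor[OF N] by blast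
  then have "closure ((\<lambda>g. B.poisson_adj (id_tensor \<tau>2 g)) ` ?G) = UNIV"
    using B.poisson_adj_dense[OF J T'(2,3)] by (metis image_image)
  then obtain U where U: "unitary_between UNIV UNIV U"
    and UA: "\<And>g. g \<in> ?G \<Longrightarrow> U (A.poisson_adj g) = B.poisson_adj (id_tensor \<tau>2 g)"
    using isometry_extension_unitary[OF G linA linB norm_eq A.poisson_adj_dense[OF J T(2,3)]] by metis
  have Pin: "A.poisson h \<in> ?G" for h by (rule A.poisson_in[OF J T(3)])
  \<comment> \<open>The relation for the adjoint transforms, dualized. Both sides lie in
    \<open>?G'\<close>, so testing against the vectors \<open>id_tensor \<tau>2 g\<close> is
    enough.\<close>
  have kernel: "B.poisson (U h) = id_tensor \<tau>2 (A.poisson h)" for h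
  proof -
    let ?d = "B.poisson (U h) - id_tensor \<tau>2 (A.poisson h)"
    have "?d \<in> ?G'"
      by (rule closed_csubspace_diff[OF closed_csubspace_tensor_subspace B.poisson_in[OF J T'(3)] inG[OF Pin]])
    then obtain g where g: "g \<in> ?G" "?d = id_tensor \<tau>2 g"
      using t2.id_tensor_surj_tensor[OF N] by blast
    have "cinner (B.poisson (U h)) (id_tensor \<tau>2 g) = cinner (id_tensor \<tau>2 (A.poisson h)) (id_tensor \<tau>2 g)"
      using g(1) by (simp add: B.cinner_poisson UA[symmetric] unitary_cinner[OF U]
          t2.id_tensor_cinner[OF fG[OF Pin] fG] A.cinner_poisson)
    then have "cinner ?d ?d = 0" unfolding g(2)[symmetric] by (simp add: cinner.diff_left)
    then show ?thesis by (simp add: cinner_self_zero_iff)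
  qed
  \<comment> \<open>After applying the injective kernel of \<open>T'\<close>, this is the
    commutation of I \<otimes> \<tau>2 with the backward shifts.\<close>
  have inter_adj: "U (cadjoint (T i) h) = cadjoint (T' i) (U h)" for i h
  proof -
    have "B.poisson (U (cadjoint (T i) h)) = B.poisson (cadjoint (T' i) (U h))"
      by (simp add: kernel A.bshift_poisson[symmetric] t2.id_tensor_bshift[OF fG[OF Pin], symmetric])
        (simp add: kernel[symmetric] B.bshift_poisson)
    then have "B.poisson (U (cadjoint (T i) h) - cadjoint (T' i) (U h)) = 0"
      by (simp add: bounded_clinear_diff[OF B.poisson_linear])
    then show ?thesis using B.poisson_injective[OF T'(2)] by fastforce
  qed
  have "U (T i h) = T' i (U h)" for i h
  proof (rule cinner_left_ext)
    fix z
    obtain k where z: "z = U k" using unitary_surj[OF U, of z] by blast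
    show "cinner (U (T i h)) z = cinner (T' i (U h)) z"
      by (simp add: z unitary_cinner[OF U] cinner_cadjoint[OF A.T_linear]
          cinner_cadjoint[OF B.T_linear] inter_adj[symmetric])
  qed
  then show ?thesis
    unfolding unitarily_equivalent_def using U by (auto intro!: exI[of _ U])
qed

section \<open>Unitary equivalence implies coincidence\<close>

text \<open>The lemmas transport each construction from \<open>T\<close> to \<open>T'\<close>.
  \<tau>2 will be \<open>U\<close> and \<tau>1 its entrywise extension \<open>U_row\<close>, both
  regarded as maps between the defect spaces.\<close>

locale unitary_intertwiner =
  A: row_contr T + B: row_contr T'
  for T :: "'n::finite \<Rightarrow> 'h::chilbert_space \<Rightarrow> 'h" and T' :: "'n \<Rightarrow> 'k::chilbert_space \<Rightarrow> 'k" +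
  fixes U :: "'h \<Rightarrow> 'k"
  assumes U: "unitary_between UNIV UNIV U" and UT: "U (T i h) = T' i (U h)"
begin

lemma U_linear: "bounded_clinear U"
  by (rule unitary_bounded_clinear[OF U])

lemma U_cinner [simp]: "cinner (U x) (U y) = cinner x y"
  by (rule unitary_cinner[OF U]) auto

lemma U_ext:
  assumes "\<And>k. cinner x (U k) = cinner y (U k)"
  shows "x = y"
proof (rule cinner_left_ext)
  fix z
  obtain k where "z = U k" using unitary_surj[OF U, of z] by blast
  then show "cinner x z = cinner y z" by (simp add: assms)
qed

lemma U_adj: "U (cadjoint (T i) h) = cadjoint (T' i) (U h)"
  by (rule U_ext) (simp add: cinner_cadjoint'[OF A.T_linear] cinner_cadjoint'[OF B.T_linear] UT[symmetric])

definition U_row :: "('n, 'h) ell2 \<Rightarrow> ('n, 'k) ell2"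
  where "U_row x = Abs_ell2 (\<lambda>i. U (comp_of x i))"

lemma comp_of_U_row: "comp_of (U_row x) i = U (comp_of x i)"
  by (simp add: U_row_def comp_of_Abs_ell2_finite)

lemma U_row_cinner: "cinner (U_row x) (U_row y) = cinner x y"
  by (simp add: cinner_ell2_finite comp_of_U_row)

lemma U_row_linear: "bounded_clinear U_row"
proof (rule bounded_clinearI[where K=1])
  show "U_row (x + y) = U_row x + U_row y" for x y
    by (rule ell2_eqI) (simp add: comp_of_U_row plus_ell2.rep_eq bounded_clinear_add[OF U_linear])
  show "U_row (c *\<^sub>C x) = c *\<^sub>C U_row x" for c x
    by (rule ell2_eqI) (simp add: comp_of_U_row scaleC_ell2.rep_eq bounded_clinear_scaleC[OF U_linear])
  show "norm (U_row x) \<le> 1 * norm x" for x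
    using norm_eq_of_cinner[OF U_row_cinner, of x] by simp
qed

lemma row_op_U_row: "row_op T' (U_row x) = U (row_op T x)"
  by (simp add: row_op_def comp_of_U_row bounded_clinear_sum[OF U_linear] UT)

lemma row_adj_U: "B.row_adj (U h) = U_row (A.row_adj h)"
  by (rule ell2_eqI) (simp add: B.comp_of_row_adj comp_of_U_row A.comp_of_row_adj U_adj)

lemma defect_U: "U (defect_op T h) = defect_op T' (U h)"
  unfolding A.defect_op_eq B.defect_op_eq
  by (rule positive_sqrt_intertwine[OF A.selfadj1 B.selfadj1 U_linear])
    (simp add: row_adj_U row_op_U_row)

lemma defect_star_U: "U_row (defect_op_star T x) = defect_op_star T' (U_row x)"
  unfolding A.defect_op_star_eq B.defect_op_star_eq
  by (rule positive_sqrt_intertwine[OF A.selfadj2 B.selfadj2 U_row_linear])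
    (simp add: row_adj_U row_op_U_row)

section \<open>Transport of the defect spaces\<close>

lemma U_defect_space: "h \<in> defect_space T \<Longrightarrow> U h \<in> defect_space T'"
proof -
  have "closure (range (defect_op T)) \<subseteq> {h. U h \<in> defect_space T'}"
    using closed_csubspace_closed[OF closed_csubspace_vimage[OF U_linear B.defect_space_closed]]
    by (intro closure_minimal) (auto simp: defect_U B.defect_in)
  then show "h \<in> defect_space T \<Longrightarrow> U h \<in> defect_space T'"
    by (auto simp: defect_space_def)
qed

lemma U_row_defect_space_star: "x \<in> defect_space_star T \<Longrightarrow> U_row x \<in> defect_space_star T'"
proof -
  have "closure (range (defect_op_star T)) \<subseteq> {x. U_row x \<in> defect_space_star T'}"
    using closed_csubspace_closed[OF closed_csubspace_vimage[OF U_row_linear B.defect_space_star_closed]]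
    by (intro closure_minimal) (auto simp: defect_star_U B.defect_star_in)
  then show "x \<in> defect_space_star T \<Longrightarrow> U_row x \<in> defect_space_star T'"
    by (auto simp: defect_space_star_def)
qed

text \<open>The situation is symmetric in \<open>T\<close> and \<open>T'\<close>, so inclusions of
  defect spaces proved for \<open>U\<close> give the opposite ones through \<open>V\<close>.\<close>

lemma inverse_intertwiner:
  obtains V where "unitary_intertwiner T' T V" "\<And>h. V (U h) = h" "\<And>k. U (V k) = k"
proof -
  obtain V where V: "unitary_between UNIV UNIV V" "\<And>x. V (U x) = x" "\<And>y. U (V y) = y"
    by (rule unitary_inverse[OF U]) (use that in blast)
  have "V (T' i k) = T i (V k)" for i k
    using V(2)[of "T i (V k)"] by (simp add: UT V(3))
  then have "unitary_intertwiner T' T V"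
    using V(1) by unfold_locales auto
  then show ?thesis using V(2,3) by (rule that)
qed

lemma unitary_defect_space: "unitary_between (defect_space T) (defect_space T') U"
  and unitary_defect_space_star:
    "unitary_between (defect_space_star T) (defect_space_star T') U_row"
  and U_row_surj: "\<exists>x. y = U_row x"
proof -
  obtain V where V: "unitary_intertwiner T' T V" "\<And>h. V (U h) = h" "\<And>k. U (V k) = k"
    by (rule inverse_intertwiner) (use that in blast)
  interpret V: unitary_intertwiner T' T V by (rule V(1))
  have "U ` defect_space T = defect_space T'"
  proof (intro equalityI subsetI)
    show "k \<in> U ` defect_space T" if "k \<in> defect_space T'" for k
      using V.U_defect_space[OF that] by (rule image_eqI[rotated]) (simp add: V(3))
  qed (auto simp: U_defect_space)
  then show "unitary_between (defect_space T) (defect_space T') U"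
    using U_linear by (simp add: unitary_between_def clinear_on_def bounded_clinear_add bounded_clinear_scaleC)
  have UV: "U_row (V.U_row y) = y" for y
    by (rule ell2_eqI) (simp add: comp_of_U_row V.comp_of_U_row V(3))
  then show "\<exists>x. y = U_row x" by metis
  have "U_row ` defect_space_star T = defect_space_star T'"
  proof (intro equalityI subsetI)
    show "y \<in> U_row ` defect_space_star T" if "y \<in> defect_space_star T'" for y
      using V.U_row_defect_space_star[OF that] by (rule image_eqI[rotated]) (simp add: UV)
  qed (auto simp: U_row_defect_space_star)
  then show "unitary_between (defect_space_star T) (defect_space_star T') U_row"
    using U_row_linear
    by (simp add: unitary_between_def clinear_on_def bounded_clinear_add bounded_clinear_scaleC U_row_cinner)
qed

lemma unitary_U_row: "unitary_between UNIV UNIV U_row"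
proof -
  have "range U_row = UNIV" using U_row_surj by auto
  then show ?thesis
    using U_row_linear
    by (simp add: unitary_between_def clinear_on_def bounded_clinear_add bounded_clinear_scaleC U_row_cinner)
qed

text \<open>On whole spaces the identities for I \<otimes> U need no membership conditions. The
  restrictions to the defect spaces come in only for statements about N_J \<otimes> D.\<close>

sublocale u: unitary_subspaces UNIV UNIV U
  by standard (rule closed_csubspace_UNIV U)+

sublocale r: unitary_subspaces UNIV UNIV U_row
  by standard (rule closed_csubspace_UNIV unitary_U_row)+

lemma word_adj_U: "B.word_adj w (U h) = U (A.word_adj w h)"
  by (induction w arbitrary: h) (simp_all add: U_adj[symmetric])

lemma poisson_U: "B.poisson (U h) = id_tensor U (A.poisson h)"
  by (rule ell2_eqI) (simp add: u.comp_of_id_tensor A.comp_of_poisson B.comp_of_poisson word_adj_U defect_U)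

lemma poisson_adj_U: "B.poisson_adj (id_tensor U y) = U (A.poisson_adj y)"
  by (rule U_ext) (simp add: B.cinner_poisson_adj A.cinner_poisson_adj poisson_U u.id_tensor_cinner)

lemma fold_bshift_U: "fold bshift w (id_tensor U y) = id_tensor U (fold bshift w y)"
  by (induction w arbitrary: y) (simp_all add: u.id_tensor_bshift)

lemma char_adj_U: "B.char_adj (id_tensor U y) = id_tensor U_row (A.char_adj y)"
proof (rule ell2_eqI)
  have "B.poisson_row (id_tensor U y) = U_row (A.poisson_row y)" for y
    by (rule ell2_eqI) (simp add: B.comp_of_poisson_row comp_of_U_row A.comp_of_poisson_row
        u.id_tensor_bshift poisson_adj_U)
  then have "B.char_adj0 (id_tensor U y) = U_row (A.char_adj0 y)" for y
    by (simp add: B.char_adj0_def A.char_adj0_def defect_star_U u.comp_of_id_tensor row_adj_U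
        bounded_clinear_diff[OF U_row_linear])
  then show "comp_of (B.char_adj (id_tensor U y)) w = comp_of (id_tensor U_row (A.char_adj y)) w" for w
    by (simp add: B.comp_of_char_adj r.comp_of_id_tensor A.comp_of_char_adj fold_bshift_U)
qed

text \<open>Dual to \<open>char_adj_U\<close>: every vector of the target space has the form I
  \<otimes> U applied to some \<open>y\<close>, and it suffices to test against these.\<close>

lemma char_op_U: "B.char_op (id_tensor U_row f) = id_tensor U (A.char_op f)"
proof (rule cinner_left_ext)
  fix z :: "('n, 'k) fock_tensor"
  obtain y where "z = id_tensor U y" using u.id_tensor_surj[of z] by auto
  then show "cinner (B.char_op (id_tensor U_row f)) z = cinner (id_tensor U (A.char_op f)) z"
    by (simp add: B.cinner_char_op char_adj_U r.id_tensor_cinner u.id_tensor_cinner A.cinner_char_op)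
qed

lemma coincide_char_functions:
  "coincide J (defect_space_star T) (defect_space T) (constrained_char_function J T)
    (defect_space_star T') (defect_space T') (constrained_char_function J T')"
  unfolding coincide_def
proof (intro exI conjI ballI)
  show "unitary_between (defect_space_star T) (defect_space_star T') U_row"
    by (rule unitary_defect_space_star)
  show "unitary_between (defect_space T) (defect_space T') U"
    by (rule unitary_defect_space)
  interpret d: unitary_subspaces "defect_space T" "defect_space T'" U
    by standard (rule A.defect_space_closed B.defect_space_closed unitary_defect_space)+
  interpret ds: unitary_subspaces "defect_space_star T" "defect_space_star T'" U_row
    by standard (rule A.defect_space_star_closed B.defect_space_star_closed unitary_defect_space_star)+
  note N = N_space_closed[of J]
  let ?G = "tensor_subspace (N_space J) (defect_space T)"
  let ?G' = "tensor_subspace (N_space J) (defect_space T')"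
  note G = closed_csubspace_tensor_subspace[of "N_space J" "defect_space T"]
  note G' = closed_csubspace_tensor_subspace[of "N_space J" "defect_space T'"]
  fix f assume f: "f \<in> tensor_subspace (N_space J) (defect_space_star T)"
  have f': "id_tensor U_row f \<in> tensor_subspace (N_space J) (defect_space_star T')"
    using f ds.id_tensor_in_iff[OF N ds.tensor_subspace_fock_K[OF N f]] by blast
  have mono: "x \<in> tensor_subspace (N_space J) K \<Longrightarrow> x \<in> tensor_subspace UNIV K"
    for x :: "('n, 'c::complex_inner) fock_tensor" and K
    using tensor_subspace_mono[of "N_space J" UNIV K] by blast
  let ?p = "ortho_proj ?G (A.char_op f)"
  have p: "?p \<in> ?G" and q: "A.char_op f - ?p \<in> ortho_compl ?G"
    using ortho_proj_in[OF G] ortho_proj_compl[OF G] by auto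
  \<comment> \<open>I \<otimes> U maps \<open>?G\<close> onto \<open>?G'\<close> and preserves inner
    products, so it carries the two conditions characterizing the projection onto \<open>?G\<close>
    to those for \<open>?G'\<close>.\<close>
  have "ortho_proj ?G' (id_tensor U (A.char_op f)) = id_tensor U ?p"
  proof (rule ortho_proj_eqI[OF G'])
    show "id_tensor U ?p \<in> ?G'"
      using p d.id_tensor_in_iff[OF N d.tensor_subspace_fock_K[OF N p]] by blast
    show "id_tensor U (A.char_op f) - id_tensor U ?p \<in> ortho_compl ?G'"
    proof (rule ortho_complI)
      fix z assume "z \<in> ?G'"
      then obtain y where y: "y \<in> ?G" "z = id_tensor U y"
        using d.id_tensor_surj_tensor[OF N] by blast
      have "cinner (id_tensor U (A.char_op f) - id_tensor U ?p) z = cinner (A.char_op f - ?p) y"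
        by (simp add: y(2) cinner.diff_left u.id_tensor_cinner)
      also have "\<dots> = 0" by (rule ortho_complD[OF q y(1)])
      finally show "cinner (id_tensor U (A.char_op f) - id_tensor U ?p) z = 0" .
    qed
  qed
  then show "constrained_char_function J T' (id_tensor U_row f) =
      id_tensor U (constrained_char_function J T f)"
    by (simp add: constrained_char_function_def A.char_function_eq[OF mono[OF f]]
        B.char_function_eq[OF mono[OF f']] char_op_U)
qed

end

theorem theorem2p5:
  fixes J :: "('n::finite fock \<Rightarrow> 'n fock) set"
    and T :: "'n \<Rightarrow> 'h::chilbert_space \<Rightarrow> 'h"
    and T' :: "'n \<Rightarrow> 'k::chilbert_space \<Rightarrow> 'k"
  assumes "wot_closed_ideal J" and "J \<noteq> nc_toeplitz"
    and "row_contraction T" and "completely_non_coisometric T" and "constrained J T"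
    and "row_contraction T'" and "completely_non_coisometric T'" and "constrained J T'"
  shows "unitarily_equivalent T T' \<longleftrightarrow>
    coincide J (defect_space_star T) (defect_space T) (constrained_char_function J T)
      (defect_space_star T') (defect_space T') (constrained_char_function J T')"
proof
  assume "unitarily_equivalent T T'"
  then obtain U where U: "unitary_between UNIV UNIV U" "\<And>i. U \<circ> T i = T' i \<circ> U"
    unfolding unitarily_equivalent_def by blast
  have "U (T i h) = T' i (U h)" for i h
    using fun_cong[OF U(2), of i h] by simp
  then interpret unitary_intertwiner T T' U
    using assms U(1) by unfold_locales auto
  show "coincide J (defect_space_star T) (defect_space T) (constrained_char_function J T)
      (defect_space_star T') (defect_space T') (constrained_char_function J T')"
    by (rule coincide_char_functions)
qed (rule coincide_imp_unitarily_equivalent[OF assms(1,3-8)])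

end
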